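(* Let $n\ge 3$, $\rho\in\{1,-1\}$, and let $V$ be a finite-dimensional irreducible representation of the complex Lie algebra $\mathfrak{g}_{2n,\rho}(\mathbb{C}_q)$ with $\dim V\ge 2$, where $\mathbb{C}_q$ is the quantum torus with involution attached to a triple $(q,\theta_1,\theta_2)\in\mathcal{P}$. Let $\mathrm{Ann}(V)=\{x\in\mathfrak{g}_{2n,\rho}(\mathbb{C}_q) : x.V=0\}$. (1) If $q=-1$ or $(q,\theta_1,\theta_2)=(1,1,1)$, then there exists an integer $k\ge 0$ such that $$\mathfrak{g}_{2n,\rho}(\mathbb{C}_q)/\mathrm{Ann}(V)\cong \mathfrak{g}_{2mn,\theta_1\rho}(\mathbb{C})^{k},$$ where $m$ is the multiplicative order of $q$ and $\mathbb{C}$ carries the identity involution. (2) If $(q,\theta_1,\theta_2)=(1,1,-1)$ or $(1,-1,-1)$, then there exists an integer $k\ge 0$ such that $$\mathfrak{g}_{2n,\rho}(\mathbb{C}_q)/\mathrm{Ann}(V)\cong \mathfrak{sl}_{2n}(\mathbb{C})^{k}.$$ Here a power $\mathfrak{a}^k$ of a Lie algebra denotes the direct sum of $k$ copies, and isomorphisms are of Lie algebras.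
   Context: Lie algebra $\mathfrak{g}_{2n,\rho}(R)$: let $R$ be a unital associative algebra over a field $k$ of characteristic $0$ with an involution, i.e. a $k$-linear map $a\mapsto\bar a$ with $\overline{ab}=\bar b\,\bar a$ and $\bar{\bar a}=a$. For $\rho\in\{1,-1\}$, $n\ge1$, $a\in R$, let $e_{ij}(a)\in\mathfrak{gl}_{2n}(R)$ be the matrix with $a$ in position $(i,j)$ and $0$ elsewhere, and for $1\le i,j\le n$ put $f_{ij}(a)=e_{ij}(a)-e_{n+j,n+i}(\bar a)$, $g_{ij}(a)=e_{i,n+j}(a)-\rho e_{j,n+i}(\bar a)$, $h_{ij}(a)=e_{n+i,j}(a)-\rho e_{n+j,i}(\bar a)$. Then $\mathfrak{g}_{2n,\rho}(R)$ is the Lie subalgebra of $\mathfrak{gl}_{2n}(R)$ generated by all $f_{ij}(a)$ ($1\le i\ne j\le n$), $g_{ij}(a)$, $h_{ij}(a)$ ($1\le i\le j\le n$), $a\in R$. Quantum torus: for $q\in\{1,-1\}$, $\mathbb{C}_q$ is the associative $\mathbb{C}$-algebra generated by $t_1^{\pm1},t_2^{\pm1}$ with relations $t_it_i^{-1}=t_i^{-1}t_i=1$ and $t_2t_1=qt_1t_2$; $m$ is the order of $q$ ($m=1$ if $q=1$, $m=2$ if $q=-1$). It carries the $\mathbb{C}$-linear involution with $\overline{t_1}=\theta_1t_1$, $\overline{t_2}=\theta_2t_2$, where $\theta_1,\theta_2\in\{1,-1\}$. $\mathcal{P}=\{(-1,1,1),(-1,1,-1),(-1,-1,-1),(1,1,1),(1,1,-1),(1,-1,-1)\}$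 is the set of triples $(q,\theta_1,\theta_2)$ considered. *)

theory Defs
  imports
    Complex_Main
    "HOL-Library.FuncSet"
    "HOL-Library.Poly_Mapping"
    "HOL-Library.Product_Plus"
begin

section \<open>Associative algebras with involution\<close>

text \<open>The underlying additive group is that of the type; the record holds the remaining operations.\<close>

record ('k, 'r) inv_algebra =
  amult :: "'r \<Rightarrow> 'r \<Rightarrow> 'r"
  aone :: 'r
  ascale :: "'k \<Rightarrow> 'r \<Rightarrow> 'r"
  astar :: "'r \<Rightarrow> 'r"

locale inv_algebra =
  fixes R :: "('k::field_char_0, 'r::ab_group_add) inv_algebra"
  assumes scale: "vector_space (ascale R)"
    and mult_assoc: "amult R (amult R a b) c = amult R a (amult R b c)"
    and one_mult: "amult R (aone R) a = a"
    and mult_one: "amult R a (aone R) = a"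
    and mult_add_left: "amult R (a + b) c = amult R a c + amult R b c"
    and mult_add_right: "amult R a (b + c) = amult R a b + amult R a c"
    and mult_scale_left: "amult R (ascale R k a) b = ascale R k (amult R a b)"
    and mult_scale_right: "amult R a (ascale R k b) = ascale R k (amult R a b)"
    and star_add: "astar R (a + b) = astar R a + astar R b"
    and star_scale: "astar R (ascale R k a) = ascale R k (astar R a)"
    and star_mult: "astar R (amult R a b) = amult R (astar R b) (astar R a)"
    and star_star: "astar R (astar R a) = a"

definition complex_algebra :: "(complex, complex) inv_algebra" where
  "complex_algebra = \<lparr>amult = (*), aone = 1, ascale = (*), astar = (\<lambda>z. z)\<rparr>"

lemma inv_algebra_complex: "inv_algebra complex_algebra"
  by standard (auto simp: complex_algebra_def algebra_simps vector_space_def)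


section \<open>Lie algebras\<close>

record ('k, 'a) lie_algebra =
  lcarrier :: "'a set"
  lzero :: 'a
  ladd :: "'a \<Rightarrow> 'a \<Rightarrow> 'a"
  lscale :: "'k \<Rightarrow> 'a \<Rightarrow> 'a"
  lbracket :: "'a \<Rightarrow> 'a \<Rightarrow> 'a"

definition lie_subalgebra :: "'a set \<Rightarrow> ('k, 'a) lie_algebra \<Rightarrow> bool" where
  "lie_subalgebra H L \<longleftrightarrow> H \<subseteq> lcarrier L \<and> lzero L \<in> H \<and>
     (\<forall>x\<in>H. \<forall>y\<in>H. ladd L x y \<in> H) \<and> (\<forall>c. \<forall>x\<in>H. lscale L c x \<in> H) \<and>
     (\<forall>x\<in>H. \<forall>y\<in>H. lbracket L x y \<in> H)"

definition lie_generate :: "('k, 'a) lie_algebra \<Rightarrow> 'a set \<Rightarrow> ('k, 'a) lie_algebra" where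
  "lie_generate L S = L\<lparr>lcarrier := \<Inter>{H. lie_subalgebra H L \<and> S \<subseteq> H}\<rparr>"

definition lie_isomorphic :: "('k, 'a) lie_algebra \<Rightarrow> ('k, 'b) lie_algebra \<Rightarrow> bool" where
  "lie_isomorphic L M \<longleftrightarrow> (\<exists>f. bij_betw f (lcarrier L) (lcarrier M) \<and>
     (\<forall>x\<in>lcarrier L. \<forall>y\<in>lcarrier L. f (ladd L x y) = ladd M (f x) (f y)) \<and>
     (\<forall>c. \<forall>x\<in>lcarrier L. f (lscale L c x) = lscale M c (f x)) \<and>
     (\<forall>x\<in>lcarrier L. \<forall>y\<in>lcarrier L. f (lbracket L x y) = lbracket M (f x) (f y)))"

definition lie_coset :: "('k, 'a) lie_algebra \<Rightarrow> 'a set \<Rightarrow> 'a \<Rightarrow> 'a set" where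
  "lie_coset L I x = ladd L x ` I"

text \<open>The quotient by an ideal \<open>I\<close>: the unions below are over coset representatives, and
  for an ideal \<open>I\<close> each of them is a single coset.\<close>

definition lie_quotient :: "('k, 'a) lie_algebra \<Rightarrow> 'a set \<Rightarrow> ('k, 'a set) lie_algebra" where
  "lie_quotient L I =
     \<lparr>lcarrier = lie_coset L I ` lcarrier L,
      lzero = I,
      ladd = (\<lambda>A B. \<Union>a\<in>A. \<Union>b\<in>B. lie_coset L I (ladd L a b)),
      lscale = (\<lambda>c A. \<Union>a\<in>A. lie_coset L I (lscale L c a)),
      lbracket = (\<lambda>A B. \<Union>a\<in>A. \<Union>b\<in>B. lie_coset L I (lbracket L a b))\<rparr>"

definition lie_power :: "('k, 'a) lie_algebra \<Rightarrow> nat \<Rightarrow> ('k, nat \<Rightarrow> 'a) lie_algebra" where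
  "lie_power L k =
     \<lparr>lcarrier = {..<k} \<rightarrow>\<^sub>E lcarrier L,
      lzero = (\<lambda>i\<in>{..<k}. lzero L),
      ladd = (\<lambda>x y. \<lambda>i\<in>{..<k}. ladd L (x i) (y i)),
      lscale = (\<lambda>c x. \<lambda>i\<in>{..<k}. lscale L c (x i)),
      lbracket = (\<lambda>x y. \<lambda>i\<in>{..<k}. lbracket L (x i) (y i))\<rparr>"

text \<open>The representation space is the whole type \<open>'v\<close>, with scalar multiplication \<open>s\<close>.\<close>

definition lie_representation ::
  "('k::field, 'a) lie_algebra \<Rightarrow> ('k \<Rightarrow> 'v::ab_group_add \<Rightarrow> 'v) \<Rightarrow> ('a \<Rightarrow> 'v \<Rightarrow> 'v) \<Rightarrow> bool" where
  "lie_representation L s \<phi> \<longleftrightarrow> vector_space s \<and>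
     (\<forall>x\<in>lcarrier L. Vector_Spaces.linear s s (\<phi> x)) \<and>
     (\<forall>x\<in>lcarrier L. \<forall>y\<in>lcarrier L. \<forall>v. \<phi> (ladd L x y) v = \<phi> x v + \<phi> y v) \<and>
     (\<forall>c. \<forall>x\<in>lcarrier L. \<forall>v. \<phi> (lscale L c x) v = s c (\<phi> x v)) \<and>
     (\<forall>x\<in>lcarrier L. \<forall>y\<in>lcarrier L. \<forall>v.
        \<phi> (lbracket L x y) v = \<phi> x (\<phi> y v) - \<phi> y (\<phi> x v))"

definition lie_irreducible ::
  "('k::field, 'a) lie_algebra \<Rightarrow> ('k \<Rightarrow> 'v::ab_group_add \<Rightarrow> 'v) \<Rightarrow> ('a \<Rightarrow> 'v \<Rightarrow> 'v) \<Rightarrow> bool" where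
  "lie_irreducible L s \<phi> \<longleftrightarrow> lie_representation L s \<phi> \<and> (UNIV :: 'v set) \<noteq> {0} \<and>
     (\<forall>W. module.subspace s W \<and> (\<forall>x\<in>lcarrier L. \<forall>w\<in>W. \<phi> x w \<in> W) \<longrightarrow> W = {0} \<or> W = UNIV)"

definition lie_annihilator ::
  "('k, 'a) lie_algebra \<Rightarrow> ('a \<Rightarrow> 'v::ab_group_add \<Rightarrow> 'v) \<Rightarrow> 'a set" where
  "lie_annihilator L \<phi> = {x \<in> lcarrier L. \<forall>v. \<phi> x v = 0}"


section \<open>Matrix Lie algebras\<close>

text \<open>An \<open>N \<times> N\<close> matrix is a function vanishing outside the indices \<open>1, \<dots>, N\<close>.\<close>

definition mat_mult :: "('k, 'r::ab_group_add) inv_algebra \<Rightarrow> nat \<Rightarrow>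
    (nat \<Rightarrow> nat \<Rightarrow> 'r) \<Rightarrow> (nat \<Rightarrow> nat \<Rightarrow> 'r) \<Rightarrow> nat \<Rightarrow> nat \<Rightarrow> 'r" where
  "mat_mult R N A B = (\<lambda>i j. \<Sum>l = 1..N. amult R (A i l) (B l j))"

definition gl :: "nat \<Rightarrow> ('k, 'r::ab_group_add) inv_algebra \<Rightarrow> ('k, nat \<Rightarrow> nat \<Rightarrow> 'r) lie_algebra" where
  "gl N R =
     \<lparr>lcarrier = {A. \<forall>i j. i \<notin> {1..N} \<or> j \<notin> {1..N} \<longrightarrow> A i j = 0},
      lzero = (\<lambda>i j. 0),
      ladd = (\<lambda>A B i j. A i j + B i j),
      lscale = (\<lambda>c A i j. ascale R c (A i j)),
      lbracket = (\<lambda>A B i j. mat_mult R N A B i j - mat_mult R N B A i j)\<rparr>"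

definition sl :: "nat \<Rightarrow> (complex, nat \<Rightarrow> nat \<Rightarrow> complex) lie_algebra" where
  "sl N = (gl N complex_algebra)
     \<lparr>lcarrier := {A \<in> lcarrier (gl N complex_algebra). (\<Sum>i = 1..N. A i i) = 0}\<rparr>"

definition e_mat :: "nat \<Rightarrow> nat \<Rightarrow> 'r::ab_group_add \<Rightarrow> nat \<Rightarrow> nat \<Rightarrow> 'r" where
  "e_mat i j a = (\<lambda>k l. if k = i \<and> l = j then a else 0)"

definition f_mat :: "('k, 'r::ab_group_add) inv_algebra \<Rightarrow> nat \<Rightarrow>
    nat \<Rightarrow> nat \<Rightarrow> 'r \<Rightarrow> nat \<Rightarrow> nat \<Rightarrow> 'r" where
  "f_mat R n i j a = e_mat i j a - e_mat (n + j) (n + i) (astar R a)"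

definition g_mat :: "('k, 'r::ab_group_add) inv_algebra \<Rightarrow> nat \<Rightarrow> 'k \<Rightarrow>
    nat \<Rightarrow> nat \<Rightarrow> 'r \<Rightarrow> nat \<Rightarrow> nat \<Rightarrow> 'r" where
  "g_mat R n \<rho> i j a = e_mat i (n + j) a - e_mat j (n + i) (ascale R \<rho> (astar R a))"

definition h_mat :: "('k, 'r::ab_group_add) inv_algebra \<Rightarrow> nat \<Rightarrow> 'k \<Rightarrow>
    nat \<Rightarrow> nat \<Rightarrow> 'r \<Rightarrow> nat \<Rightarrow> nat \<Rightarrow> 'r" where
  "h_mat R n \<rho> i j a = e_mat (n + i) j a - e_mat (n + j) i (ascale R \<rho> (astar R a))"

text \<open>\<open>g_lie n \<rho> R\<close> is $\mathfrak{g}_{2n,\rho}(R)$: the first argument is half the matrix size.\<close>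

definition g_lie :: "nat \<Rightarrow> 'k \<Rightarrow> ('k, 'r::ab_group_add) inv_algebra \<Rightarrow>
    ('k, nat \<Rightarrow> nat \<Rightarrow> 'r) lie_algebra" where
  "g_lie n \<rho> R = lie_generate (gl (2 * n) R)
     ({f_mat R n i j a | i j a. i \<in> {1..n} \<and> j \<in> {1..n} \<and> i \<noteq> j} \<union>
      {g_mat R n \<rho> i j a | i j a. 1 \<le> i \<and> i \<le> j \<and> j \<le> n} \<union>
      {h_mat R n \<rho> i j a | i j a. 1 \<le> i \<and> i \<le> j \<and> j \<le> n})"


section \<open>The quantum torus\<close>

text \<open>\<open>Poly_Mapping.single (a, b) c\<close> stands for $c\,t_1^a t_2^b$; the product is the bilinear
  extension of $t_1^a t_2^b \cdot t_1^c t_2^d = q^{bc} t_1^{a+c} t_2^{b+d}$. That this is the algebra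
  presented by the generators $t_1^{\pm1}, t_2^{\pm1}$ and their relations is proved in
  \<open>quantum_torus_relations\<close> and \<open>quantum_torus_universal\<close> below. The involution is the
  linear extension of
  $\overline{t_1^a t_2^b} = \bar t_2^b\, \bar t_1^a = \theta_1^a \theta_2^b q^{ab} t_1^a t_2^b$; see
  \<open>quantum_torus_inv_algebra\<close>, \<open>quantum_torus_star\<close> and \<open>quantum_torus_star_unique\<close>.\<close>

type_synonym torus = "(int \<times> int) \<Rightarrow>\<^sub>0 complex"

definition torus_mult :: "complex \<Rightarrow> torus \<Rightarrow> torus \<Rightarrow> torus" where
  "torus_mult q x y = (\<Sum>a\<in>Poly_Mapping.keys x. \<Sum>b\<in>Poly_Mapping.keys y.
     Poly_Mapping.single (a + b)
       (q powi (snd a * fst b) * Poly_Mapping.lookup x a * Poly_Mapping.lookup y b))"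

definition torus_scale :: "complex \<Rightarrow> torus \<Rightarrow> torus" where
  "torus_scale c x = Poly_Mapping.map ((*) c) x"

definition torus_star :: "complex \<Rightarrow> complex \<Rightarrow> complex \<Rightarrow> torus \<Rightarrow> torus" where
  "torus_star q \<theta>1 \<theta>2 x = (\<Sum>a\<in>Poly_Mapping.keys x. Poly_Mapping.single a
     (\<theta>1 powi fst a * \<theta>2 powi snd a * q powi (fst a * snd a) * Poly_Mapping.lookup x a))"

definition quantum_torus :: "complex \<Rightarrow> complex \<Rightarrow> complex \<Rightarrow> (complex, torus) inv_algebra" where
  "quantum_torus q \<theta>1 \<theta>2 =
     \<lparr>amult = torus_mult q,
      aone = Poly_Mapping.single (0, 0) 1,
      ascale = torus_scale,
      astar = torus_star q \<theta>1 \<theta>2\<rparr>"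

definition torus_t1 :: "int \<Rightarrow> torus" where "torus_t1 k = Poly_Mapping.single (k, 0) 1"
definition torus_t2 :: "int \<Rightarrow> torus" where "torus_t2 k = Poly_Mapping.single (0, k) 1"

definition torus_params :: "(complex \<times> complex \<times> complex) set" where
  "torus_params = {(-1, 1, 1), (-1, 1, -1), (-1, -1, -1), (1, 1, 1), (1, 1, -1), (1, -1, -1)}"

definition mult_order :: "complex \<Rightarrow> nat" where
  "mult_order q = (LEAST m. 0 < m \<and> q ^ m = 1)"

lemma mult_order_1: "mult_order 1 = 1"
  unfolding mult_order_def by (rule Least_equality) auto

lemma mult_order_minus_1: "mult_order (-1) = 2"
  unfolding mult_order_def
proof (rule Least_equality)
  fix m :: nat
  assume "0 < m \<and> (-1 :: complex) ^ m = 1"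
  then show "2 \<le> m" by (cases "m = 1") auto
qed auto


subsection \<open>The presentation of the quantum torus\<close>

lemma torus_induct [case_names zero single add]:
  fixes x :: torus
  assumes "P 0" "\<And>a c. P (Poly_Mapping.single a c)" "\<And>x y. P x \<Longrightarrow> P y \<Longrightarrow> P (x + y)"
  shows "P x"
proof (induction x rule: Poly_Mapping.update_induct)
  case (update f a b)
  have "Poly_Mapping.update a b f = f + Poly_Mapping.single a b"
    using update(1)
    by (intro poly_mapping_eqI) (auto simp: lookup_update lookup_add lookup_single in_keys_iff when_def)
  then show ?case using assms(2,3) update by simp
qed (use assms in auto)

lemma torus_mult_add_left: "torus_mult q (x + y) z = torus_mult q x z + torus_mult q y z"
  unfolding torus_mult_def
  by (rule setsum_keys_plus_distrib
        [where f = "\<lambda>a c. \<Sum>b\<in>Poly_Mapping.keys z. Poly_Mapping.single (a + b)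
           (q powi (snd a * fst b) * c * Poly_Mapping.lookup z b)"])
     (auto simp: algebra_simps single_add sum.distrib)

lemma torus_mult_add_right: "torus_mult q x (y + z) = torus_mult q x y + torus_mult q x z"
  unfolding torus_mult_def sum.distrib [symmetric]
  by (intro sum.cong refl, rule setsum_keys_plus_distrib
        [where f = "\<lambda>b c. Poly_Mapping.single (a + b)
           (q powi (snd a * fst b) * Poly_Mapping.lookup x a * c)" for a])
     (auto simp: algebra_simps single_add)

lemma torus_mult_single:
  "torus_mult q (Poly_Mapping.single a c) (Poly_Mapping.single b d) =
     Poly_Mapping.single (a + b) (q powi (snd a * fst b) * c * d)"
  by (auto simp: torus_mult_def)

lemma torus_mult_0 [simp]: "torus_mult q 0 x = 0" "torus_mult q x 0 = 0"
  by (auto simp: torus_mult_def)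

lemma torus_star_add: "torus_star q \<theta>1 \<theta>2 (x + y) = torus_star q \<theta>1 \<theta>2 x + torus_star q \<theta>1 \<theta>2 y"
  unfolding torus_star_def
  by (rule setsum_keys_plus_distrib
        [where f = "\<lambda>a c. Poly_Mapping.single a
           (\<theta>1 powi fst a * \<theta>2 powi snd a * q powi (fst a * snd a) * c)"])
     (auto simp: algebra_simps single_add)

lemma torus_star_single:
  "torus_star q \<theta>1 \<theta>2 (Poly_Mapping.single a c) = Poly_Mapping.single a
     (\<theta>1 powi fst a * \<theta>2 powi snd a * q powi (fst a * snd a) * c)"
  by (auto simp: torus_star_def)

lemma torus_star_0 [simp]: "torus_star q \<theta>1 \<theta>2 0 = 0"
  by (auto simp: torus_star_def)

lemma lookup_torus_scale:
  "Poly_Mapping.lookup (torus_scale c x) a = c * Poly_Mapping.lookup x a"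
  by (simp add: torus_scale_def map.rep_eq when_def)

lemma torus_scale_add:
  "torus_scale c (x + y) = torus_scale c x + torus_scale c y"
  by (intro poly_mapping_eqI) (auto simp: lookup_torus_scale lookup_add algebra_simps)

lemma torus_scale_single:
  "torus_scale c (Poly_Mapping.single a d) = Poly_Mapping.single a (c * d)"
  by (intro poly_mapping_eqI) (auto simp: lookup_torus_scale lookup_single when_def)

lemma torus_scale_0 [simp]: "torus_scale c 0 = 0"
  by (intro poly_mapping_eqI) (auto simp: lookup_torus_scale)

lemma vector_space_torus_scale: "vector_space torus_scale"
  by standard
     (auto intro!: poly_mapping_eqI simp: lookup_torus_scale lookup_add algebra_simps)

lemma torus_mult_scale_left:
  "torus_mult q (torus_scale k x) y = torus_scale k (torus_mult q x y)"
proof (induction x rule: torus_induct)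
  case (single a c)
  show ?case
    by (induction y rule: torus_induct)
       (auto simp: torus_scale_single torus_mult_single torus_mult_add_right torus_scale_add algebra_simps)
qed (auto simp: torus_mult_add_left torus_scale_add)

lemma torus_mult_scale_right:
  "torus_mult q x (torus_scale k y) = torus_scale k (torus_mult q x y)"
proof (induction x rule: torus_induct)
  case (single a c)
  show ?case
    by (induction y rule: torus_induct)
       (auto simp: torus_scale_single torus_mult_single torus_mult_add_right torus_scale_add algebra_simps)
qed (auto simp: torus_mult_add_left torus_scale_add)

lemma torus_mult_assoc:
  assumes "q \<noteq> 0"
  shows "torus_mult q (torus_mult q x y) z = torus_mult q x (torus_mult q y z)"
proof (induction x rule: torus_induct)
  case (single a c)
  show ?case
  proof (induction y rule: torus_induct)
    case (single b d)
    show ?case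
      by (induction z rule: torus_induct)
         (auto simp: torus_mult_single torus_mult_add_right torus_mult_add_left algebra_simps
           power_int_add assms)
  qed (auto simp: torus_mult_add_left torus_mult_add_right)
qed (auto simp: torus_mult_add_left)

lemma sign_powi_square:
  assumes "\<theta> \<in> {1, -1 :: complex}"
  shows "\<theta> powi k * \<theta> powi k = 1"
proof -
  have "\<theta> powi k * \<theta> powi k = (\<theta> * \<theta>) powi k" by (simp add: power_int_mult_distrib)
  then show ?thesis using assms by auto
qed

lemma torus_star_mult:
  assumes q: "q \<in> {1, -1}" and \<theta>: "\<theta>1 \<noteq> 0" "\<theta>2 \<noteq> 0"
  shows "torus_star q \<theta>1 \<theta>2 (torus_mult q x y) =
    torus_mult q (torus_star q \<theta>1 \<theta>2 y) (torus_star q \<theta>1 \<theta>2 x)"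
proof (induction x rule: torus_induct)
  case (single a c)
  show ?case
  proof (induction y rule: torus_induct)
    case (single b d)
    have q0: "q \<noteq> 0" using q by auto
    have *: "q powi ((fst a + fst b) * (snd a + snd b)) * q powi (snd a * fst b) =
      q powi (snd b * fst a) * q powi (fst a * snd a) * q powi (fst b * snd b)"
    proof -
      have "q powi ((fst a + fst b) * (snd a + snd b)) * q powi (snd a * fst b) =
        q powi (fst a * snd a) * q powi (fst b * snd b) * q powi (snd b * fst a) *
        (q powi (snd a * fst b) * q powi (snd a * fst b))"
        by (simp add: q0 algebra_simps power_int_add)
      then show ?thesis using sign_powi_square[OF q] by simp
    qed
    have "torus_star q \<theta>1 \<theta>2
        (torus_mult q (Poly_Mapping.single a c) (Poly_Mapping.single b d)) =
      Poly_Mapping.single (a + b) (\<theta>1 powi (fst a + fst b) * \<theta>2 powi (snd a + snd b) *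
        (q powi ((fst a + fst b) * (snd a + snd b)) * q powi (snd a * fst b)) * c * d)"
      by (simp add: torus_mult_single torus_star_single mult.assoc)
    also have "\<dots> = torus_mult q (torus_star q \<theta>1 \<theta>2 (Poly_Mapping.single b d))
        (torus_star q \<theta>1 \<theta>2 (Poly_Mapping.single a c))"
      unfolding *
      by (simp add: torus_mult_single torus_star_single power_int_add \<theta> ac_simps)
    finally show ?case .
  qed (auto simp: torus_mult_add_left torus_mult_add_right torus_star_add)
qed (auto simp: torus_mult_add_left torus_mult_add_right torus_star_add)

lemma torus_star_star:
  assumes "q \<in> {1, -1}" "\<theta>1 \<in> {1, -1}" "\<theta>2 \<in> {1, -1}"
  shows "torus_star q \<theta>1 \<theta>2 (torus_star q \<theta>1 \<theta>2 x) = x"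
proof (induction x rule: torus_induct)
  case (single a c)
  have "torus_star q \<theta>1 \<theta>2 (torus_star q \<theta>1 \<theta>2 (Poly_Mapping.single a c)) =
    Poly_Mapping.single a ((\<theta>1 powi fst a * \<theta>1 powi fst a) * (\<theta>2 powi snd a * \<theta>2 powi snd a) *
      (q powi (fst a * snd a) * q powi (fst a * snd a)) * c)"
    by (simp add: torus_star_single ac_simps)
  then show ?case
    using assms by (simp only: sign_powi_square) simp
qed (auto simp: torus_star_add)

lemma torus_star_scale:
  "torus_star q \<theta>1 \<theta>2 (torus_scale k x) = torus_scale k (torus_star q \<theta>1 \<theta>2 x)"
  by (induction x rule: torus_induct)
     (auto simp: torus_scale_single torus_star_single torus_star_add torus_scale_add algebra_simps)

lemma torus_one_mult: "torus_mult q (Poly_Mapping.single (0, 0) 1) x = x"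
  by (induction x rule: torus_induct) (auto simp: torus_mult_single torus_mult_add_right plus_prod_def)

lemma torus_mult_one: "torus_mult q x (Poly_Mapping.single (0, 0) 1) = x"
  by (induction x rule: torus_induct) (auto simp: torus_mult_single torus_mult_add_left plus_prod_def)

theorem quantum_torus_inv_algebra:
  assumes "q \<in> {1, -1}" "\<theta>1 \<in> {1, -1}" "\<theta>2 \<in> {1, -1}"
  shows "inv_algebra (quantum_torus q \<theta>1 \<theta>2)"
proof -
  have "q \<noteq> 0" "\<theta>1 \<noteq> 0" "\<theta>2 \<noteq> 0" using assms by auto
  then show ?thesis
    unfolding inv_algebra_def quantum_torus_def
    using assms
    by (simp add: vector_space_torus_scale torus_mult_assoc torus_one_mult torus_mult_one
      torus_mult_add_left torus_mult_add_right torus_mult_scale_left torus_mult_scale_right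
      torus_star_add torus_star_scale torus_star_mult torus_star_star)
qed

theorem quantum_torus_star:
  "astar (quantum_torus q \<theta>1 \<theta>2) (torus_t1 1) = ascale (quantum_torus q \<theta>1 \<theta>2) \<theta>1 (torus_t1 1)"
  "astar (quantum_torus q \<theta>1 \<theta>2) (torus_t2 1) = ascale (quantum_torus q \<theta>1 \<theta>2) \<theta>2 (torus_t2 1)"
  by (simp_all add: quantum_torus_def torus_t1_def torus_t2_def torus_star_single torus_scale_single)

theorem quantum_torus_relations:
  fixes q \<theta>1 \<theta>2
  defines "R \<equiv> quantum_torus q \<theta>1 \<theta>2"
  shows "amult R (torus_t1 1) (torus_t1 (-1)) = aone R" "amult R (torus_t1 (-1)) (torus_t1 1) = aone R"
    "amult R (torus_t2 1) (torus_t2 (-1)) = aone R" "amult R (torus_t2 (-1)) (torus_t2 1) = aone R"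
    "amult R (torus_t2 1) (torus_t1 1) = ascale R q (amult R (torus_t1 1) (torus_t2 1))"
  by (simp_all add: R_def quantum_torus_def torus_t1_def torus_t2_def torus_mult_single
    torus_scale_single)

definition ipow :: "'b::monoid_mult \<Rightarrow> 'b \<Rightarrow> int \<Rightarrow> 'b" where
  "ipow u u' k = (if 0 \<le> k then u ^ nat k else u' ^ nat (- k))"

lemma ipow_simps [simp]: "ipow u u' 0 = 1" "ipow u u' 1 = u" "ipow u u' (-1) = u'"
  by (auto simp: ipow_def)

lemma ipow_step:
  assumes "u * u' = 1" "u' * u = 1"
  shows "ipow u u' (k + 1) = ipow u u' k * u" "ipow u u' (k - 1) = ipow u u' k * u'"
proof -
  have *: "ipow u u' (k + 1) = ipow u u' k * u" if "u * u' = 1" "u' * u = 1"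
    for u u' :: 'a and k :: int
  proof (cases "0 \<le> k")
    case True
    then show ?thesis by (simp add: ipow_def nat_add_distrib power_commutes)
  next
    case False
    define m where "m = nat (- k - 1)"
    have k: "k = - int m - 1" using False by (simp add: m_def)
    have "nat (- k) = Suc m" by (simp add: k)
    moreover have "u' ^ Suc m * u = u' ^ m"
      by (simp add: power_Suc2 mult.assoc that del: power_Suc)
    ultimately show ?thesis using False
      by (cases "m = 0") (auto simp: ipow_def k)
  qed
  show "ipow u u' (k + 1) = ipow u u' k * u" by (rule *[OF assms])
  have "ipow u u' k = ipow u u' (k - 1) * u" using *[OF assms, of "k - 1"] by simp
  then show "ipow u u' (k - 1) = ipow u u' k * u'" by (simp add: mult.assoc assms)
qed

lemma ipow_add:
  assumes "u * u' = 1" "u' * u = 1"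
  shows "ipow u u' (j + k) = ipow u u' j * ipow u u' k"
proof (induction k rule: int_induct[where k = 0])
  case (step1 i)
  have "ipow u u' (j + (i + 1)) = ipow u u' (j + i) * u"
    using ipow_step(1)[OF assms, of "j + i"] by (simp add: add.assoc)
  then show ?case using step1 by (simp add: ipow_step(1)[OF assms] mult.assoc)
next
  case (step2 i)
  have "ipow u u' (j + (i - 1)) = ipow u u' (j + i) * u'"
    using ipow_step(2)[OF assms, of "j + i"] by (simp add: algebra_simps)
  then show ?case using step2 by (simp add: ipow_step(2)[OF assms] mult.assoc)
qed simp

locale complex_algebra_type = vector_space s
  for s :: "complex \<Rightarrow> 'b::ring_1 \<Rightarrow> 'b" +
  assumes s_left: "s c x * y = s c (x * y)"
    and s_right: "x * s c y = s c (x * y)"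
begin

lemma q_flip:
  assumes "x * y = s r (y * x)" "r \<noteq> 0"
  shows "y * x = s (inverse r) (x * y)"
  using assms by simp

lemma q_ipow:
  assumes xy: "x * y = s r (y * x)" and r: "r \<noteq> 0" and y: "y * y' = 1" "y' * y = 1"
  shows "x * ipow y y' k = s (r powi k) (ipow y y' k * x)"
proof (induction k rule: int_induct[where k = 0])
  case (step1 i)
  have "x * ipow y y' (i + 1) = (x * ipow y y' i) * y"
    by (simp add: ipow_step[OF y] mult.assoc)
  also have "\<dots> = s (r powi i) (ipow y y' i * (x * y))"
    by (simp add: step1 s_left mult.assoc)
  also have "\<dots> = s (r powi (i + 1)) (ipow y y' (i + 1) * x)"
    by (simp add: xy s_right r power_int_add mult.assoc ipow_step[OF y])
  finally show ?case .
next
  case (step2 i)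
  have "y' * (x * y) * y' = s r (y' * (y * x) * y')" by (simp add: xy s_left s_right)
  moreover have "y' * (x * y) * y' = y' * x" by (simp add: mult.assoc y)
  moreover have "y' * (y * x) * y' = x * y'" by (simp add: mult.assoc[symmetric] y)
  ultimately have "y' * x = s r (x * y')" by simp
  from q_flip[OF this r] have xy': "x * y' = s (inverse r) (y' * x)" .
  have "x * ipow y y' (i - 1) = (x * ipow y y' i) * y'"
    by (simp add: ipow_step[OF y] mult.assoc)
  also have "\<dots> = s (r powi i) (ipow y y' i * (x * y'))"
    by (simp add: step2 s_left mult.assoc)
  also have "\<dots> = s (r powi (i - 1)) (ipow y y' (i - 1) * x)"
    by (simp add: xy' s_right r power_int_diff mult.assoc ipow_step[OF y] divide_inverse)
  finally show ?case .
qed simp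

end

text \<open>Universal property: \<open>quantum_torus\<close> maps uniquely to every complex unital associative
  algebra (multiplication of the type, scalars \<open>s\<close>) containing elements that satisfy the relations.\<close>

theorem quantum_torus_universal:
  fixes s :: "complex \<Rightarrow> 'b::ring_1 \<Rightarrow> 'b" and u1 u1' u2 u2' :: 'b and q \<theta>1 \<theta>2
  defines "R \<equiv> quantum_torus q \<theta>1 \<theta>2"
  assumes alg: "vector_space s" "\<And>c x y. s c x * y = s c (x * y)" "\<And>c x y. x * s c y = s c (x * y)"
    and q: "q \<noteq> 0"
    and u1: "u1 * u1' = 1" "u1' * u1 = 1" and u2: "u2 * u2' = 1" "u2' * u2 = 1"
    and rel: "u2 * u1 = s q (u1 * u2)"
  shows "\<exists>!\<phi>. \<phi> (aone R) = 1 \<and> (\<forall>x y. \<phi> (x + y) = \<phi> x + \<phi> y) \<and>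
    (\<forall>c x. \<phi> (ascale R c x) = s c (\<phi> x)) \<and> (\<forall>x y. \<phi> (amult R x y) = \<phi> x * \<phi> y) \<and>
    \<phi> (torus_t1 1) = u1 \<and> \<phi> (torus_t2 1) = u2"
proof -
  interpret complex_algebra_type s
    using alg by (simp add: complex_algebra_type_def complex_algebra_type_axioms_def)
  define M where "M a = ipow u1 u1' (fst a) * ipow u2 u2' (snd a)" for a :: "int \<times> int"
  define \<Phi> where "\<Phi> x = (\<Sum>a\<in>Poly_Mapping.keys x. s (Poly_Mapping.lookup x a) (M a))" for x :: torus
  have comm: "ipow u2 u2' b * ipow u1 u1' c = s (q powi (b * c)) (ipow u1 u1' c * ipow u2 u2' b)"
    for b c
  proof -
    have "u2 * ipow u1 u1' c = s (q powi c) (ipow u1 u1' c * u2)"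
      by (rule q_ipow[OF rel q u1])
    then have "ipow u1 u1' c * u2 = s (inverse (q powi c)) (u2 * ipow u1 u1' c)"
      by (rule q_flip) (use q in auto)
    then have "ipow u1 u1' c * ipow u2 u2' b =
      s (inverse (q powi c) powi b) (ipow u2 u2' b * ipow u1 u1' c)"
      by (rule q_ipow) (use q u2 in auto)
    then have "ipow u2 u2' b * ipow u1 u1' c =
      s (inverse (inverse (q powi c) powi b)) (ipow u1 u1' c * ipow u2 u2' b)"
      by (rule q_flip) (use q in auto)
    also have "inverse (inverse (q powi c) powi b) = q powi (b * c)"
      by (simp add: power_int_inverse power_int_mult[symmetric] mult.commute)
    finally show ?thesis .
  qed
  have M_mult: "M a * M b = s (q powi (snd a * fst b)) (M (a + b))" for a b
  proof -
    have "M a * M b = ipow u1 u1' (fst a) * (ipow u2 u2' (snd a) * ipow u1 u1' (fst b)) * ipow u2 u2' (snd b)"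
      by (simp add: M_def mult.assoc)
    also have "\<dots> = s (q powi (snd a * fst b)) (M (a + b))"
      by (simp add: comm s_left s_right M_def ipow_add[OF u1] ipow_add[OF u2] mult.assoc)
    finally show ?thesis .
  qed
  have \<Phi>_single: "\<Phi> (Poly_Mapping.single a c) = s c (M a)" for a c
    by (auto simp: \<Phi>_def)
  have \<Phi>_0: "\<Phi> 0 = 0" by (simp add: \<Phi>_def)
  have \<Phi>_add: "\<Phi> (x + y) = \<Phi> x + \<Phi> y" for x y
    unfolding \<Phi>_def
    by (rule setsum_keys_plus_distrib[where f = "\<lambda>a c. s c (M a)"]) (auto simp: scale_left_distrib)
  have \<Phi>_scale: "\<Phi> (ascale R c x) = s c (\<Phi> x)" for c x
    unfolding R_def quantum_torus_def
    by (induction x rule: torus_induct)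
       (auto simp: \<Phi>_0 \<Phi>_add \<Phi>_single torus_scale_single torus_scale_add scale_right_distrib)
  have \<Phi>_mult: "\<Phi> (amult R x y) = \<Phi> x * \<Phi> y" for x y
  proof -
    have "\<Phi> (torus_mult q x y) = \<Phi> x * \<Phi> y"
    proof (induction x rule: torus_induct)
      case (single a c)
      show ?case
        by (induction y rule: torus_induct)
           (auto simp: \<Phi>_0 \<Phi>_add \<Phi>_single torus_mult_single torus_mult_add_right M_mult s_left s_right
             algebra_simps)
    qed (auto simp: \<Phi>_0 \<Phi>_add torus_mult_add_left algebra_simps)
    then show ?thesis by (simp add: R_def quantum_torus_def)
  qed
  show ?thesis
  proof (rule ex1I[of _ \<Phi>])
    show "\<Phi> (aone R) = 1 \<and> (\<forall>x y. \<Phi> (x + y) = \<Phi> x + \<Phi> y) \<and>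
      (\<forall>c x. \<Phi> (ascale R c x) = s c (\<Phi> x)) \<and> (\<forall>x y. \<Phi> (amult R x y) = \<Phi> x * \<Phi> y) \<and>
      \<Phi> (torus_t1 1) = u1 \<and> \<Phi> (torus_t2 1) = u2"
      using \<Phi>_add \<Phi>_scale \<Phi>_mult
      by (simp add: \<Phi>_single R_def quantum_torus_def torus_t1_def torus_t2_def M_def)
  next
    fix \<psi>
    assume \<psi>: "\<psi> (aone R) = 1 \<and> (\<forall>x y. \<psi> (x + y) = \<psi> x + \<psi> y) \<and>
      (\<forall>c x. \<psi> (ascale R c x) = s c (\<psi> x)) \<and> (\<forall>x y. \<psi> (amult R x y) = \<psi> x * \<psi> y) \<and>
      \<psi> (torus_t1 1) = u1 \<and> \<psi> (torus_t2 1) = u2"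
    then have \<psi>_mult: "\<psi> (torus_mult q x y) = \<psi> x * \<psi> y" for x y
      by (simp add: R_def quantum_torus_def)
    have one: "\<psi> (Poly_Mapping.single (0, 0) 1) = 1"
      using \<psi> by (simp add: R_def quantum_torus_def)
    have p1: "\<psi> (torus_t1 k) = ipow u1 u1' k" for k
    proof (induction k rule: int_induct[where k = 0])
      case (step1 i)
      have "torus_t1 (i + 1) = torus_mult q (torus_t1 i) (torus_t1 1)"
        by (simp add: torus_t1_def torus_mult_single)
      then show ?case using step1 \<psi> by (simp add: \<psi>_mult ipow_step[OF u1])
    next
      case (step2 i)
      have "torus_t1 i = torus_mult q (torus_t1 (i - 1)) (torus_t1 1)"
        by (simp add: torus_t1_def torus_mult_single)
      then have "ipow u1 u1' i = \<psi> (torus_t1 (i - 1)) * u1"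
        using step2 \<psi> \<psi>_mult by metis
      then show ?case by (simp add: ipow_step[OF u1] mult.assoc u1)
    qed (simp add: torus_t1_def one)
    have p2: "\<psi> (torus_t2 k) = ipow u2 u2' k" for k
    proof (induction k rule: int_induct[where k = 0])
      case (step1 i)
      have "torus_t2 (i + 1) = torus_mult q (torus_t2 i) (torus_t2 1)"
        by (simp add: torus_t2_def torus_mult_single)
      then show ?case using step1 \<psi> by (simp add: \<psi>_mult ipow_step[OF u2])
    next
      case (step2 i)
      have "torus_t2 i = torus_mult q (torus_t2 (i - 1)) (torus_t2 1)"
        by (simp add: torus_t2_def torus_mult_single)
      then have "ipow u2 u2' i = \<psi> (torus_t2 (i - 1)) * u2"
        using step2 \<psi> \<psi>_mult by metis
      then show ?case by (simp add: ipow_step[OF u2] mult.assoc u2)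
    qed (simp add: torus_t2_def one)
    have \<psi>_single: "\<psi> (Poly_Mapping.single a c) = s c (M a)" for a c
    proof -
      have "Poly_Mapping.single a c = ascale R c (amult R (torus_t1 (fst a)) (torus_t2 (snd a)))"
        by (simp add: R_def quantum_torus_def torus_t1_def torus_t2_def torus_mult_single
          torus_scale_single)
      then show ?thesis using \<psi> by (simp add: p1 p2 M_def)
    qed
    have \<psi>0: "\<psi> 0 = 0" using \<psi>_single[of "(0, 0)" 0] by simp
    show "\<psi> = \<Phi>"
    proof
      fix x
      show "\<psi> x = \<Phi> x"
        by (induction x rule: torus_induct) (use \<psi> in \<open>auto simp: \<psi>0 \<Phi>_0 \<psi>_single \<Phi>_single \<Phi>_add\<close>)
    qed
  qed
qed

theorem quantum_torus_star_unique:
  fixes q \<theta>1 \<theta>2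
  defines "R \<equiv> quantum_torus q \<theta>1 \<theta>2"
  assumes params: "q \<in> {1, -1}" "\<theta>1 \<in> {1, -1}" "\<theta>2 \<in> {1, -1}"
    and \<sigma>: "inv_algebra (R\<lparr>astar := \<sigma>\<rparr>)"
      "\<sigma> (torus_t1 1) = ascale R \<theta>1 (torus_t1 1)" "\<sigma> (torus_t2 1) = ascale R \<theta>2 (torus_t2 1)"
  shows "\<sigma> = astar R"
proof -
  interpret A: inv_algebra R
    unfolding R_def by (rule quantum_torus_inv_algebra[OF params])
  interpret B: inv_algebra "R\<lparr>astar := \<sigma>\<rparr>" by (rule \<sigma>)
  define E where "E x \<longleftrightarrow> \<sigma> x = astar R x" for x
  have E_mult: "E (amult R x y)" if "E x" "E y" for x y
    using that B.star_mult[of x y] A.star_mult[of x y] by (simp add: E_def)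
  have E_add: "E (x + y)" if "E x" "E y" for x y
    using that B.star_add[of x y] A.star_add[of x y] by (simp add: E_def)
  have E_scale: "E (ascale R c x)" if "E x" for x c
    using that B.star_scale[of c x] A.star_scale[of c x] by (simp add: E_def)
  have one: "\<sigma> (aone R) = aone R" "astar R (aone R) = aone R"
    using B.star_mult[of "aone R" "\<sigma> (aone R)"] B.star_star[of "aone R"] B.one_mult B.mult_one
      A.star_mult[of "aone R" "astar R (aone R)"] A.star_star[of "aone R"] A.one_mult A.mult_one
    by auto
  have E_one: "E (aone R)" by (simp add: E_def one)
  have E_inv: "E y" if "E x" "amult R x y = aone R" "amult R y x = aone R" for x y
  proof -
    have "amult R (\<sigma> y) (\<sigma> x) = aone R" "amult R (astar R x) (astar R y) = aone R"
      using B.star_mult[of x y] A.star_mult[of y x] that one by auto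
    then have "\<sigma> y = amult R (\<sigma> y) (amult R (\<sigma> x) (astar R y))"
      using that(1) A.mult_one by (simp add: E_def)
    also have "\<dots> = astar R y"
      using \<open>amult R (\<sigma> y) (\<sigma> x) = aone R\<close> A.one_mult A.mult_assoc by metis
    finally show ?thesis by (simp add: E_def)
  qed
  have t: "E (torus_t1 1)" "E (torus_t2 1)"
    using \<sigma> quantum_torus_star[of q \<theta>1 \<theta>2] by (simp_all add: E_def R_def)
  have t': "E (torus_t1 (-1))" "E (torus_t2 (-1))"
    using E_inv t quantum_torus_relations[of q \<theta>1 \<theta>2, folded R_def] by blast+
  have step: "torus_t1 (j + k) = amult R (torus_t1 j) (torus_t1 k)"
    "torus_t2 (j + k) = amult R (torus_t2 j) (torus_t2 k)" for j k
    by (simp_all add: R_def quantum_torus_def torus_t1_def torus_t2_def torus_mult_single)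
  have zero: "torus_t1 0 = aone R" "torus_t2 0 = aone R"
    by (simp_all add: R_def quantum_torus_def torus_t1_def torus_t2_def)
  have p1: "E (torus_t1 k)" for k
  proof (induction k rule: int_induct[where k = 0])
    case (step2 i)
    then show ?case using step(1)[of i "-1"] E_mult t' by simp
  qed (use zero E_one step E_mult t in simp_all)
  have p2: "E (torus_t2 k)" for k
  proof (induction k rule: int_induct[where k = 0])
    case (step2 i)
    then show ?case using step(2)[of i "-1"] E_mult t' by simp
  qed (use zero E_one step E_mult t in simp_all)
  have E_single: "E (Poly_Mapping.single a c)" for a c
  proof -
    have "Poly_Mapping.single a c = ascale R c (amult R (torus_t1 (fst a)) (torus_t2 (snd a)))"
      by (simp add: R_def quantum_torus_def torus_t1_def torus_t2_def torus_mult_single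
        torus_scale_single)
    then show ?thesis using p1 p2 E_mult E_scale by simp
  qed
  have "E x" for x
    by (induction x rule: torus_induct) (use E_single[of 0 0] E_single E_add in auto)
  then show ?thesis by (auto simp: E_def)
qed

end

theory Submission
  imports Defs "HOL-Computational_Algebra.Fundamental_Theorem_Algebra"
begin

text \<open>Let \<open>I\<close> be the annihilator of \<open>V\<close> and \<open>J\<close> the set of those \<open>a\<close> in the torus for which the
  root elements with entry \<open>a\<close> lie in \<open>I\<close>. Since \<open>n \<ge> 3\<close>, \<open>J\<close> is an ideal stable under
  the involution, and \<open>I\<close> consists of the elements of the Lie algebra with all entries in \<open>J\<close>.
  An ideal of the Lie algebra that is abelian modulo \<open>I\<close> acts by commuting operators, and
  its brackets with everything else are nilpotent (Jacobson) and hence act by zero; so a central element of the torus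
  whose square lies in \<open>J\<close> lies in \<open>J\<close>. As \<open>J\<close> has finite codimension, it is therefore the
  common kernel of finitely many $m$-dimensional irreducible representations of the torus,
  and evaluation at these points identifies the quotient with a power of the Lie algebra of the
  involution induced on $m \times m$ matrices. If $q = 1$ and the involution acts nontrivially on the
  torus, it permutes the points without fixed points, and one point from each orbit gives
  a copy of $\mathfrak{sl}_{2n}$.\<close>

section \<open>Linear algebra\<close>

text \<open>Jacobson's lemma stands in for the structure theory of reductive algebras, since the Lie
  algebra is infinite-dimensional; irreducibility enters through the fact that a common kernel of
  nilpotent operators is a submodule. The obstacle is the diagonal: root elements are governed by
  \<open>J\<close>, but a diagonal element of the Lie algebra is subject to a trace condition modulo
  commutators. The map \<open>avg\<close> vanishes exactly on sums of commutators, so this condition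
  becomes a linear equation, and the Lie algebra is the set of skew matrices of averaged trace zero
  (\<open>G_iff\<close>). The bound \<open>3 \<le> n\<close> provides, for any two indices, a third
  one in a different pair of indices, through which brackets are routed. Surjectivity onto the power
  is checked on root elements in one slot; interpolation in central elements separates the
  slots.\<close>

definition poly_comb :: "('k::field \<Rightarrow> 'v::ab_group_add \<Rightarrow> 'v) \<Rightarrow> 'k poly \<Rightarrow> (nat \<Rightarrow> 'v) \<Rightarrow> 'v" where
  "poly_comb s P w = (\<Sum>k\<le>degree P. s (coeff P k) (w k))"

context vector_space
begin

lemma poly_comb_bound:
  assumes "degree P \<le> N"
  shows "poly_comb scale P w = (\<Sum>k\<le>N. scale (coeff P k) (w k))"
  unfolding poly_comb_def
  by (rule sum.mono_neutral_left) (use assms in \<open>auto simp: coeff_eq_0\<close>)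

lemma poly_comb_0 [simp]: "poly_comb scale 0 w = 0"
  by (simp add: poly_comb_def)

lemma poly_comb_pCons:
  "poly_comb scale (pCons a P) w = scale a (w 0) + poly_comb scale P (\<lambda>k. w (Suc k))"
proof -
  have "poly_comb scale (pCons a P) w = (\<Sum>k\<le>Suc (degree P). scale (coeff (pCons a P) k) (w k))"
    by (rule poly_comb_bound) (rule degree_pCons_le)
  also have "\<dots> = scale a (w 0) + (\<Sum>k\<le>degree P. scale (coeff P k) (w (Suc k)))"
    by (subst sum.atMost_Suc_shift) simp
  finally show ?thesis by (simp add: poly_comb_def)
qed

lemma poly_comb_add:
  "poly_comb scale (P + Q) w = poly_comb scale P w + poly_comb scale Q w"
proof -
  define N where "N = max (degree P) (degree Q)"
  have "degree (P + Q) \<le> N" "degree P \<le> N" "degree Q \<le> N"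
    using degree_add_le_max[of P Q] by (auto simp: N_def)
  then show ?thesis
    by (simp add: poly_comb_bound[where N = N] scale_left_distrib sum.distrib)
qed

lemma poly_comb_smult: "poly_comb scale (smult c P) w = scale c (poly_comb scale P w)"
  by (simp add: poly_comb_bound[where N = "degree P"] scale_sum_right)

lemma poly_comb_hom:
  assumes "\<And>u v. f (u + v) = f u + f v" "\<And>c v. f (scale c v) = s' c (f v)"
  shows "f (poly_comb scale P w) = poly_comb s' P (\<lambda>k. f (w k))"
proof -
  have "f 0 = 0" using assms(1)[of 0 0] by simp
  then have "f (sum g A) = (\<Sum>x\<in>A. f (g x))" for g and A :: "nat set"
    by (induction A rule: infinite_finite_induct) (auto simp: assms)
  then show ?thesis by (simp add: poly_comb_def assms)
qed

end

text \<open>The support condition drives the induction: two solutions with disjoint supports can be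
  combined so that one more functional vanishes, and disjointness prevents the combination from
  cancelling to 0.\<close>

lemma poly_functional_relation:
  fixes r :: "nat \<Rightarrow> 'e \<Rightarrow> 'k::field"
  assumes "finite E" "infinite K"
  shows "\<exists>P. P \<noteq> 0 \<and> (\<forall>k. coeff P k \<noteq> 0 \<longrightarrow> k \<in> K) \<and>
    (\<forall>e\<in>E. poly_comb (*) P (\<lambda>k. r k e) = 0)"
  using assms
proof (induction E arbitrary: K rule: finite_induct)
  case empty
  then obtain k where "k \<in> K" using infinite_imp_nonempty by blast
  then show ?case by (intro exI[of _ "monom 1 k"]) auto
next
  case (insert e E)
  interpret vector_space "(*) :: 'k \<Rightarrow> 'k \<Rightarrow> 'k" by standard (auto simp: algebra_simps)
  define L where "L P = poly_comb (*) P (\<lambda>k. r k e)" for P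
  obtain K1 K2 where K: "K1 \<subseteq> K" "K2 \<subseteq> K" "infinite K1" "infinite K2" "K1 \<inter> K2 = {}"
    using infinite_split[OF insert.prems] by metis
  from insert.IH[OF K(3)] obtain P1 where P1: "P1 \<noteq> 0" "\<forall>k. coeff P1 k \<noteq> 0 \<longrightarrow> k \<in> K1"
    "\<forall>e\<in>E. poly_comb (*) P1 (\<lambda>k. r k e) = 0" by blast
  from insert.IH[OF K(4)] obtain P2 where P2: "P2 \<noteq> 0" "\<forall>k. coeff P2 k \<noteq> 0 \<longrightarrow> k \<in> K2"
    "\<forall>e\<in>E. poly_comb (*) P2 (\<lambda>k. r k e) = 0" by blast
  show ?case
  proof (cases "L P1 = 0")
    case True
    with P1 K show ?thesis by (intro exI[of _ P1]) (auto simp: L_def)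
  next
    case False
    define P where "P = smult (L P2) P1 - smult (L P1) P2"
    have neg: "P = smult (L P2) P1 + smult (- L P1) P2" by (simp add: P_def)
    obtain k where k: "coeff P2 k \<noteq> 0" using P2(1) by (metis leading_coeff_0_iff)
    then have "coeff P1 k = 0" using P1(2) P2(2) K(5) by blast
    then have "coeff P k \<noteq> 0" using k False by (simp add: P_def)
    then have "P \<noteq> 0" by auto
    moreover have "\<forall>k. coeff P k \<noteq> 0 \<longrightarrow> k \<in> K"
      using P1(2) P2(2) K(1,2) by (auto simp: P_def) (metis mult_zero_right subsetD)
    moreover have "\<forall>e\<in>insert e E. poly_comb (*) P (\<lambda>k. r k e) = 0"
      using P1(3) P2(3) unfolding neg poly_comb_add poly_comb_smult
      by (auto simp: L_def)
    ultimately show ?thesis by blast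
  qed
qed

lemma linear_funpow:
  "Vector_Spaces.linear s s f \<Longrightarrow> Vector_Spaces.linear s s (f ^^ k)"
  by (induction k) (auto simp: Vector_Spaces.linear_iff)

lemma linear_simps:
  assumes "Vector_Spaces.linear s s f"
  shows "f (u + v) = f u + f v" "f (s c v) = s c (f v)" "f 0 = 0" "f (u - v) = f u - f v"
proof -
  interpret l: Vector_Spaces.linear s s f by fact
  show "f (u + v) = f u + f v" "f (s c v) = s c (f v)" "f 0 = 0" "f (u - v) = f u - f v"
    by (auto simp: l.add l.scale l.zero l.diff)
qed

section \<open>Nilpotent commutators in finite dimension\<close>

context finite_dimensional_vector_space
begin

text \<open>Each pair of basis vectors gives one functional on coefficient sequences, so only
  finitely many conditions have to be met. For the powers of one operator this is an annihilating
  polynomial; for arbitrary operators it will give the finite codimension of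
  \<open>J\<close>.\<close>

lemma linear_family_relation:
  assumes w: "\<And>k :: nat. Vector_Spaces.linear scale scale (w k)"
  shows "\<exists>P. P \<noteq> 0 \<and> (\<forall>v. poly_comb scale P (\<lambda>k. w k v) = 0)"
proof -
  define r where "r k be = representation Basis (w k (fst be)) (snd be)" for k be
  obtain P where P: "P \<noteq> 0" "\<forall>be\<in>Basis \<times> Basis. poly_comb (*) P (\<lambda>k. r k be) = 0"
    using poly_functional_relation[of "Basis \<times> Basis" UNIV r] finite_Basis by auto
  define f where "f v = poly_comb scale P (\<lambda>k. w k v)" for v
  have lin: "Vector_Spaces.linear scale scale f"
    unfolding Vector_Spaces.linear_iff f_def poly_comb_def
    using vector_space_axioms w
    by (auto simp: linear_simps[OF w] scale_right_distrib sum.distrib scale_sum_right ac_simps)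
  have "f b = 0" if b: "b \<in> Basis" for b
  proof -
    have rep: "representation Basis (f b) e = 0" for e
    proof (cases "e \<in> Basis")
      case True
      have "representation Basis (f b) e = poly_comb (*) P (\<lambda>k. representation Basis (w k b) e)"
        unfolding f_def
        by (rule poly_comb_hom[where f = "\<lambda>x. representation Basis x e"])
           (auto simp: representation_add representation_scale independent_Basis span_Basis)
      then show ?thesis using P(2) b True by (auto simp: r_def)
    qed (metis representation_ne_zero)
    have "(\<Sum>e | representation Basis (f b) e \<noteq> 0. scale (representation Basis (f b) e) e) = f b"
      by (rule sum_nonzero_representation_eq) (auto simp: independent_Basis span_Basis)
    then show ?thesis using rep by simp
  qed
  then have "Basis \<subseteq> {v. f v = 0}" by blast
  moreover have "subspace {v. f v = 0}" by (auto simp: subspace_def linear_simps[OF lin])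
  ultimately have "span Basis \<subseteq> {v. f v = 0}" by (rule span_minimal)
  then have "f v = 0" for v using span_Basis by blast
  with P(1) show ?thesis by (auto simp: f_def)
qed

text \<open>A version of Jacobson's lemma. If \<open>P\<close> is a nonzero polynomial of least degree such that
  some \<open>P(x) c\<^sup>m\<close> vanishes, then commuting with \<open>y\<close> shows that \<open>P'(x) c\<^bsup>2m+1\<^esup>\<close>
  vanishes too, so \<open>P\<close> is constant.\<close>

lemma commutator_nilpotent:
  fixes x y c d :: "'b \<Rightarrow> 'b"
  assumes char: "\<And>k::nat. k > 0 \<Longrightarrow> (of_nat k :: 'a) \<noteq> 0"
    and lin: "Vector_Spaces.linear scale scale x" "Vector_Spaces.linear scale scale y"
      "Vector_Spaces.linear scale scale c" "Vector_Spaces.linear scale scale d"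
    and c: "\<And>v. c v = x (y v) - y (x v)" and d: "\<And>v. d v = c (y v) - y (c v)"
    and xc: "\<And>v. x (c v) = c (x v)" and cd: "\<And>v. c (d v) = d (c v)"
  shows "\<exists>m. \<forall>v. (c ^^ m) v = 0"
proof -
  note ls = linear_simps[OF lin(1)] linear_simps[OF lin(2)] linear_simps[OF lin(3)]
    linear_simps[OF lin(4)]
  define pev where "pev P v = poly_comb scale P (\<lambda>k. (x ^^ k) v)" for P v
  note lx = linear_simps[OF linear_funpow[OF lin(1)]]
  note lc = linear_simps[OF linear_funpow[OF lin(3)]]
  have pev_pCons: "pev (pCons a P) v = scale a v + pev P (x v)" for a P v
    by (simp add: pev_def poly_comb_pCons funpow_swap1)
  have pev_x: "pev P (x v) = x (pev P v)" for P v
    using poly_comb_hom[of x scale P "\<lambda>k. (x ^^ k) v"]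
    by (simp add: pev_def ls funpow_swap1)
  have pev_c: "pev P (c v) = c (pev P v)" for P v
  proof -
    have "(x ^^ k) (c v) = c ((x ^^ k) v)" for k by (induction k) (auto simp: xc)
    then show ?thesis using poly_comb_hom[of c scale P "\<lambda>k. (x ^^ k) v"] by (simp add: pev_def ls)
  qed
  have pev_add: "pev P (u + v) = pev P u + pev P v" for P u v
    unfolding pev_def poly_comb_def by (simp add: lx scale_right_distrib sum.distrib)
  have pev_scale: "pev P (scale a v) = scale a (pev P v)" for P a v
    unfolding pev_def poly_comb_def by (simp add: lx scale_sum_right ac_simps)
  have pev_padd: "pev (P + Q) v = pev P v + pev Q v" for P Q v
    by (simp add: pev_def poly_comb_add)
  \<comment> \<open>Leibniz rule: since \<open>x\<close> commutes with \<open>c\<close>, the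
    commutator of \<open>P(x)\<close> with \<open>y\<close> is \<open>P'(x) c\<close>.\<close>
  have pev_y: "pev P (y v) = y (pev P v) + pev (pderiv P) (c v)" for P v
  proof (induction P arbitrary: v)
    case 0
    then show ?case by (simp add: pev_def ls)
  next
    case (pCons a P)
    have "pev P (x (y v)) = pev P (y (x v)) + pev P (c v)"
      using pev_add[of P "y (x v)" "c v"] c by simp
    then show ?case
      by (simp add: pev_pCons pCons.IH pderiv_pCons pev_padd ls xc[symmetric])
  qed
  have cm: "(c ^^ m) (d v) = d ((c ^^ m) v)" for m v
    by (induction m) (auto simp: cd)
  \<comment> \<open>At \<open>m = 0\<close> the truncated \<open>m - 1\<close> does no harm, since
    its term has coefficient 0.\<close>
  have c_y: "(c ^^ m) (y v) = y ((c ^^ m) v) + scale (of_nat m) ((c ^^ (m - 1)) (d v))" for m v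
  proof (induction m)
    case (Suc m)
    have "(c ^^ Suc m) (y v) = c (y ((c ^^ m) v)) + scale (of_nat m) (c ((c ^^ (m - 1)) (d v)))"
      by (simp add: Suc ls)
    also have "c (y ((c ^^ m) v)) = y ((c ^^ Suc m) v) + (c ^^ m) (d v)"
      using d[of "(c ^^ m) v"] by (simp add: cm)
    also have "scale (of_nat m) (c ((c ^^ (m - 1)) (d v))) = scale (of_nat m) ((c ^^ m) (d v))"
      by (cases m) auto
    finally show ?case by (simp add: scale_left_distrib add.assoc)
  qed simp
  define Q where "Q P \<longleftrightarrow> P \<noteq> 0 \<and> (\<exists>m. \<forall>v. pev P ((c ^^ m) v) = 0)" for P
  \<comment> \<open>Start from \<open>P(x) c^m y c^m = 0\<close> and move \<open>y\<close> to the
    left. Passing \<open>c^m\<close> leaves a multiple of \<open>c^(m-1) d c^m\<close>, in which a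
    full \<open>c^m\<close> can be brought next to \<open>P(x)\<close>; passing \<open>P(x)\<close>
    leaves \<open>P'(x) c\<close>, whence the exponent \<open>2m + 1\<close>.\<close>
  have Q_pderiv: "pev (pderiv P) ((c ^^ (2 * m + 1)) v) = 0"
    if P: "\<forall>v. pev P ((c ^^ m) v) = 0" for P m v
  proof -
    have 1: "(c ^^ (m - 1)) (d ((c ^^ m) v)) = (c ^^ m) (d ((c ^^ (m - 1)) v))" if "m > 0"
      by (simp add: cm funpow_add[symmetric, THEN fun_cong, unfolded comp_def] add.commute)
    have 2: "pev P (scale (of_nat m) ((c ^^ (m - 1)) (d ((c ^^ m) v)))) = 0"
      using P 1 by (cases "m = 0") (auto simp: pev_scale pev_add)
    have "0 = pev P ((c ^^ m) (y ((c ^^ m) v)))" using P by simp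
    also have "\<dots> = pev P (y ((c ^^ m) ((c ^^ m) v)))"
      unfolding c_y pev_add 2 by simp
    also have "\<dots> = pev (pderiv P) (c ((c ^^ m) ((c ^^ m) v)))"
      using P by (simp add: pev_y ls)
    finally show ?thesis
      by (simp add: funpow_add mult_2)
  qed
  obtain P0 where "P0 \<noteq> 0" "\<forall>v. pev P0 v = 0"
    using linear_family_relation[of "\<lambda>k. x ^^ k"] linear_funpow[OF lin(1)] by (auto simp: pev_def)
  then have "Q P0" unfolding Q_def by (auto intro!: exI[of _ 0])
  then obtain P where P: "Q P" "\<And>P'. Q P' \<Longrightarrow> degree P \<le> degree P'"
    using ex_has_least_nat[of Q P0 degree] by blast
  obtain m where m: "\<forall>v. pev P ((c ^^ m) v) = 0" using P(1) by (auto simp: Q_def)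
  have "degree P = 0"
  proof (rule ccontr)
    assume deg: "degree P \<noteq> 0"
    then obtain k where k: "degree P = Suc k" using not0_implies_Suc by blast
    have "coeff (pderiv P) k = of_nat (Suc k) * lead_coeff P"
      by (simp add: coeff_pderiv k)
    also have "\<dots> \<noteq> 0" using char[of "Suc k"] P(1) by (auto simp: Q_def simp del: of_nat_Suc)
    finally have "pderiv P \<noteq> 0" by auto
    moreover have "degree (pderiv P) < degree P"
      unfolding k less_Suc_eq_le by (rule degree_le) (auto simp: coeff_pderiv coeff_eq_0 k)
    moreover have "\<forall>v. pev (pderiv P) ((c ^^ (2 * m + 1)) v) = 0" using Q_pderiv[OF m] by blast
    ultimately have "Q (pderiv P)" "degree (pderiv P) < degree P" unfolding Q_def by blast+
    then show False using P(2)[of "pderiv P"] by simp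
  qed
  then obtain a where a: "P = [:a:]" by (metis degree_eq_zeroE)
  then have "a \<noteq> 0" using P(1) by (auto simp: Q_def)
  then have "\<forall>v. (c ^^ m) v = 0" using m by (simp add: a pev_def poly_comb_pCons)
  then show ?thesis by blast
qed

text \<open>Among the nonzero invariant subspaces take \<open>U\<close> of least dimension. The
  kernel of one \<open>f\<close> on \<open>U\<close> is nonzero because \<open>f\<close> is
  nilpotent, and invariant because the family commutes, so it is all of \<open>U\<close>.\<close>

lemma commuting_nilpotents_common_kernel:
  assumes lin: "\<And>f. f \<in> S \<Longrightarrow> Vector_Spaces.linear scale scale f"
    and nil: "\<And>f. f \<in> S \<Longrightarrow> \<exists>m. \<forall>v. (f ^^ m) v = 0"
    and comm: "\<And>f g v. f \<in> S \<Longrightarrow> g \<in> S \<Longrightarrow> f (g v) = g (f v)"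
    and nontriv: "(UNIV :: 'b set) \<noteq> {0}"
  shows "\<exists>v. v \<noteq> 0 \<and> (\<forall>f\<in>S. f v = 0)"
proof -
  define Q where "Q U \<longleftrightarrow> subspace U \<and> U \<noteq> {0} \<and> (\<forall>f\<in>S. \<forall>u\<in>U. f u \<in> U)" for U
  have "Q UNIV" using nontriv by (auto simp: Q_def)
  then obtain U where U: "Q U" "\<And>U'. Q U' \<Longrightarrow> dim U \<le> dim U'"
    using ex_has_least_nat[of Q UNIV dim] by blast
  have sub: "subspace U" and ne: "U \<noteq> {0}" and inv: "\<And>f u. f \<in> S \<Longrightarrow> u \<in> U \<Longrightarrow> f u \<in> U"
    using U(1) by (auto simp: Q_def)
  obtain u where u: "u \<in> U" "u \<noteq> 0" using ne subspace_0[OF sub] by blast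
  have "f w = 0" if f: "f \<in> S" and w: "w \<in> U" for f w
  proof -
    note lf = linear_simps[OF lin[OF f]]
    define U' where "U' = {v \<in> U. f v = 0}"
    obtain m where m: "(f ^^ m) u = 0" using nil[OF f] by blast
    define k where "k = (LEAST k. (f ^^ k) u = 0)"
    have k: "(f ^^ k) u = 0" unfolding k_def by (rule LeastI) (rule m)
    then have "k \<noteq> 0" using u by (cases k) auto
    then obtain l where l: "k = Suc l" using not0_implies_Suc by blast
    have "(f ^^ l) u \<noteq> 0" using not_less_Least[of l "\<lambda>k. (f ^^ k) u = 0"] l by (auto simp: k_def)
    moreover have "(f ^^ l) u \<in> U" by (induction l) (auto simp: u inv f)
    ultimately have "U' \<noteq> {0}" using k l by (auto simp: U'_def)
    moreover have "subspace U'"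
      using sub by (auto simp: U'_def subspace_def lf)
    moreover have "g v \<in> U'" if "g \<in> S" "v \<in> U'" for g v
      using that comm[OF f that(1), of v] linear_simps(3)[OF lin[OF that(1)]]
      by (auto simp: U'_def inv)
    ultimately have "Q U'" by (auto simp: Q_def)
    then have "U' = U"
      using subspace_dim_equal[of U' U] U(2) sub \<open>subspace U'\<close> by (auto simp: U'_def)
    then show ?thesis using w by (auto simp: U'_def)
  qed
  then show ?thesis using u by blast
qed

end

text \<open>The operators of brackets of \<open>A\<close> with the algebra commute and are
  nilpotent, so they share a nonzero kernel. This kernel is a submodule, because bracketing such an
  element once more gives an element of the same kind; irreducibility makes it the whole
  space.\<close>

lemma irreducible_abelian_ideal:
  fixes L :: "('k::field_char_0, 'a) lie_algebra" and s :: "'k \<Rightarrow> 'v::ab_group_add \<Rightarrow> 'v"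
  assumes fd: "finite_dimensional_vector_space s B"
    and irr: "lie_irreducible L s \<phi>"
    and A: "A \<subseteq> lcarrier L" "\<And>x y. x \<in> A \<Longrightarrow> y \<in> lcarrier L \<Longrightarrow> lbracket L x y \<in> A"
    and abel: "\<And>x y v. x \<in> A \<Longrightarrow> y \<in> A \<Longrightarrow> \<phi> (lbracket L x y) v = 0"
    and x: "x \<in> A" and y: "y \<in> lcarrier L"
  shows "\<phi> (lbracket L x y) v = 0"
proof -
  interpret finite_dimensional_vector_space s B by fact
  have rep: "lie_representation L s \<phi>" and nt: "(UNIV :: 'v set) \<noteq> {0}"
    and irr': "\<And>W. subspace W \<Longrightarrow> (\<forall>x\<in>lcarrier L. \<forall>w\<in>W. \<phi> x w \<in> W) \<Longrightarrow> W = {0} \<or> W = UNIV"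
    using irr by (auto simp: lie_irreducible_def)
  have lin: "Vector_Spaces.linear s s (\<phi> x)" if "x \<in> lcarrier L" for x
    using rep that by (auto simp: lie_representation_def)
  have br: "\<phi> (lbracket L x y) v = \<phi> x (\<phi> y v) - \<phi> y (\<phi> x v)"
    if "x \<in> lcarrier L" "y \<in> lcarrier L" for x y v
    using rep that by (auto simp: lie_representation_def)
  have comm: "\<phi> x (\<phi> y v) = \<phi> y (\<phi> x v)" if "x \<in> A" "y \<in> A" for x y v
    using abel[OF that, of v] br[of x y v] that A(1) by (auto simp: subset_iff)
  define S where "S = {\<phi> (lbracket L x y) | x y. x \<in> A \<and> y \<in> lcarrier L}"
  have "\<exists>v. v \<noteq> 0 \<and> (\<forall>f\<in>S. f v = 0)"
  proof (rule commuting_nilpotents_common_kernel[OF _ _ _ nt])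
    fix f assume "f \<in> S"
    then obtain x y where f: "f = \<phi> (lbracket L x y)" "x \<in> A" "y \<in> lcarrier L"
      by (auto simp: S_def)
    then have cA: "lbracket L x y \<in> A" "lbracket L (lbracket L x y) y \<in> A" using A by auto
    then show "Vector_Spaces.linear s s f" using lin f A(1) by auto
    \<comment> \<open>Of the four operators handed to \<open>commutator_nilpotent\<close>, those in
      the roles of \<open>x\<close>, \<open>c\<close> and \<open>d\<close> come from
      \<open>A\<close> and hence commute.\<close>
    show "\<exists>m. \<forall>v. (f ^^ m) v = 0"
      unfolding f
      by (rule commutator_nilpotent[of "\<phi> x" "\<phi> y" _ "\<phi> (lbracket L (lbracket L x y) y)"])
         (use f cA A(1) in \<open>auto simp: subset_iff intro!: lin br comm\<close>)
  next
    fix f g v assume "f \<in> S" "g \<in> S"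
    then show "f (g v) = g (f v)" using comm A by (auto simp: S_def)
  qed
  then obtain v0 where v0: "v0 \<noteq> 0" "\<forall>f\<in>S. f v0 = 0" by blast
  define W where "W = {v. \<forall>f\<in>S. f v = 0}"
  have linS: "Vector_Spaces.linear s s f" if "f \<in> S" for f
    using that lin A by (auto simp: S_def)
  have "subspace W"
    by (auto simp: subspace_def W_def linear_simps[OF linS])
  moreover have "\<phi> z w \<in> W" if z: "z \<in> lcarrier L" and w: "w \<in> W" for z w
  proof -
    have "\<phi> (lbracket L x y) (\<phi> z w) = 0" if xy: "x \<in> A" "y \<in> lcarrier L" for x y
    proof -
      have in1: "lbracket L x y \<in> A" "lbracket L x y \<in> lcarrier L" using A xy by auto
      have 0: "\<phi> (lbracket L x y) w = 0" "\<phi> (lbracket L (lbracket L x y) z) w = 0"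
        using w xy z in1 by (auto simp: W_def S_def)
      have "\<phi> (lbracket L x y) (\<phi> z w) = \<phi> z (\<phi> (lbracket L x y) w)"
        using 0(2) br[OF in1(2) z, of w] by simp
      then show ?thesis using 0 linear_simps(3)[OF lin[OF z]] by simp
    qed
    then show ?thesis by (auto simp: W_def S_def)
  qed
  ultimately have "W = UNIV" using irr'[of W] v0 by (auto simp: W_def)
  then show ?thesis using x y by (auto simp: W_def S_def)
qed

section \<open>Unitary Lie algebras over an algebra with involution\<close>

sublocale inv_algebra \<subseteq> vs: vector_space "ascale R"
  by (rule scale)

context inv_algebra
begin

lemma mult_zero_left [simp]: "amult R 0 a = 0"
  using mult_add_left[of 0 0 a] by simp

lemma mult_zero_right [simp]: "amult R a 0 = 0"
  using mult_add_right[of a 0 0] by simp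

lemma mult_minus_left: "amult R (- a) b = - amult R a b"
  using mult_add_left[of "- a" a b] by (simp add: eq_neg_iff_add_eq_0)

lemma mult_minus_right: "amult R a (- b) = - amult R a b"
  using mult_add_right[of a "- b" b] by (simp add: eq_neg_iff_add_eq_0)

lemma mult_diff_left: "amult R (a - b) c = amult R a c - amult R b c"
  using mult_add_left[of a "- b" c] by (simp add: mult_minus_left)

lemma mult_diff_right: "amult R a (b - c) = amult R a b - amult R a c"
  using mult_add_right[of a b "- c"] by (simp add: mult_minus_right)

lemma mult_sum_left: "amult R (sum f A) b = (\<Sum>x\<in>A. amult R (f x) b)"
  by (induction A rule: infinite_finite_induct) (auto simp: mult_add_left)

lemma mult_sum_right: "amult R b (sum f A) = (\<Sum>x\<in>A. amult R b (f x))"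
  by (induction A rule: infinite_finite_induct) (auto simp: mult_add_right)

lemma star_zero [simp]: "astar R 0 = 0"
  using star_add[of 0 0] by simp

lemma star_minus: "astar R (- a) = - astar R a"
  using star_add[of "- a" a] by (simp add: eq_neg_iff_add_eq_0)

lemma star_diff: "astar R (a - b) = astar R a - astar R b"
  using star_add[of a "- b"] by (simp add: star_minus)

lemma star_sum: "astar R (sum f A) = (\<Sum>x\<in>A. astar R (f x))"
  by (induction A rule: infinite_finite_induct) (auto simp: star_add)

lemma star_one [simp]: "astar R (aone R) = aone R"
  using star_mult[of "aone R" "astar R (aone R)"] by (simp add: star_star one_mult mult_one)

definition star_ideal :: "'r set \<Rightarrow> bool" where
  "star_ideal J \<longleftrightarrow> 0 \<in> J \<and> (\<forall>a\<in>J. \<forall>b\<in>J. a + b \<in> J) \<and> (\<forall>c. \<forall>a\<in>J. ascale R c a \<in> J) \<and>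
     (\<forall>a\<in>J. \<forall>b. amult R a b \<in> J \<and> amult R b a \<in> J) \<and> (\<forall>a\<in>J. astar R a \<in> J)"

lemma star_idealD:
  assumes "star_ideal J"
  shows "0 \<in> J" "a \<in> J \<Longrightarrow> b \<in> J \<Longrightarrow> a + b \<in> J" "a \<in> J \<Longrightarrow> ascale R c a \<in> J"
    "a \<in> J \<Longrightarrow> amult R a b \<in> J" "a \<in> J \<Longrightarrow> amult R b a \<in> J" "a \<in> J \<Longrightarrow> astar R a \<in> J"
    "a \<in> J \<Longrightarrow> - a \<in> J" "a \<in> J \<Longrightarrow> b \<in> J \<Longrightarrow> a - b \<in> J"
    "(\<And>x. x \<in> A \<Longrightarrow> f x \<in> J) \<Longrightarrow> sum f A \<in> J"
proof -
  show *: "0 \<in> J" "a \<in> J \<Longrightarrow> b \<in> J \<Longrightarrow> a + b \<in> J" "a \<in> J \<Longrightarrow> ascale R c a \<in> J"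
    "a \<in> J \<Longrightarrow> amult R a b \<in> J" "a \<in> J \<Longrightarrow> amult R b a \<in> J" "a \<in> J \<Longrightarrow> astar R a \<in> J" for a b c
    using assms by (auto simp: star_ideal_def)
  show neg: "a \<in> J \<Longrightarrow> - a \<in> J" for a
    using *(3)[of a "-1"] by simp
  show "a \<in> J \<Longrightarrow> b \<in> J \<Longrightarrow> a - b \<in> J" using *(2)[of a "- b"] neg by simp
  show "(\<And>x. x \<in> A \<Longrightarrow> f x \<in> J) \<Longrightarrow> sum f A \<in> J"
    by (induction A rule: infinite_finite_induct) (auto simp: *)
qed

lemma star_ideal_unscale:
  assumes "star_ideal J" "ascale R c a \<in> J" "c \<noteq> 0"
  shows "a \<in> J"
  using star_idealD(3)[OF assms(1,2), of "inverse c"] assms(3) by simp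

end

text \<open>Averaging over conjugation by the units in \<open>U\<close> kills commutators; this takes the place of the
  trace modulo commutators.\<close>

locale unitary = inv_algebra R
  for R :: "('k::field_char_0, 'r::ab_group_add) inv_algebra" +
  fixes n :: nat and \<rho> :: 'k and U :: "('r \<times> 'r) set"
  assumes n3: "3 \<le> n" and rho: "\<rho> = 1 \<or> \<rho> = -1"
    and finU: "finite U" and neU: "U \<noteq> {}"
    and invU: "(u, v) \<in> U \<Longrightarrow> amult R u v = aone R" "(u, v) \<in> U \<Longrightarrow> amult R v u = aone R"
    and commU: "(\<Sum>(u, v)\<in>U. amult R (amult R u (amult R a b)) v) =
      (\<Sum>(u, v)\<in>U. amult R (amult R u (amult R b a)) v)"
begin

abbreviation G where "G \<equiv> lcarrier (g_lie n \<rho> R)"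
abbreviation br where "br \<equiv> lbracket (gl (2 * n) R)"
abbreviation gens where "gens \<equiv>
     ({f_mat R n i j a | i j a. i \<in> {1..n} \<and> j \<in> {1..n} \<and> i \<noteq> j} \<union>
      {g_mat R n \<rho> i j a | i j a. 1 \<le> i \<and> i \<le> j \<and> j \<le> n} \<union>
      {h_mat R n \<rho> i j a | i j a. 1 \<le> i \<and> i \<le> j \<and> j \<le> n})"

definition avg :: "'r \<Rightarrow> 'r" where
  "avg a = (\<Sum>(u, v)\<in>U. amult R (amult R u a) v)"

definition idx :: "nat set" where "idx = {1..2 * n}"
definition pr :: "nat \<Rightarrow> nat" where "pr p = (if p \<le> n then p + n else p - n)"
definition eps :: "nat \<Rightarrow> 'k" where "eps p = (if p \<le> n then 1 else \<rho>)"

text \<open>Skew-adjointness for the form whose Gram matrix has the identity in the upper right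
  block and \<rho> times the identity in the lower left one; \<open>pr\<close> exchanges paired
  indices and \<open>eps\<close> carries the sign.\<close>

definition skew :: "(nat \<Rightarrow> nat \<Rightarrow> 'r) \<Rightarrow> bool" where
  "skew X \<longleftrightarrow> (\<forall>p\<in>idx. \<forall>q\<in>idx.
     X (pr q) (pr p) = ascale R (- (eps p * eps q)) (astar R (X p q)))"

text \<open>The common form of the generators: \<open>F i j\<close>, \<open>F i (n + j)\<close> and \<open>F (n + i) j\<close>
  are $f_{ij}$, $g_{ij}$ and $h_{ij}$.\<close>

definition F :: "nat \<Rightarrow> nat \<Rightarrow> 'r \<Rightarrow> nat \<Rightarrow> nat \<Rightarrow> 'r" where
  "F p q a = (\<lambda>i j. e_mat p q a i j -
     e_mat (pr q) (pr p) (ascale R (eps p * eps q) (astar R a)) i j)"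

lemma F_entry: "F p q a i j = (if i = p \<and> j = q then a else 0) -
     (if i = pr q \<and> j = pr p then ascale R (eps p * eps q) (astar R a) else 0)"
  by (simp add: F_def e_mat_def)

lemma e_mat_add: "e_mat p q (a + b) i j = e_mat p q a i j + (e_mat p q b i j :: 'r)"
  by (simp add: e_mat_def)

lemma e_mat_scale: "e_mat p q (ascale R c a) i j = ascale R c (e_mat p q a i j)"
  by (simp add: e_mat_def)

lemma e_mat_zero [simp]: "e_mat p q 0 i j = (0::'r)"
  by (simp add: e_mat_def)


lemma pr_dom [simp]: "p \<in> idx \<Longrightarrow> pr p \<in> idx"
  and pr_pr [simp]: "p \<in> idx \<Longrightarrow> pr (pr p) = p"
  and pr_neq [simp]: "p \<in> idx \<Longrightarrow> pr p \<noteq> p" "p \<in> idx \<Longrightarrow> p \<noteq> pr p"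
  by (auto simp: pr_def idx_def)

lemma finite_idx [simp]: "finite idx"
  by (simp add: idx_def)

lemma pr_eq_iff: "p \<in> idx \<Longrightarrow> q \<in> idx \<Longrightarrow> pr p = pr q \<longleftrightarrow> p = q"
  by (metis pr_pr)

lemma pr_eq_swap: "p \<in> idx \<Longrightarrow> q \<in> idx \<Longrightarrow> pr p = q \<longleftrightarrow> p = pr q"
  by (metis pr_pr)

lemma rho_sq [simp]: "\<rho> * \<rho> = 1" "\<rho> * (\<rho> * c) = c"
  using rho by auto

lemma eps_sq [simp]: "eps p * eps p = 1" "eps p * (eps p * c) = c"
  by (auto simp: eps_def)

lemma eps_pr: "p \<in> idx \<Longrightarrow> eps (pr p) = \<rho> * eps p"
  by (auto simp: eps_def pr_def idx_def)

lemma bij_pr: "bij_betw pr idx idx"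
  by (rule bij_betw_byWitness[where f' = pr]) (use pr_dom pr_pr in blast)+

text \<open>\<open>b\<close> numbers the pairs \<open>{r, pr r}\<close>. At least three pairs exist
  because \<open>3 \<le> n\<close>, and \<open>p\<close> and \<open>q\<close> meet at most two of
  them.\<close>

lemma third_index:
  assumes "p \<in> idx" "q \<in> idx"
  obtains r where "r \<in> idx" "r \<noteq> p" "r \<noteq> pr p" "r \<noteq> q" "r \<noteq> pr q"
proof -
  define b where "b p = (if p \<le> n then p else p - n)" for p
  have "card {b p, b q} \<le> 2" by (cases "b p = b q") auto
  then have "card {b p, b q} < card {1::nat, 2, 3}" by simp
  then have "\<not> {1::nat, 2, 3} \<subseteq> {b p, b q}" by (meson card_mono finite.emptyI finite.insertI not_le)
  then obtain r where r: "r \<in> {1, 2, 3}" "r \<noteq> b p" "r \<noteq> b q" by blast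
  then have "r \<le> n" "r \<in> idx" using n3 by (auto simp: idx_def)
  then show thesis using r assms that[of r] by (auto simp: b_def pr_def idx_def split: if_splits)
qed

lemma gl_simps:
  "lcarrier (gl (2 * n) R) = {A. \<forall>i j. i \<notin> idx \<or> j \<notin> idx \<longrightarrow> A i j = 0}"
  "lzero (gl (2 * n) R) = (\<lambda>i j. 0)"
  "ladd (gl (2 * n) R) X Y = (\<lambda>i j. X i j + Y i j)"
  "lscale (gl (2 * n) R) c X = (\<lambda>i j. ascale R c (X i j))"
  "br X Y = (\<lambda>i j. (\<Sum>l\<in>idx. amult R (X i l) (Y l j)) - (\<Sum>l\<in>idx. amult R (Y i l) (X l j)))"
  by (simp_all add: gl_def mat_mult_def idx_def)

lemma g_lie_simps:
  "lzero (g_lie n \<rho> R) = (\<lambda>i j. 0)"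
  "ladd (g_lie n \<rho> R) X Y = (\<lambda>i j. X i j + Y i j)"
  "lscale (g_lie n \<rho> R) c X = (\<lambda>i j. ascale R c (X i j))"
  "lbracket (g_lie n \<rho> R) X Y = br X Y"
  "G = \<Inter>{H. lie_subalgebra H (gl (2 * n) R) \<and> gens \<subseteq> H}"
  by (simp_all add: g_lie_def lie_generate_def gl_simps gl_def)

lemma br_gl: "X \<in> lcarrier (gl (2 * n) R) \<Longrightarrow> Y \<in> lcarrier (gl (2 * n) R) \<Longrightarrow>
    br X Y \<in> lcarrier (gl (2 * n) R)"
  by (auto simp: gl_simps)

lemma G_minimal: "lie_subalgebra H (gl (2 * n) R) \<Longrightarrow> gens \<subseteq> H \<Longrightarrow> G \<subseteq> H"
  by (auto simp: g_lie_simps)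

lemma F_add: "F p q (a + b) = (\<lambda>i j. F p q a i j + F p q b i j)"
  by (intro ext) (simp add: F_def star_add vs.scale_right_distrib e_mat_add)

lemma F_scale: "F p q (ascale R c a) = (\<lambda>i j. ascale R c (F p q a i j))"
  by (intro ext) (simp add: F_def star_scale e_mat_scale vs.scale_right_diff_distrib ac_simps)

lemma F_zero: "F p q 0 = (\<lambda>i j. 0)"
  by (intro ext) (simp add: F_def)

text \<open>Every root space has two names. This recovers the positions absent from the list of
  generators, and later makes \<open>J\<close> stable under the involution.\<close>

lemma F_swap:
  assumes "p \<in> idx" "q \<in> idx"
  shows "F (pr q) (pr p) (astar R a) = (\<lambda>i j. ascale R (- (eps p * eps q)) (F p q a i j))"
  using assms
  by (intro ext) (simp add: F_def e_mat_scale eps_pr star_star vs.scale_right_diff_distrib ac_simps)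

lemma F_gl: "p \<in> idx \<Longrightarrow> q \<in> idx \<Longrightarrow> F p q a \<in> lcarrier (gl (2 * n) R)"
  using pr_dom[of p] pr_dom[of q] by (auto simp: F_entry gl_simps simp del: pr_dom)

lemma f_mat_F: "i \<le> n \<Longrightarrow> j \<le> n \<Longrightarrow> f_mat R n i j a = F i j a"
  by (intro ext) (auto simp: f_mat_def F_entry e_mat_def fun_diff_def pr_def eps_def add.commute)

lemma g_mat_F: "1 \<le> i \<Longrightarrow> 1 \<le> j \<Longrightarrow> i \<le> n \<Longrightarrow> j \<le> n \<Longrightarrow> g_mat R n \<rho> i j a = F i (n + j) a"
  by (intro ext) (auto simp: g_mat_def F_entry e_mat_def fun_diff_def pr_def eps_def add.commute)

lemma h_mat_F: "1 \<le> i \<Longrightarrow> 1 \<le> j \<Longrightarrow> i \<le> n \<Longrightarrow> j \<le> n \<Longrightarrow> h_mat R n \<rho> i j a = F (n + i) j a"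
  by (intro ext) (auto simp: h_mat_def F_entry e_mat_def fun_diff_def pr_def eps_def add.commute)

lemma gens_F:
  assumes "X \<in> gens"
  obtains p q a where "p \<in> idx" "q \<in> idx" "p \<noteq> q" "X = F p q a"
proof -
  from assms consider i j a where "X = f_mat R n i j a" "i \<in> {1..n}" "j \<in> {1..n}" "i \<noteq> j"
    | i j a where "X = g_mat R n \<rho> i j a" "1 \<le> i" "i \<le> j" "j \<le> n"
    | i j a where "X = h_mat R n \<rho> i j a" "1 \<le> i" "i \<le> j" "j \<le> n"
    by blast
  then show thesis
  proof cases
    case 1
    then show thesis by (intro that[of i j a]) (auto simp: f_mat_F idx_def)
  next
    case 2
    then show thesis by (intro that[of i "n + j" a]) (auto simp: g_mat_F idx_def)
  next
    case 3
    then show thesis by (intro that[of "n + i" j a]) (auto simp: h_mat_F idx_def)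
  qed
qed

lemma subalgebra_G: "lie_subalgebra G (gl (2 * n) R)"
proof -
  have "lie_subalgebra (lcarrier (gl (2 * n) R)) (gl (2 * n) R)"
    unfolding lie_subalgebra_def using br_gl by (auto simp: gl_simps)
  moreover have "gens \<subseteq> lcarrier (gl (2 * n) R)"
  proof
    fix X assume "X \<in> gens"
    then obtain p q a where "p \<in> idx" "q \<in> idx" "p \<noteq> q" "X = F p q a" by (rule gens_F)
    then show "X \<in> lcarrier (gl (2 * n) R)" by (simp add: F_gl)
  qed
  ultimately have "G \<subseteq> lcarrier (gl (2 * n) R)" by (rule G_minimal)
  then show ?thesis by (auto simp: lie_subalgebra_def g_lie_simps)
qed

lemma G_closed:
  "(\<lambda>i j. 0) \<in> G" "X \<in> G \<Longrightarrow> Y \<in> G \<Longrightarrow> (\<lambda>i j. X i j + Y i j) \<in> G"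
  "X \<in> G \<Longrightarrow> (\<lambda>i j. ascale R c (X i j)) \<in> G" "X \<in> G \<Longrightarrow> Y \<in> G \<Longrightarrow> br X Y \<in> G"
  "X \<in> G \<Longrightarrow> X \<in> lcarrier (gl (2 * n) R)"
  using subalgebra_G unfolding lie_subalgebra_def gl_simps(2-4) by blast+

lemma F_G:
  assumes "p \<in> idx" "q \<in> idx" "p \<noteq> q"
  shows "F p q a \<in> G"
proof -
  have gen: "X \<in> G" if "X \<in> gens" for X
    unfolding g_lie_simps(5) by (rule InterI) (use that in \<open>simp only: mem_Collect_eq subset_iff\<close>)
  have gen_f: "F i j a \<in> G" if "i \<in> {1..n}" "j \<in> {1..n}" "i \<noteq> j" for i j a
  proof -
    have "f_mat R n i j a \<in> G" using that by (intro gen) blast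
    then show ?thesis using that by (simp add: f_mat_F)
  qed
  have gen_g: "F i (n + j) a \<in> G" if "1 \<le> i" "i \<le> j" "j \<le> n" for i j a
  proof -
    have "g_mat R n \<rho> i j a \<in> G" using that by (intro gen) blast
    then show ?thesis using that by (simp add: g_mat_F)
  qed
  have gen_h: "F (n + i) j a \<in> G" if "1 \<le> i" "i \<le> j" "j \<le> n" for i j a
  proof -
    have "h_mat R n \<rho> i j a \<in> G" using that by (intro gen) blast
    then show ?thesis using that by (simp add: h_mat_F)
  qed
  have le: "F p q a \<in> G" if "p \<in> idx" "q \<in> idx" "p \<noteq> q" "p \<le> n" "q \<le> n \<or> p \<le> q - n" for p q a
    using that gen_f[of p q a] gen_g[of p "q - n" a] by (cases "q \<le> n") (auto simp: idx_def)
  have h: "F p q a \<in> G" if "p \<in> idx" "q \<in> idx" "p \<noteq> q" "p > n" "q \<le> n" "p - n \<le> q" for p q a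
    using that gen_h[of "p - n" q a] by (auto simp: idx_def)
  have swap: "F p q a \<in> G" if pq: "F (pr q) (pr p) (astar R a) \<in> G" "p \<in> idx" "q \<in> idx"
  proof -
    have "(\<lambda>i j. ascale R (- (eps p * eps q)) (F (pr q) (pr p) (astar R a) i j)) \<in> G"
      by (rule G_closed) (rule pq)
    then show ?thesis unfolding F_swap[OF pq(2,3)] by (simp add: ac_simps)
  qed
  \<comment> \<open>Cases 1 and 4 are generator positions; the other three are mirror images of such
    positions under \<open>F_swap\<close>.\<close>
  consider "p \<le> n" "q \<le> n \<or> p \<le> q - n" | "p \<le> n" "q > n" "q - n < p"
    | "p > n" "q > n" | "p > n" "q \<le> n" "p - n \<le> q" | "p > n" "q \<le> n" "q < p - n" by linarith
  then show ?thesis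
  proof cases
    case 1
    then show ?thesis using le assms by blast
  next
    case 2
    then show ?thesis using assms by (intro swap le) (auto simp: pr_def idx_def)
  next
    case 3
    then show ?thesis using assms by (intro swap le) (auto simp: pr_def idx_def)
  next
    case 4
    then show ?thesis using h assms by blast
  next
    case 5
    then show ?thesis using assms by (intro swap h) (auto simp: pr_def idx_def)
  qed
qed

lemma br_F:
  assumes p: "p \<in> idx" and q: "q \<in> idx"
  shows "br (F p q a) X i j =
    (if i = p then amult R a (X q j) else 0) -
    (if i = pr q then amult R (ascale R (eps p * eps q) (astar R a)) (X (pr p) j) else 0) -
    (if j = q then amult R (X i p) a else 0) +
    (if j = pr p then amult R (X i (pr q)) (ascale R (eps p * eps q) (astar R a)) else 0)"
proof -
  let ?c = "ascale R (eps p * eps q) (astar R a)"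
  have "(\<Sum>l\<in>idx. amult R (F p q a i l) (X l j)) =
    (\<Sum>l\<in>idx. (if l = q then if i = p then amult R a (X q j) else 0 else 0) -
      (if l = pr p then if i = pr q then amult R ?c (X (pr p) j) else 0 else 0))"
    by (rule sum.cong) (auto simp: F_entry mult_diff_left mult_minus_left)
  also have "\<dots> = (if i = p then amult R a (X q j) else 0) -
      (if i = pr q then amult R ?c (X (pr p) j) else 0)"
    using q pr_dom[OF p] by (simp add: sum_subtractf sum.delta del: pr_dom)
  finally have 1: "(\<Sum>l\<in>idx. amult R (F p q a i l) (X l j)) =
      (if i = p then amult R a (X q j) else 0) -
      (if i = pr q then amult R ?c (X (pr p) j) else 0)" .
  have "(\<Sum>l\<in>idx. amult R (X i l) (F p q a l j)) =
    (\<Sum>l\<in>idx. (if l = p then if j = q then amult R (X i p) a else 0 else 0) -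
      (if l = pr q then if j = pr p then amult R (X i (pr q)) ?c else 0 else 0))"
    by (rule sum.cong) (auto simp: F_entry mult_diff_right mult_minus_right)
  also have "\<dots> = (if j = q then amult R (X i p) a else 0) -
      (if j = pr p then amult R (X i (pr q)) ?c else 0)"
    using p pr_dom[OF q] by (simp add: sum_subtractf sum.delta del: pr_dom)
  finally show ?thesis unfolding gl_simps 1 by simp
qed

text \<open>Excluded are the diagonal and the positions \<open>(p, pr p)\<close>, where the two
  entries of \<open>F p q a\<close> collide and leave \<open>a - \<rho> astar a\<close>. At a good
  position \<open>a\<close> can be read off.\<close>

definition good :: "nat \<Rightarrow> nat \<Rightarrow> bool" where
  "good p q \<longleftrightarrow> p \<in> idx \<and> q \<in> idx \<and> q \<noteq> p \<and> q \<noteq> pr p"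

lemma goodD: "good p q \<Longrightarrow> p \<in> idx" "good p q \<Longrightarrow> q \<in> idx" "good p q \<Longrightarrow> q \<noteq> p" "good p q \<Longrightarrow> p \<noteq> q"
  "good p q \<Longrightarrow> q \<noteq> pr p" "good p q \<Longrightarrow> p \<noteq> pr q" "good p q \<Longrightarrow> pr p \<noteq> q" "good p q \<Longrightarrow> pr q \<noteq> p"
  unfolding good_def using pr_pr by metis+

lemma good_sym: "good p q \<Longrightarrow> good q p" "good p q \<Longrightarrow> good p (pr q)" "good p q \<Longrightarrow> good (pr p) q"
  unfolding good_def using pr_pr pr_dom by metis+

section \<open>Brackets of root elements\<close>

lemma if_conj_rearrange:
  fixes x y z w :: 'r
  shows "(if A then if B then x else 0 else 0) - (if C then if P \<and> D then - y else 0 else 0) -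
      (if E then if H \<and> P then z else 0 else 0) + (if K then if L then - w else 0 else 0) =
    (if A \<and> B then x else 0) - (if L \<and> K then w else 0) -
      (if P then (if H \<and> E then z else 0) - (if C \<and> D then y else 0) else 0)"
  by simp

text \<open>Along a chain of good positions root elements multiply like matrix units; a chain that
  closes up also contributes the product in the other order. The end \<open>r = pr p\<close> is
  permitted, and that is how the positions which are not good are reached.\<close>

lemma br_FF:
  assumes pq: "good p q" and qr: "good q r"
  shows "br (F p q a) (F q r b) =
    (\<lambda>i j. F p r (amult R a b) i j - (if r = p then F q q (amult R b a) i j else 0))"
proof (intro ext)
  fix i j
  note d = goodD[OF pq] goodD[OF qr]
  let ?c = "ascale R (eps p * eps q) (astar R a)" and ?d = "ascale R (eps q * eps r) (astar R b)"
  have dc: "amult R ?d ?c = ascale R (eps p * eps r) (astar R (amult R a b))"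
    by (simp add: mult_scale_left mult_scale_right star_mult ac_simps)
  have cd: "amult R ?c ?d = astar R (amult R b a)" if "r = p"
    using that by (simp add: mult_scale_left mult_scale_right star_mult ac_simps)
  have 1: "amult R a (F q r b q j) = (if j = r then amult R a b else 0)"
    unfolding F_entry using d by simp
  have "pr p = pr r \<longleftrightarrow> r = p" using d pr_eq_iff[of p r] by blast
  then have 2: "amult R ?c (F q r b (pr p) j) = (if r = p \<and> j = pr q then - amult R ?c ?d else 0)"
    unfolding F_entry using d by (simp add: mult_minus_right)
  have "p = r \<longleftrightarrow> r = p" by blast
  then have 3: "amult R (F q r b i p) a = (if i = q \<and> r = p then amult R b a else 0)"
    unfolding F_entry using d by simp
  have 4: "amult R (F q r b i (pr q)) ?c = (if i = pr r then - amult R ?d ?c else 0)"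
    unfolding F_entry using d by (simp add: mult_minus_left)
  show "br (F p q a) (F q r b) i j =
    F p r (amult R a b) i j - (if r = p then F q q (amult R b a) i j else 0)"
    unfolding br_F[OF d(1,2)] 1 2 3 4 dc unfolding F_entry eps_sq vs.scale_one
    by (subst if_conj_rearrange, rule if_cong[THEN arg_cong[where f = "\<lambda>x. _ - _ - x"]])
       (rule refl, drule cd, simp only:, rule refl)
qed

lemma br_FF_good:
  assumes "good p q" "good q r" "r \<noteq> p"
  shows "br (F p q a) (F q r b) = F p r (amult R a b)"
  using assms by (simp add: br_FF)

lemma br_FF_diag:
  assumes "good p q"
  shows "br (F p q a) (F q p b) = (\<lambda>i j. F p p (amult R a b) i j - F q q (amult R b a) i j)"
  using assms good_sym by (simp add: br_FF)

section \<open>Skewness and the averaged trace\<close>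

lemma avg_zero [simp]: "avg 0 = 0" by (auto simp: avg_def intro!: sum.neutral)
lemma avg_add: "avg (a + b) = avg a + avg b"
  by (simp add: avg_def mult_add_left mult_add_right case_prod_unfold sum.distrib)
lemma avg_scale: "avg (ascale R c a) = ascale R c (avg a)"
  by (simp add: avg_def mult_scale_left mult_scale_right case_prod_unfold vs.scale_sum_right)
lemma avg_minus: "avg (- a) = - avg a"
  using avg_scale[of "-1" a] by simp
lemma avg_diff: "avg (a - b) = avg a - avg b"
  using avg_add[of a "- b"] by (simp add: avg_minus)
lemma avg_sum: "avg (sum f A) = (\<Sum>x\<in>A. avg (f x))"
  by (induction A rule: infinite_finite_induct) (auto simp: avg_add)
lemma avg_comm: "avg (amult R a b) = avg (amult R b a)"
  using commU by (simp add: avg_def)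

definition tr :: "(nat \<Rightarrow> nat \<Rightarrow> 'r) \<Rightarrow> 'r" where "tr X = (\<Sum>p\<in>idx. X p p)"

text \<open>The adjoint reverses products, so its eigenspace for -1 is closed under brackets. The
  auxiliary identity is the rule for the adjoint of a product, with the summation index
  \<open>l\<close> replaced by \<open>pr l\<close>.\<close>

lemma skew_br:
  assumes X: "skew X" and Y: "skew Y"
  shows "skew (br X Y)"
proof -
  have *: "(\<Sum>l\<in>idx. amult R (X (pr q) l) (Y l (pr p))) =
    ascale R (eps p * eps q) (astar R (\<Sum>l\<in>idx. amult R (Y p l) (X l q)))"
    if pq: "p \<in> idx" "q \<in> idx" and X: "skew X" and Y: "skew Y" for p q X Y
  proof -
    have "(\<Sum>l\<in>idx. amult R (X (pr q) l) (Y l (pr p))) =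
      (\<Sum>l\<in>idx. amult R (X (pr q) (pr l)) (Y (pr l) (pr p)))"
      by (rule sum.reindex_bij_betw[OF bij_pr, symmetric])
    also have "\<dots> = (\<Sum>l\<in>idx. ascale R (eps p * eps q) (astar R (amult R (Y p l) (X l q))))"
      using that unfolding skew_def
      by (intro sum.cong) (auto simp: mult_scale_left mult_scale_right star_mult mult_minus_left mult_minus_right ac_simps)
    finally show ?thesis by (simp add: star_sum vs.scale_sum_right)
  qed
  show ?thesis
    unfolding skew_def gl_simps
    using *[OF _ _ X Y] *[OF _ _ Y X]
    by (simp add: star_diff vs.scale_right_diff_distrib)
qed

lemma avg_tr_br: "avg (tr (br X Y)) = 0"
proof -
  have "avg (tr (br X Y)) = (\<Sum>p\<in>idx. \<Sum>l\<in>idx. avg (amult R (X p l) (Y l p))) -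
      (\<Sum>p\<in>idx. \<Sum>l\<in>idx. avg (amult R (X l p) (Y p l)))"
    by (simp add: tr_def gl_simps avg_sum avg_diff sum_subtractf avg_comm[of "Y _ _"])
  also have "(\<Sum>p\<in>idx. \<Sum>l\<in>idx. avg (amult R (X l p) (Y p l))) =
      (\<Sum>p\<in>idx. \<Sum>l\<in>idx. avg (amult R (X p l) (Y l p)))"
    by (rule sum.swap)
  finally show ?thesis by simp
qed

lemma e_mat_pr:
  assumes "p \<in> idx" "q \<in> idx" "i \<in> idx" "j \<in> idx"
  shows "e_mat (pr q) (pr p) a (pr j) (pr i) = (e_mat p q a i j :: 'r)"
    "e_mat p q a (pr j) (pr i) = (e_mat (pr q) (pr p) a i j :: 'r)"
proof -
  have "pr j = pr q \<and> pr i = pr p \<longleftrightarrow> i = p \<and> j = q" using assms pr_eq_iff by blast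
  moreover have "pr j = p \<and> pr i = q \<longleftrightarrow> i = pr q \<and> j = pr p" using assms pr_eq_swap by blast
  ultimately show "e_mat (pr q) (pr p) a (pr j) (pr i) = (e_mat p q a i j :: 'r)"
    "e_mat p q a (pr j) (pr i) = (e_mat (pr q) (pr p) a i j :: 'r)"
    unfolding e_mat_def by (simp_all only:)
qed

lemma e_mat_sign: "ascale R (eps i * eps j) (e_mat p q a i j) = ascale R (eps p * eps q) (e_mat p q a i j)"
  by (simp add: e_mat_def)

lemma star_e_mat: "astar R (e_mat p q a i j) = e_mat p q (astar R a) i j"
  by (simp add: e_mat_def)

lemma skew_F:
  assumes p: "p \<in> idx" and q: "q \<in> idx"
  shows "skew (F p q a)"
  unfolding skew_def
proof (intro ballI)
  fix i j assume ij: "i \<in> idx" "j \<in> idx"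
  have s: "ascale R (eps i * eps j) (F p q a i j) = ascale R (eps p * eps q) (F p q a i j)"
    unfolding F_def vs.scale_right_diff_distrib e_mat_sign[of i j p q] e_mat_sign[of i j "pr q" "pr p"]
      eps_pr[OF p] eps_pr[OF q]
    by (simp add: ac_simps)
  have "F p q a (pr j) (pr i) = - ascale R (eps p * eps q) (astar R (F p q a i j))"
    unfolding F_def
    by (simp add: e_mat_pr[OF p q ij] star_diff star_e_mat star_scale star_star e_mat_scale
      vs.scale_right_diff_distrib ac_simps)
  also have "ascale R (eps p * eps q) (astar R (F p q a i j)) =
      ascale R (eps i * eps j) (astar R (F p q a i j))"
    using arg_cong[OF s, of "astar R"] unfolding star_scale by (rule sym)
  finally show "F p q a (pr j) (pr i) = ascale R (- (eps i * eps j)) (astar R (F p q a i j))"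
    by simp
qed

lemma tr_F: "p \<in> idx \<Longrightarrow> q \<in> idx \<Longrightarrow> p \<noteq> q \<Longrightarrow> tr (F p q a) = 0"
  unfolding tr_def by (intro sum.neutral) (auto simp: F_entry pr_eq_iff pr_eq_swap)

text \<open>Both conditions hold for the generators and define a subalgebra, so they bound
  \<open>G\<close> from above. That they characterise \<open>G\<close> is shown in
  \<open>G_iff\<close>.\<close>

lemma G_skew:
  assumes "X \<in> G"
  shows "skew X" "avg (tr X) = 0"
proof -
  define H where "H = {X \<in> lcarrier (gl (2 * n) R). skew X \<and> avg (tr X) = 0}"
  have tr_add: "tr (\<lambda>i j. X i j + Y i j) = tr X + tr Y"
    and tr_scale: "tr (\<lambda>i j. ascale R c (X i j)) = ascale R c (tr X)" for X Y c
    by (simp_all add: tr_def sum.distrib vs.scale_sum_right)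
  have sk_add: "skew (\<lambda>i j. X i j + Y i j)" if "skew X" "skew Y" for X Y
    using that unfolding skew_def by (simp add: star_add vs.scale_right_distrib)
  have sk_scale: "skew (\<lambda>i j. ascale R c (X i j))" if "skew X" for X c
    using that unfolding skew_def by (simp add: star_scale ac_simps)
  have "skew (\<lambda>i j. 0)" "tr (\<lambda>i j. 0) = 0" by (simp_all add: skew_def tr_def)
  then have "lie_subalgebra H (gl (2 * n) R)"
    unfolding lie_subalgebra_def H_def gl_simps(2-4) mem_Collect_eq
    by (intro conjI ballI allI subsetI)
       (simp_all add: br_gl skew_br avg_tr_br tr_add tr_scale avg_add avg_scale sk_add sk_scale,
        simp_all add: gl_simps(1))
  moreover have "gens \<subseteq> H"
  proof
    fix Y assume "Y \<in> gens"
    then obtain p q a where "p \<in> idx" "q \<in> idx" "p \<noteq> q" "Y = F p q a" by (rule gens_F)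
    then show "Y \<in> H" by (simp add: H_def skew_F tr_F F_gl)
  qed
  ultimately have "G \<subseteq> H" by (rule G_minimal)
  then show "skew X" "avg (tr X) = 0" using assms by (auto simp: H_def)
qed

end

section \<open>Ideals of the unitary Lie algebra\<close>

locale unitary_ideal = unitary R n \<rho> U
  for R :: "('k::field_char_0, 'r::ab_group_add) inv_algebra" and n \<rho> U +
  fixes I :: "(nat \<Rightarrow> nat \<Rightarrow> 'r) set"
  assumes I_G: "I \<subseteq> G"
    and I_zero: "(\<lambda>i j. 0) \<in> I"
    and I_add: "X \<in> I \<Longrightarrow> Y \<in> I \<Longrightarrow> (\<lambda>i j. X i j + Y i j) \<in> I"
    and I_scale: "X \<in> I \<Longrightarrow> (\<lambda>i j. ascale R c (X i j)) \<in> I"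
    and I_br: "X \<in> I \<Longrightarrow> Y \<in> G \<Longrightarrow> br X Y \<in> I"
begin

text \<open>Position \<open>(1, 2)\<close> stands for all good positions, by
  \<open>J_iff\<close>.\<close>

definition J :: "'r set" where "J = {a. F 1 2 a \<in> I}"

lemma I_br': "X \<in> G \<Longrightarrow> Y \<in> I \<Longrightarrow> br X Y \<in> I"
proof -
  assume "X \<in> G" "Y \<in> I"
  then have "(\<lambda>i j. ascale R (-1) (br Y X i j)) \<in> I" by (intro I_scale I_br)
  moreover have "(\<lambda>i j. ascale R (-1) (br Y X i j)) = br X Y" by (simp add: gl_simps)
  ultimately show ?thesis by simp
qed

lemma I_diff: "X \<in> I \<Longrightarrow> Y \<in> I \<Longrightarrow> (\<lambda>i j. X i j - Y i j) \<in> I"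
  using I_add[of X "\<lambda>i j. ascale R (-1) (Y i j)"] I_scale[of Y "-1"] by simp

lemma I_sum: "(\<And>x. x \<in> A \<Longrightarrow> f x \<in> I) \<Longrightarrow> (\<lambda>i j. \<Sum>x\<in>A. f x i j) \<in> I"
  by (induction A rule: infinite_finite_induct) (auto simp: I_zero I_add)

text \<open>One bracket with \<open>F q r b\<close> suffices unless \<open>r\<close> is
  \<open>q\<close> or \<open>pr q\<close>. In that case \<open>(q, r)\<close> is not good, and the
  move is made in two steps through a third index, the second with factor
  \<open>aone R\<close>.\<close>

lemma I_row:
  assumes "good p q" "F p q a \<in> I" "good p r"
  shows "F p r (amult R a b) \<in> I"
proof -
  have step: "F p r (amult R a b) \<in> I"
    if "good p q" "good q r" "good p r" "F p q a \<in> I" for q r a b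
  proof -
    have "br (F p q a) (F q r b) \<in> I"
      using that goodD[OF that(2)] by (intro I_br F_G) auto
    then show ?thesis using that goodD[OF that(3)] by (simp add: br_FF_good)
  qed
  obtain s where s: "s \<in> idx" "s \<noteq> p" "s \<noteq> pr p" "s \<noteq> q" "s \<noteq> pr q"
    using third_index goodD[OF assms(1)] by metis
  have ps: "good p s" "good q s" using s goodD[OF assms(1)] by (auto simp: good_def)
  show ?thesis
  proof (cases "r = q \<or> r = pr q")
    case True
    have "F p s (amult R a b) \<in> I" using step[OF assms(1) ps(2,1) assms(2)] .
    moreover have "good s r" using True good_sym ps by metis
    ultimately have "F p r (amult R (amult R a b) (aone R)) \<in> I"
      using step ps assms by blast
    then show ?thesis by (simp add: mult_one)
  next
    case False
    then have "good q r" using goodD[OF assms(3)] goodD[OF assms(1)] by (auto simp: good_def)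
    then show ?thesis using step assms by blast
  qed
qed

lemma I_star:
  assumes "p \<in> idx" "q \<in> idx"
  shows "F p q a \<in> I \<longleftrightarrow> F (pr q) (pr p) (astar R a) \<in> I"
proof
  assume "F p q a \<in> I"
  then show "F (pr q) (pr p) (astar R a) \<in> I"
    unfolding F_swap[OF assms] by (rule I_scale)
next
  assume "F (pr q) (pr p) (astar R a) \<in> I"
  then have "F (pr (pr p)) (pr (pr q)) (astar R (astar R a)) \<in> I"
    unfolding F_swap[OF pr_dom[OF assms(2)] pr_dom[OF assms(1)], of "astar R a"] by (rule I_scale)
  then show "F p q a \<in> I" using assms by (simp add: star_star)
qed

lemma I_col:
  assumes "good p q" "F p q a \<in> I" "good r q"
  shows "F r q (amult R b a) \<in> I"
proof -
  have g: "good (pr q) (pr p)" "good (pr q) (pr r)" using assms good_sym by metis+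
  have "F (pr q) (pr p) (astar R a) \<in> I" using assms goodD I_star by metis
  then have "F (pr q) (pr r) (amult R (astar R a) (astar R b)) \<in> I" using g I_row by blast
  then show ?thesis using assms goodD I_star star_mult by metis
qed

lemma good_12: "good 1 2"
  using n3 by (auto simp: good_def idx_def pr_def)

text \<open>The path is \<open>(p, q)\<close>, \<open>(p, s)\<close>, \<open>(p', s)\<close>,
  \<open>(p', q')\<close>, with \<open>s\<close> outside the pairs of \<open>p\<close> and
  \<open>p'\<close>.\<close>

lemma I_F_move:
  assumes "good p q" "F p q a \<in> I" "good p' q'"
  shows "F p' q' a \<in> I"
proof -
  obtain s where s: "s \<in> idx" "s \<noteq> p" "s \<noteq> pr p" "s \<noteq> p'" "s \<noteq> pr p'"
    using third_index goodD[OF assms(1)] goodD[OF assms(3)] by metis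
  then have g: "good p s" "good p' s" using goodD[OF assms(1)] goodD[OF assms(3)] by (auto simp: good_def)
  have "F p s a \<in> I" using I_row[OF assms(1,2) g(1), of "aone R"] by (simp add: mult_one)
  then have "F p' s a \<in> I" using I_col[OF g(1) _ g(2), of a "aone R"] by (simp add: one_mult)
  then show ?thesis using I_row[OF g(2) _ assms(3), of a "aone R"] by (simp add: mult_one)
qed

lemma J_iff: "good p q \<Longrightarrow> F p q a \<in> I \<longleftrightarrow> a \<in> J"
  unfolding J_def mem_Collect_eq using I_F_move[OF _ _ good_12] I_F_move[OF good_12] by metis

lemma J_ideal: "star_ideal J"
  unfolding star_ideal_def
proof (intro conjI ballI allI)
  show "0 \<in> J" by (simp add: J_def F_zero I_zero)
  show "a + b \<in> J" if "a \<in> J" "b \<in> J" for a b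
    using that by (simp add: J_def F_add I_add)
  show "ascale R c a \<in> J" if "a \<in> J" for a c
    using that by (simp add: J_def F_scale I_scale)
  show "amult R a b \<in> J" "amult R b a \<in> J" if "a \<in> J" for a b
    using that I_row[OF good_12 _ good_12] I_col[OF good_12 _ good_12] by (simp_all add: J_def)
  show "astar R a \<in> J" if "a \<in> J" for a
  proof -
    have "F (pr 2) (pr 1) (astar R a) \<in> I"
      using that I_star[of 1 2 a] goodD[OF good_12] by (simp add: J_def)
    then show ?thesis using J_iff good_12 good_sym by metis
  qed
qed

section \<open>Matrices with entries in \<open>J\<close> belong to \<open>I\<close>\<close>

lemma F_diag_diff:
  assumes "p \<in> idx" "q \<in> idx" "a \<in> J"
  shows "(\<lambda>i j. F p p a i j - F q q a i j) \<in> I"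
proof -
  have *: "(\<lambda>i j. F p p a i j - F q q a i j) \<in> I" if "good p q" for p q
  proof -
    have "br (F p q a) (F q p (aone R)) \<in> I"
      using that assms J_iff goodD[OF that] by (intro I_br F_G) auto
    then show ?thesis using that by (simp add: br_FF_diag one_mult mult_one)
  qed
  obtain s where s: "s \<in> idx" "s \<noteq> p" "s \<noteq> pr p" "s \<noteq> q" "s \<noteq> pr q"
    using third_index assms by metis
  then have "good p s" "good s q" using assms good_sym(1)[of q s] by (auto simp: good_def)
  from I_add[OF this[THEN *]] show ?thesis by simp
qed

text \<open>The bracket of \<open>F 1 2 a\<close> with \<open>F 2 1 b\<close> carries
  \<open>a b\<close> at index 1 and \<open>b a\<close> at index 2; shifting the second term to index
  1 leaves the commutator.\<close>

lemma F_diag_commutator: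
  assumes "a \<in> J"
  shows "F 1 1 (amult R a b - amult R b a) \<in> I"
proof -
  note d = goodD[OF good_12]
  have "br (F 1 2 a) (F 2 1 b) \<in> I"
    using assms J_iff good_12 d by (intro I_br F_G) auto
  then have 1: "(\<lambda>i j. F 1 1 (amult R a b) i j - F 2 2 (amult R b a) i j) \<in> I"
    by (simp only: br_FF_diag[OF good_12])
  have 2: "(\<lambda>i j. F 2 2 (amult R b a) i j - F 1 1 (amult R b a) i j) \<in> I"
    using assms d star_idealD[OF J_ideal] by (intro F_diag_diff)
  have "F 1 1 (amult R a b + ascale R (-1) (amult R b a)) =
      (\<lambda>i j. (F 1 1 (amult R a b) i j - F 2 2 (amult R b a) i j) +
        (F 2 2 (amult R b a) i j - F 1 1 (amult R b a) i j))"
    unfolding F_add F_scale by simp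
  then show ?thesis using I_add[OF 1 2] by simp
qed

lemma F_sum: "F p q (sum f A) = (\<lambda>i j. \<Sum>x\<in>A. F p q (f x) i j)"
  by (induction A rule: infinite_finite_induct) (auto simp: F_zero F_add)

text \<open>Each \<open>a - u a v\<close> is the commutator of \<open>a v\<close> with
  \<open>u\<close>, because \<open>v u = 1\<close>. The sum over \<open>U\<close> is
  \<open>card U\<close> times \<open>a\<close>, minus the average of \<open>a\<close>, and
  \<open>card U\<close> is invertible in characteristic 0.\<close>

lemma F_diag_avg_zero:
  assumes "a \<in> J" "avg a = 0"
  shows "F 1 1 a \<in> I"
proof -
  have *: "F 1 1 (a - amult R (amult R u a) v) \<in> I" if "(u, v) \<in> U" for u v
  proof -
    have "a - amult R (amult R u a) v = amult R (amult R a v) u - amult R u (amult R a v)"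
      using invU(2)[OF that] by (simp add: mult_assoc mult_one)
    then show ?thesis using F_diag_commutator[of "amult R a v" u] star_idealD[OF J_ideal] assms by simp
  qed
  have "(\<lambda>i j. \<Sum>x\<in>U. F 1 1 (a - amult R (amult R (fst x) a) (snd x)) i j) \<in> I"
    by (rule I_sum) (use * in auto)
  also have "(\<lambda>i j. \<Sum>x\<in>U. F 1 1 (a - amult R (amult R (fst x) a) (snd x)) i j) =
      F 1 1 (\<Sum>x\<in>U. a - amult R (amult R (fst x) a) (snd x))"
    by (simp add: F_sum)
  also have "(\<Sum>x\<in>U. a - amult R (amult R (fst x) a) (snd x)) = (\<Sum>x\<in>U. a) - avg a"
    by (simp add: sum_subtractf avg_def case_prod_unfold)
  also have "(\<Sum>x\<in>U. a) - avg a = ascale R (of_nat (card U)) a"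
    using assms by (simp add: vs.sum_constant_scale)
  finally have "(\<lambda>i j. ascale R (inverse (of_nat (card U))) (ascale R (of_nat (card U)) (F 1 1 a i j))) \<in> I"
    unfolding F_scale by (rule I_scale)
  moreover have "(of_nat (card U) :: 'k) \<noteq> 0" using finU neU by simp
  ultimately show ?thesis by simp
qed

text \<open>Every entry is met twice, once directly and once through the mirror part of
  \<open>F\<close>; skewness makes the two contributions equal.\<close>

lemma double_skew:
  assumes X: "X \<in> lcarrier (gl (2 * n) R)" "skew X"
  shows "(\<Sum>p\<in>idx. \<Sum>q\<in>idx. F p q (X p q) i j) = ascale R 2 (X i j)"
proof -
  have 1: "(\<Sum>p\<in>idx. \<Sum>q\<in>idx. e_mat p q (Y p q) i j) = Y i j"
    if "\<And>i j. i \<notin> idx \<or> j \<notin> idx \<Longrightarrow> Y i j = 0" for Y :: "nat \<Rightarrow> nat \<Rightarrow> 'r" and i j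
  proof -
    have "(\<Sum>p\<in>idx. \<Sum>q\<in>idx. e_mat p q (Y p q) i j) =
        (\<Sum>p\<in>idx. if i = p then (\<Sum>q\<in>idx. if j = q then Y p q else 0) else 0)"
      by (intro sum.cong) (auto simp: e_mat_def)
    then show ?thesis using that[of i j] by (auto simp: sum.delta)
  qed
  have "(\<Sum>p\<in>idx. \<Sum>q\<in>idx. e_mat (pr q) (pr p) (ascale R (eps p * eps q) (astar R (X p q))) i j) =
      (\<Sum>p\<in>idx. \<Sum>q\<in>idx. e_mat (pr q) (pr p) (- X (pr q) (pr p)) i j)"
    using X(2) by (intro sum.cong) (auto simp: skew_def)
  also have "\<dots> = (\<Sum>q\<in>idx. \<Sum>p\<in>idx. e_mat (pr q) (pr p) (- X (pr q) (pr p)) i j)"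
    by (rule sum.swap)
  also have "\<dots> = (\<Sum>q\<in>idx. \<Sum>p\<in>idx. e_mat q p (- X q p) i j)"
    by (simp only: sum.reindex_bij_betw[OF bij_pr, of "\<lambda>p. e_mat _ p (- X _ p) i j"]
      sum.reindex_bij_betw[OF bij_pr, of "\<lambda>q. \<Sum>p\<in>idx. e_mat q p (- X q p) i j"])
  also have "\<dots> = - X i j"
    by (rule 1) (use X(1) in \<open>auto simp: gl_simps\<close>)
  finally have 2: "(\<Sum>p\<in>idx. \<Sum>q\<in>idx. e_mat (pr q) (pr p)
      (ascale R (eps p * eps q) (astar R (X p q))) i j) = - X i j" .
  have "(\<Sum>p\<in>idx. \<Sum>q\<in>idx. e_mat p q (X p q) i j) = X i j"
    by (rule 1) (use X(1) in \<open>auto simp: gl_simps\<close>)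
  then have "(\<Sum>p\<in>idx. \<Sum>q\<in>idx. F p q (X p q) i j) = X i j + X i j"
    unfolding F_def sum_subtractf 2 by simp
  also have "\<dots> = ascale R 2 (X i j)"
    using vs.scale_left_distrib[of 1 1 "X i j"] by simp
  finally show ?thesis .
qed

text \<open>By \<open>double_skew\<close>, \<open>X\<close> is half a sum of elements
  \<open>F p q (X p q)\<close>. Those at \<open>(p, pr p)\<close> are brackets of good ones. The
  diagonal ones are collected at index 1, where they add up to \<open>F 1 1 (tr X)\<close>, and
  there \<open>F_diag_avg_zero\<close> applies.\<close>

lemma entries_in_J_imp_I:
  assumes X: "X \<in> lcarrier (gl (2 * n) R)" "skew X" "avg (tr X) = 0"
    and J: "\<And>i j. X i j \<in> J"
  shows "X \<in> I"
proof -
  have off: "F p q (X p q) \<in> I" if pq: "p \<in> idx" "q \<in> idx" "p \<noteq> q" for p q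
  proof (cases "q = pr p")
    case True
    obtain s where s: "s \<in> idx" "s \<noteq> p" "s \<noteq> pr p" using third_index pq by metis
    then have g: "good p s" "good s (pr p)"
      using pq good_sym by (auto simp: good_def)
    have "br (F p s (X p q)) (F s (pr p) (aone R)) \<in> I"
      using J J_iff g goodD[OF g(2)] by (intro I_br F_G) auto
    then show ?thesis using True g pq by (simp add: br_FF_good mult_one)
  next
    case False
    then show ?thesis using pq J J_iff[of p q] by (auto simp: good_def)
  qed
  have one: "1 \<in> idx" using goodD[OF good_12] by simp
  have "tr X \<in> J" unfolding tr_def by (rule star_idealD(9)[OF J_ideal]) (rule J)
  then have "F 1 1 (tr X) \<in> I" using X(3) by (rule F_diag_avg_zero)
  moreover have "(\<lambda>i j. \<Sum>p\<in>idx. F p p (X p p) i j - F 1 1 (X p p) i j) \<in> I"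
    by (rule I_sum, rule F_diag_diff) (use one J in auto)
  ultimately have "(\<lambda>i j. (\<Sum>p\<in>idx. F p p (X p p) i j - F 1 1 (X p p) i j) + F 1 1 (tr X) i j) \<in> I"
    by (rule I_add[rotated])
  then have diag: "(\<lambda>i j. \<Sum>p\<in>idx. F p p (X p p) i j) \<in> I"
    by (simp add: tr_def F_sum sum_subtractf)
  have "(\<lambda>i j. \<Sum>p\<in>idx. \<Sum>q\<in>idx - {p}. F p q (X p q) i j) \<in> I"
    by (intro I_sum off) auto
  from I_add[OF diag this] have "(\<lambda>i j. \<Sum>p\<in>idx. \<Sum>q\<in>idx. F p q (X p q) i j) \<in> I"
    by (simp add: sum.distrib[symmetric] sum.remove[of idx])
  then have "(\<lambda>i j. ascale R (1/2) (ascale R 2 (X i j))) \<in> I"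
    unfolding double_skew[OF X(1,2)] by (rule I_scale)
  then show ?thesis by simp
qed

text \<open>The entries of \<open>X\<close> off the diagonal are separated by the weights of the toral elements
  \<open>F p p 1\<close>. Bracketing with \<open>F p q a\<close> shows that the diagonal entries agree and are central
  modulo \<open>J\<close>, so the trace condition puts them in \<open>J\<close> as well.\<close>

definition wt :: "nat \<Rightarrow> nat \<Rightarrow> nat \<Rightarrow> 'k" where
  "wt p i j = (if i = p then 1 else 0) - (if i = pr p then 1 else 0) -
     (if j = p then 1 else 0) + (if j = pr p then 1 else 0)"

text \<open>\<open>F p p 1 - F q q 1\<close> is a bracket. Replacing \<open>q\<close> by
  \<open>pr q\<close> turns the minus into a plus, and \<open>F p p 1\<close> is half the sum of the
  two.\<close>

lemma F_pp_G:
  assumes p: "p \<in> idx"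
  shows "F p p (aone R) \<in> G"
proof -
  obtain q where q: "q \<in> idx" "q \<noteq> p" "q \<noteq> pr p" using third_index p by metis
  then have g: "good p q" "good p (pr q)" using p good_sym by (auto simp: good_def)
  have D: "(\<lambda>i j. F p p (aone R) i j - F q q (aone R) i j) \<in> G" if "good p q" for q
  proof -
    have "br (F p q (aone R)) (F q p (aone R)) \<in> G"
      using goodD[OF that] by (intro G_closed F_G) auto
    then show ?thesis using that by (simp add: br_FF_diag one_mult)
  qed
  have "F (pr q) (pr q) (aone R) = (\<lambda>i j. - F q q (aone R) i j)"
    using F_swap[of q q "aone R"] q by simp
  then have "(\<lambda>i j. ascale R (1/2) (F p p (aone R) i j + F p p (aone R) i j)) \<in> G"
    using G_closed(2)[OF D[OF g(1)] D[OF g(2)]] G_closed(3) by simp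
  moreover have "ascale R (1/2) (x + x) = x" for x
    using vs.scale_left_distrib[of "1/2" "1/2" x] by (simp add: vs.scale_right_distrib)
  ultimately show ?thesis by simp
qed

text \<open>Each \<open>c\<close> in the list contributes one bracket with \<open>F p p 1\<close>
  minus \<open>c\<close> times the identity. Weights range over the integers from -2 to 2, so a list
  of four of them leaves a single weight.\<close>

lemma I_weight:
  assumes p: "p \<in> idx" and X: "X \<in> I"
  shows "(\<lambda>i j. ascale R (\<Prod>c\<leftarrow>cs. wt p i j - c) (X i j)) \<in> I"
proof (induction cs)
  case (Cons c cs)
  define Y where "Y = (\<lambda>i j. ascale R (\<Prod>c\<leftarrow>cs. wt p i j - c) (X i j))"
  have "br (F p p (aone R)) Y i j = ascale R (wt p i j) (Y i j)" for i j
  proof -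
    have sel: "(if A then x else 0) = ascale R (if A then 1 else 0) x" for A x by simp
    have "br (F p p (aone R)) Y i j = (if i = p then Y i j else 0) - (if i = pr p then Y i j else 0)
        - (if j = p then Y i j else 0) + (if j = pr p then Y i j else 0)"
      unfolding br_F[OF p p] by (simp add: one_mult mult_one cong: if_cong)
    then show ?thesis
      unfolding sel[of _ "Y i j"] wt_def
      by (simp only: vs.scale_left_distrib vs.scale_left_diff_distrib)
  qed
  then have "(\<lambda>i j. ascale R (wt p i j) (Y i j)) = br (F p p (aone R)) Y" by (intro ext) simp
  also have "\<dots> \<in> I" using Cons F_pp_G[OF p] by (intro I_br') (auto simp: Y_def)
  finally have "(\<lambda>i j. ascale R (wt p i j) (Y i j) - ascale R c (Y i j)) \<in> I"
    using Cons by (intro I_diff I_scale) (auto simp: Y_def)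
  then show ?case
    by (simp add: Y_def vs.scale_left_diff_distrib[symmetric] del: vs.scale_scale) simp
qed (simp add: X)

lemma I_imp_good_entry:
  assumes X: "X \<in> I" and g: "good p q"
  shows "X p q \<in> J"
proof -
  note d = goodD[OF g]
  have sk: "skew X" and gl: "X \<in> lcarrier (gl (2 * n) R)" using X I_G G_skew G_closed by auto
  \<comment> \<open>Weight 1 is kept for \<open>p\<close> and weight -1 for \<open>q\<close>; they
    occur together only at \<open>(p, q)\<close> and at its mirror image. Each of the two products
    is -6 there, whence the factor 36.\<close>
  define w where "w i j = (\<Prod>c\<leftarrow>[-2, 0, 1, 2]. wt q i j - c) * (\<Prod>c\<leftarrow>[-2, -1, 0, 2]. wt p i j - c)" for i j
  have "(\<lambda>i j. ascale R (\<Prod>c\<leftarrow>[-2, 0, 1, 2]. wt q i j - c)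
      (ascale R (\<Prod>c\<leftarrow>[-2, -1, 0, 2]. wt p i j - c) (X i j))) \<in> I"
    using d X by (intro I_weight)
  then have I: "(\<lambda>i j. ascale R (w i j) (X i j)) \<in> I" by (simp add: w_def)
  have w: "w i j = (if i = p \<and> j = q \<or> i = pr q \<and> j = pr p then 36 else 0)"
    if "i \<in> idx" "j \<in> idx" for i j
  proof -
    have ne: "pr p \<noteq> p" "p \<noteq> pr p" "pr q \<noteq> q" "q \<noteq> pr q" using d by auto
    have 1: "(\<Prod>c\<leftarrow>[-2, -1, 0, 2]. wt p i j - c) =
        (if i = p \<and> j \<noteq> p \<and> j \<noteq> pr p \<or> j = pr p \<and> i \<noteq> p \<and> i \<noteq> pr p then - 6 else 0)"
      unfolding wt_def using ne
      by (cases "i = p"; cases "i = pr p"; cases "j = p"; cases "j = pr p") simp_all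
    have 2: "(\<Prod>c\<leftarrow>[-2, 0, 1, 2]. wt q i j - c) =
        (if j = q \<and> i \<noteq> q \<and> i \<noteq> pr q \<or> i = pr q \<and> j \<noteq> q \<and> j \<noteq> pr q then - 6 else 0)"
      unfolding wt_def using ne
      by (cases "i = q"; cases "i = pr q"; cases "j = q"; cases "j = pr q") simp_all
    have "(i = p \<and> j \<noteq> p \<and> j \<noteq> pr p \<or> j = pr p \<and> i \<noteq> p \<and> i \<noteq> pr p) \<and>
        (j = q \<and> i \<noteq> q \<and> i \<noteq> pr q \<or> i = pr q \<and> j \<noteq> q \<and> j \<noteq> pr q) \<longleftrightarrow>
        i = p \<and> j = q \<or> i = pr q \<and> j = pr p"
      using d pr_eq_iff[OF d(1,2)] by metis
    moreover have "(if C then - 6 else 0) * (if A then - 6 else 0) = (if A \<and> C then 36 else (0 :: 'k))"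
      for A C by simp
    ultimately show ?thesis unfolding w_def 1 2 by (simp only:)
  qed
  have sw: "X (pr q) (pr p) = - ascale R (eps p * eps q) (astar R (X p q))"
    using sk d by (simp add: skew_def)
  have "ascale R (w i j) (X i j) = F p q (ascale R 36 (X p q)) i j" for i j
  proof (cases "i \<in> idx \<and> j \<in> idx")
    case True
    have "\<not> (p = pr q \<and> q = pr p)" using d by blast
    then show ?thesis
      using w[of i j] True sw d unfolding F_entry
      by (cases "i = p \<and> j = q"; cases "i = pr q \<and> j = pr p") (auto simp: star_scale ac_simps)
  next
    case False
    then have "X i j = 0" using gl by (auto simp: gl_simps)
    then show ?thesis using False d pr_dom unfolding F_entry by auto
  qed
  then have "F p q (ascale R 36 (X p q)) = (\<lambda>i j. ascale R (w i j) (X i j))" by (intro ext) simp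
  then have "ascale R 36 (X p q) \<in> J" using I J_iff[OF g] by metis
  then show ?thesis by (rule star_ideal_unscale[OF J_ideal]) simp
qed

lemma I_imp_opposite_entry:
  assumes X: "X \<in> I" and p: "p \<in> idx"
  shows "X p (pr p) \<in> J"
proof -
  \<comment> \<open>Weight 2 is kept; it occurs only at \<open>(p, pr p)\<close>, where the product
    is 24.\<close>
  define Y where "Y = (\<lambda>i j. ascale R (\<Prod>c\<leftarrow>[-2, -1, 0, 1]. wt p i j - c) (X i j))"
  have Y: "Y \<in> I" unfolding Y_def using p X by (rule I_weight)
  have ne: "pr p \<noteq> p" "p \<noteq> pr p" using p by auto
  have Yp: "Y p (pr p) = ascale R 24 (X p (pr p))"
    unfolding Y_def wt_def using ne by simp
  have Y0: "Y i j = 0" if "i \<noteq> p \<or> j \<noteq> pr p" for i j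
  proof -
    have i: "i = p \<or> i = pr p \<or> (i \<noteq> p \<and> i \<noteq> pr p)" and j: "j = p \<or> j = pr p \<or> (j \<noteq> p \<and> j \<noteq> pr p)"
      by blast+
    show ?thesis
      unfolding Y_def wt_def using i j ne that by (elim disjE conjE) simp_all
  qed
  obtain q where q: "q \<in> idx" "q \<noteq> p" "q \<noteq> pr p" using third_index p by metis
  then have g: "good p q" using p by (simp add: good_def)
  then have g': "good q (pr p)" "good q p" using good_sym by metis+
  note d = goodD[OF g]
  \<comment> \<open>Position \<open>(p, pr p)\<close> is not good, so its entry is carried to the
    good position \<open>(q, pr p)\<close>.\<close>
  have "br (F q p (aone R)) Y \<in> I" using d Y by (intro I_br' F_G) auto
  then have "br (F q p (aone R)) Y q (pr p) \<in> J" by (rule I_imp_good_entry) (rule g')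
  moreover have "br (F q p (aone R)) Y q (pr p) = Y p (pr p)"
    unfolding br_F[OF d(2,1)] using d ne pr_eq_iff[OF p q(1)] by (simp add: one_mult)
  ultimately have "ascale R 24 (X p (pr p)) \<in> J" using Yp by simp
  then show ?thesis by (rule star_ideal_unscale[OF J_ideal]) simp
qed

lemma I_imp_diag_entry:
  assumes X: "X \<in> I" and p: "p \<in> idx"
  shows "X p p \<in> J"
proof -
  note Jd = star_idealD[OF J_ideal]
  have *: "amult R a (X q q) - amult R (X p p) a \<in> J" if g: "good p q" for p q a
  proof -
    note d = goodD[OF g]
    have "br (F p q a) X \<in> I" using d X by (intro I_br' F_G) auto
    then have "br (F p q a) X p q \<in> J" by (rule I_imp_good_entry) (rule g)
    then show ?thesis unfolding br_F[OF d(1,2)] using d by simp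
  qed
  have diff: "X q q - X p p \<in> J" if pq: "p \<in> idx" "q \<in> idx" for p q
  proof -
    have 1: "X q q - X p p \<in> J" if "good p q" for p q
      using *[OF that, of "aone R"] by (simp add: one_mult mult_one)
    obtain s where "s \<in> idx" "s \<noteq> p" "s \<noteq> pr p" "s \<noteq> q" "s \<noteq> pr q" using third_index pq by metis
    then have "good p s" "good s q" using pq good_sym(1)[of q s] by (auto simp: good_def)
    from Jd(2)[OF this[THEN 1]] show ?thesis by simp
  qed
  define x where "x = X p p"
  have central: "amult R a x - amult R x a \<in> J" for a
  proof -
    obtain q where q: "q \<in> idx" "q \<noteq> p" "q \<noteq> pr p" using third_index p by metis
    then have "amult R a (X q q) - amult R x a \<in> J"
      using *[of p q a] p by (auto simp: good_def x_def)
    moreover have "amult R a (X q q - x) \<in> J" using diff p q Jd(5) by (simp add: x_def)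
    ultimately show ?thesis using Jd(8) by (fastforce simp: mult_diff_right)
  qed
  have avgJ: "avg a \<in> J" if "a \<in> J" for a
    unfolding avg_def using that by (intro Jd(9)) (auto intro: Jd(4)[OF Jd(5)])
  \<comment> \<open>As \<open>x\<close> is central modulo \<open>J\<close>, each
    \<open>u x v\<close> is congruent to \<open>x\<close>, and \<open>avg x\<close> to
    \<open>card U\<close> times \<open>x\<close>. As all diagonal entries are congruent to
    \<open>x\<close>, the trace condition then puts \<open>2n\<close> times \<open>avg x\<close>
    into \<open>J\<close>.\<close>
  have "avg x - ascale R (of_nat (card U)) x = (\<Sum>(u, v)\<in>U. amult R (amult R u x) v - x)"
    by (simp add: avg_def case_prod_unfold sum_subtractf vs.sum_constant_scale)
  also have "\<dots> \<in> J"
  proof (rule Jd(9))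
    fix uv assume "uv \<in> U"
    then obtain u v where uv: "uv = (u, v)" "(u, v) \<in> U" by (cases uv) auto
    have "amult R (amult R u x - amult R x u) v \<in> J" using central Jd(4) by blast
    then show "(case uv of (u, v) \<Rightarrow> amult R (amult R u x) v - x) \<in> J"
      using invU(1)[OF uv(2)] by (simp add: uv mult_diff_left mult_assoc mult_one)
  qed
  finally have 1: "avg x - ascale R (of_nat (card U)) x \<in> J" .
  have "avg (tr X) = 0" using X I_G G_skew by auto
  moreover have "tr X = (\<Sum>q\<in>idx. X q q - x) + ascale R (of_nat (card idx)) x"
    by (simp add: tr_def sum_subtractf vs.sum_constant_scale)
  ultimately have "ascale R (of_nat (card idx)) (avg x) = - avg (\<Sum>q\<in>idx. X q q - x)"
    by (simp add: avg_add avg_scale add_eq_0_iff)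
  also have "\<dots> \<in> J"
    using diff p by (intro Jd(7) avgJ Jd(9)) (auto simp: x_def)
  finally have "avg x \<in> J"
    by (rule star_ideal_unscale[OF J_ideal]) (use p in auto)
  from Jd(8)[OF this 1] have "ascale R (of_nat (card U)) x \<in> J" by simp
  then have "x \<in> J" by (rule star_ideal_unscale[OF J_ideal]) (use finU neU in auto)
  then show ?thesis by (simp add: x_def)
qed

theorem I_iff: "X \<in> I \<longleftrightarrow> X \<in> G \<and> (\<forall>i j. X i j \<in> J)"
proof
  assume X: "X \<in> I"
  then have "X \<in> G" "X \<in> lcarrier (gl (2 * n) R)" using I_G G_closed by auto
  moreover have "X i j \<in> J" for i j
  proof (cases "i \<in> idx \<and> j \<in> idx")
    case True
    then consider "good i j" | "j = i" | "j = pr i" by (auto simp: good_def)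
    then show ?thesis
      using True X I_imp_good_entry I_imp_opposite_entry I_imp_diag_entry by cases auto
  next
    case False
    then have "X i j = 0" using \<open>X \<in> lcarrier (gl (2 * n) R)\<close> by (auto simp: gl_simps)
    then show ?thesis using star_idealD(1)[OF J_ideal] by simp
  qed
  ultimately show "X \<in> G \<and> (\<forall>i j. X i j \<in> J)" by blast
next
  assume "X \<in> G \<and> (\<forall>i j. X i j \<in> J)"
  then show "X \<in> I" using entries_in_J_imp_I[of X] G_skew[of X] G_closed(5)[of X] by simp
qed

end

context unitary
begin

lemma unitary_ideal_G: "unitary_ideal R n \<rho> U G"
  by (intro unitary_ideal.intro unitary_axioms unitary_ideal_axioms.intro)
     (auto simp: G_closed)

text \<open>The results on ideals are applied to the ideal \<open>G\<close> itself: then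
  \<open>J\<close> is the whole ring, and \<open>entries_in_J_imp_I\<close> becomes the converse of
  \<open>G_skew\<close>.\<close>

theorem G_iff: "X \<in> G \<longleftrightarrow> X \<in> lcarrier (gl (2 * n) R) \<and> skew X \<and> avg (tr X) = 0"
proof -
  interpret unitary_ideal R n \<rho> U G by (rule unitary_ideal_G)
  have "1 \<in> idx" "2 \<in> idx" using n3 by (auto simp: idx_def)
  then have "J = UNIV" using F_G by (auto simp: J_def)
  then show ?thesis using G_skew G_closed(5) entries_in_J_imp_I by blast
qed

end

section \<open>Irreducible representations\<close>

definition lagrange :: "complex set \<Rightarrow> complex \<Rightarrow> complex poly" where
  "lagrange A a = (\<Prod>b\<in>A - {a}. smult (inverse (a - b)) [:- b, 1:])"

lemma poly_lagrange:
  assumes "finite A" "a' \<in> A"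
  shows "poly (lagrange A a) a' = (if a' = a then 1 else 0)"
proof (cases "a' = a")
  case True
  have "inverse (a - b) * (a - b) = 1" if "b \<in> A - {a}" for b
    by (rule left_inverse) (use that in auto)
  then show ?thesis
    unfolding lagrange_def poly_prod True poly_smult by (simp add: algebra_simps)
next
  case False
  then show ?thesis using assms by (auto simp: lagrange_def poly_prod intro!: prod_zero)
qed

text \<open>Modulo the product of all \<open>X - b\<close>, Lagrange polynomials are eigenvectors of
  multiplication by \<open>X\<close>. Evaluated at a central element they will split the quotient by
  \<open>J\<close> into eigenspaces.\<close>

lemma lagrange_dvd:
  assumes "finite A" "a \<in> A"
  shows "(\<Prod>b\<in>A. [:- b, 1:]) dvd [:- a, 1:] * lagrange A a"
proof -
  have "lagrange A a = smult (\<Prod>b\<in>A - {a}. inverse (a - b)) (\<Prod>b\<in>A - {a}. [:- b, 1:])"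
    unfolding lagrange_def by (rule prod_smult)
  then have "[:- a, 1:] * lagrange A a =
      smult (\<Prod>b\<in>A - {a}. inverse (a - b)) ([:- a, 1:] * (\<Prod>b\<in>A - {a}. [:- b, 1:]))"
    by simp
  also have "[:- a, 1:] * (\<Prod>b\<in>A - {a}. [:- b, 1:]) = (\<Prod>b\<in>A. [:- b, 1:])"
    using prod.remove[OF assms, of "\<lambda>b. [:- b, 1:]"] by simp
  finally show ?thesis by (simp add: dvd_smult)
qed

text \<open>For nonempty \<open>A\<close> the difference has degree below \<open>card A\<close> and
  vanishes on \<open>A\<close>, so it is 0. For empty \<open>A\<close> the sum is 0, but the product
  is 1 and divides everything.\<close>

lemma lagrange_sum_dvd:
  assumes "finite A"
  shows "(\<Prod>b\<in>A. [:- b, 1:]) dvd 1 - (\<Sum>a\<in>A. lagrange A a)"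
proof (cases "A = {}")
  case False
  let ?Q = "1 - (\<Sum>a\<in>A. lagrange A a)"
  have "degree (lagrange A a) \<le> card A - 1" if "a \<in> A" for a
  proof -
    have "degree (lagrange A a) \<le> (\<Sum>b\<in>A - {a}. degree (smult (inverse (a - b)) [:- b, 1:]))"
      unfolding lagrange_def
      by (rule degree_prod_sum_le[unfolded comp_def]) (use assms in auto)
    also have "\<dots> \<le> (\<Sum>b\<in>A - {a}. 1)" by (intro sum_mono) simp
    finally show ?thesis using that assms by simp
  qed
  then have "degree (\<Sum>a\<in>A. lagrange A a) \<le> card A - 1"
    using assms by (intro degree_sum_le) auto
  then have deg: "degree ?Q \<le> card A - 1" by (intro degree_diff_le) auto
  have "?Q = 0"
  proof (rule ccontr)
    assume "?Q \<noteq> 0"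
    moreover have "A \<subseteq> {x. poly ?Q x = 0}"
      using assms by (auto simp: poly_sum poly_lagrange)
    ultimately have "card A \<le> card {x. poly ?Q x = 0}" "card {x. poly ?Q x = 0} \<le> degree ?Q"
      using card_poly_roots_bound by (blast intro: card_mono poly_roots_finite)+
    moreover have "0 < card A" using False assms by (simp add: card_gt_0_iff)
    ultimately show False using deg by linarith
  qed
  then show ?thesis by simp
qed simp

section \<open>Annihilators of irreducible representations\<close>

locale unitary_rep = unitary R n \<rho> U
  for R :: "(complex, 'r::ab_group_add) inv_algebra" and n \<rho> U +
  fixes s :: "complex \<Rightarrow> 'v::ab_group_add \<Rightarrow> 'v" and B :: "'v set"
    and \<phi> :: "(nat \<Rightarrow> nat \<Rightarrow> 'r) \<Rightarrow> 'v \<Rightarrow> 'v"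
  assumes fd: "finite_dimensional_vector_space s B"
    and irr: "lie_irreducible (g_lie n \<rho> R) s \<phi>"
begin

lemma rep:
  "X \<in> G \<Longrightarrow> Vector_Spaces.linear s s (\<phi> X)"
  "X \<in> G \<Longrightarrow> Y \<in> G \<Longrightarrow> \<phi> (\<lambda>i j. X i j + Y i j) v = \<phi> X v + \<phi> Y v"
  "X \<in> G \<Longrightarrow> \<phi> (\<lambda>i j. ascale R c (X i j)) v = s c (\<phi> X v)"
  "X \<in> G \<Longrightarrow> Y \<in> G \<Longrightarrow> \<phi> (br X Y) v = \<phi> X (\<phi> Y v) - \<phi> Y (\<phi> X v)"
  "vector_space s"
  using irr unfolding lie_irreducible_def lie_representation_def g_lie_simps(2-4) by blast+

end

sublocale unitary_rep \<subseteq> unitary_ideal R n \<rho> U "lie_annihilator (g_lie n \<rho> R) \<phi>"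
proof (unfold_locales, unfold lie_annihilator_def)
  interpret vector_space s by (rule rep)
  show "{X \<in> G. \<forall>v. \<phi> X v = 0} \<subseteq> G" by blast
  show "(\<lambda>i j. 0) \<in> {X \<in> G. \<forall>v. \<phi> X v = 0}"
    using G_closed(1) rep(3)[OF G_closed(1), of 0] by simp
  fix X Y c assume X: "X \<in> {X \<in> G. \<forall>v. \<phi> X v = 0}"
  show "(\<lambda>i j. ascale R c (X i j)) \<in> {X \<in> G. \<forall>v. \<phi> X v = 0}"
    using X by (simp add: G_closed rep)
  show "(\<lambda>i j. X i j + Y i j) \<in> {X \<in> G. \<forall>v. \<phi> X v = 0}" if "Y \<in> {X \<in> G. \<forall>v. \<phi> X v = 0}"
    using X that by (simp add: G_closed rep)
  show "br X Y \<in> {X \<in> G. \<forall>v. \<phi> X v = 0}" if "Y \<in> G"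
    using X that linear_simps(3)[OF rep(1)[OF that]] by (simp add: G_closed rep)
qed

context unitary_rep
begin

text \<open>The matrices of \<open>G\<close> with entries in \<open>N\<close> form an ideal whose
  brackets have entries in \<open>J\<close> and so act by zero. By
  \<open>irreducible_abelian_ideal\<close> its brackets with all of \<open>G\<close> act by zero
  too, and \<open>F 1 2 a\<close> is one of them, routed through index 3.\<close>

lemma semiprime:
  assumes N: "star_ideal N" and sq: "\<And>a b. a \<in> N \<Longrightarrow> b \<in> N \<Longrightarrow> amult R a b \<in> J"
  shows "N \<subseteq> J"
proof
  fix a assume a: "a \<in> N"
  note Nd = star_idealD[OF N]
  define A where "A = {X \<in> G. \<forall>i j. X i j \<in> N}"
  have brA: "br X Y \<in> A" if "X \<in> A" "Y \<in> G" for X Y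
    using that G_closed(4) unfolding A_def gl_simps(5)
    by (auto intro!: Nd(8) Nd(9) intro: Nd(4) Nd(5))
  have "\<phi> (br X Y) v = 0" if "X \<in> A" "Y \<in> A" for X Y v
  proof -
    have "br X Y \<in> G" "\<forall>i j. br X Y i j \<in> J"
      using that G_closed(4) star_idealD(8,9)[OF J_ideal] sq unfolding A_def gl_simps(5)
      by (auto intro!: star_idealD(8,9)[OF J_ideal] sq)
    then have "br X Y \<in> lie_annihilator (g_lie n \<rho> R) \<phi>" using I_iff by blast
    then show ?thesis by (simp add: lie_annihilator_def)
  qed
  then have kill: "\<phi> (br X Y) v = 0" if "X \<in> A" "Y \<in> G" for X Y v
    using irreducible_abelian_ideal[OF fd irr, of A X Y v] that brA
    unfolding g_lie_simps(4) by (auto simp: A_def)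
  have 13: "good 1 3" "good 3 2" using n3 by (auto simp: good_def idx_def pr_def)
  note d = goodD[OF 13(1)] goodD[OF 13(2)]
  have "F 1 3 a \<in> A"
    using a d F_G Nd by (auto simp: A_def F_entry)
  then have "\<phi> (br (F 1 3 a) (F 3 2 (aone R))) v = 0" for v using d F_G by (intro kill) auto
  moreover have "br (F 1 3 a) (F 3 2 (aone R)) = F 1 2 a"
    using 13 by (simp add: br_FF_good mult_one)
  ultimately show "a \<in> J" using goodD[OF good_12] F_G unfolding J_def mem_Collect_eq unfolding lie_annihilator_def by simp
qed

text \<open>Take \<open>N = J + w R\<close>: centrality and the sign condition make it a star ideal,
  and products of two of its elements lie in \<open>J\<close> because \<open>w w\<close>
  does.\<close>

lemma semiprime_signed_central:
  assumes central: "\<And>b. amult R w b = amult R b w" and star: "astar R w = w \<or> astar R w = - w"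
    and sq: "amult R w w \<in> J"
  shows "w \<in> J"
proof -
  note Jd = star_idealD[OF J_ideal]
  define N where "N = {a + amult R w b | a b. a \<in> J}"
  have NI: "a + amult R w b \<in> N" if "a \<in> J" for a b using that by (auto simp: N_def)
  have "star_ideal N"
    unfolding star_ideal_def
  proof (intro conjI ballI allI)
    show "0 \<in> N" using NI[OF Jd(1), of 0] by simp
    fix x y c assume "x \<in> N"
    then obtain a b where x: "x = a + amult R w b" "a \<in> J" by (auto simp: N_def)
    show "ascale R c x \<in> N"
      using NI[OF Jd(3)[OF x(2), of c], of "ascale R c b"]
      by (simp add: x vs.scale_right_distrib mult_scale_right)
    show "amult R x y \<in> N"
      using NI[OF Jd(4)[OF x(2), of y], of "amult R b y"] by (simp add: x mult_add_left mult_assoc)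
    show "amult R y x \<in> N"
      using NI[OF Jd(5)[OF x(2), of y], of "amult R y b"]
      by (simp add: x mult_add_right mult_assoc[symmetric] central[of y])
    show "astar R x \<in> N"
      using NI[OF Jd(6)[OF x(2)], of "astar R b"] NI[OF Jd(6)[OF x(2)], of "- astar R b"] star
      by (auto simp: x star_add star_mult central[of "astar R b"] mult_minus_left mult_minus_right)
    show "x + y \<in> N" if "y \<in> N"
    proof -
      from that obtain a' b' where y: "y = a' + amult R w b'" "a' \<in> J" by (auto simp: N_def)
      show ?thesis
        using NI[OF Jd(2)[OF x(2) y(2)], of "b + b'"] by (simp add: x y mult_add_right algebra_simps)
    qed
  qed
  moreover have "amult R x y \<in> J" if xy: "x \<in> N" "y \<in> N" for x y
  proof -
    from xy obtain a b a' b' where *: "x = a + amult R w b" "y = a' + amult R w b'" "a \<in> J" "a' \<in> J"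
      by (auto simp: N_def)
    have "amult R b (amult R w b') = amult R w (amult R b b')"
      unfolding mult_assoc[symmetric] central[of b] ..
    then have "amult R (amult R w b) (amult R w b') = amult R (amult R w w) (amult R b b')"
      by (simp add: mult_assoc)
    then have "amult R x y = amult R a y + (amult R (amult R w b) a' + amult R (amult R w w) (amult R b b'))"
      by (simp add: * mult_add_left mult_add_right)
    also have "\<dots> \<in> J" using * sq by (intro Jd(2)) (auto intro: Jd(4) Jd(5))
    finally show ?thesis .
  qed
  ultimately have "N \<subseteq> J" by (rule semiprime)
  moreover have "w \<in> N" using NI[OF Jd(1), of "aone R"] by (simp add: mult_one)
  ultimately show ?thesis by blast
qed

text \<open>\<open>z\<close> and \<open>astar R z\<close> may be unrelated, so the signed case is
  used three times: first for their product, which then takes care of the mixed terms in the squares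
  of their sum and difference.\<close>

lemma semiprime_central:
  assumes c: "\<And>b. amult R z b = amult R b z" and sq: "amult R z z \<in> J"
  shows "z \<in> J"
proof -
  note Jd = star_idealD[OF J_ideal]
  let ?z = "astar R z"
  have c': "amult R ?z b = amult R b ?z" for b
    using arg_cong[OF c[of "astar R b"], of "astar R"] by (simp add: star_mult star_star)
  have sq': "amult R ?z ?z \<in> J" using Jd(6)[OF sq] by (simp add: star_mult)
  have "amult R z ?z \<in> J"
  proof (rule semiprime_signed_central)
    show "amult R (amult R z ?z) b = amult R b (amult R z ?z)" for b
      by (metis c c' mult_assoc)
    show "astar R (amult R z ?z) = amult R z ?z \<or> astar R (amult R z ?z) = - amult R z ?z"
      by (simp add: star_mult star_star)
    have "amult R (amult R z ?z) (amult R z ?z) = amult R (amult R z z) (amult R ?z ?z)"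
      by (metis c mult_assoc)
    then show "amult R (amult R z ?z) (amult R z ?z) \<in> J" using sq Jd(4) by simp
  qed
  note zz = this
  have plus: "z + ?z \<in> J"
  proof (rule semiprime_signed_central)
    show "amult R (z + ?z) b = amult R b (z + ?z)" for b
      by (simp add: mult_add_left mult_add_right c[of b] c'[of b])
    have "amult R (z + ?z) (z + ?z) =
        (amult R z z + amult R z ?z) + (amult R z ?z + amult R ?z ?z)"
      by (simp add: mult_add_left mult_add_right c'[of z])
    then show "amult R (z + ?z) (z + ?z) \<in> J" using sq sq' zz Jd(2) by simp
  qed (simp add: star_add star_star add.commute)
  have minus: "z - ?z \<in> J"
  proof (rule semiprime_signed_central)
    show "amult R (z - ?z) b = amult R b (z - ?z)" for b
      by (simp add: mult_diff_left mult_diff_right c[of b] c'[of b])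
    have "amult R (z - ?z) (z - ?z) =
        (amult R z z - amult R z ?z) - (amult R z ?z - amult R ?z ?z)"
      by (simp add: mult_diff_left mult_diff_right c'[of z])
    then show "amult R (z - ?z) (z - ?z) \<in> J" using sq sq' zz Jd(8) by simp
  qed (simp add: star_diff star_star)
  have "ascale R 2 z = (z + ?z) + (z - ?z)"
    using vs.scale_left_distrib[of 1 1 z] by simp
  then have "ascale R 2 z \<in> J" using Jd(2)[OF plus minus] by simp
  then show ?thesis by (rule star_ideal_unscale[OF J_ideal]) simp
qed

text \<open>The operator of \<open>F 1 2 a\<close> depends linearly on \<open>a\<close>, vanishes
  exactly for \<open>a\<close> in \<open>J\<close>, and lives in a finite-dimensional space.\<close>

lemma J_finite_codim: "\<exists>P. P \<noteq> 0 \<and> poly_comb (ascale R) P w \<in> J"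
proof -
  interpret V: finite_dimensional_vector_space s B by (rule fd)
  have 12: "F 1 2 a \<in> G" for a using goodD[OF good_12] by (intro F_G)
  obtain P where P: "P \<noteq> 0" "\<And>v. poly_comb s P (\<lambda>k. \<phi> (F 1 2 (w k)) v) = 0"
    using V.linear_family_relation[of "\<lambda>k. \<phi> (F 1 2 (w k))"] rep(1)[OF 12] by blast
  have "\<phi> (F 1 2 (poly_comb (ascale R) P w)) v = poly_comb s P (\<lambda>k. \<phi> (F 1 2 (w k)) v)" for v
    by (rule vs.poly_comb_hom) (simp_all only: F_add F_scale rep(2)[OF 12 12] rep(3)[OF 12])
  then show ?thesis using P 12 unfolding J_def mem_Collect_eq unfolding lie_annihilator_def by auto
qed

end

section \<open>Polynomials in a ring element\<close>

context inv_algebra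
begin

fun rpow :: "'r \<Rightarrow> nat \<Rightarrow> 'r" where
  "rpow z 0 = aone R" |
  "rpow z (Suc k) = amult R z (rpow z k)"

definition reval :: "'r \<Rightarrow> 'k poly \<Rightarrow> 'r" where
  "reval z P = poly_comb (ascale R) P (rpow z)"

lemma reval_pCons: "reval z (pCons a P) = ascale R a (aone R) + amult R z (reval z P)"
proof -
  have "poly_comb (ascale R) P (\<lambda>k. amult R z (rpow z k)) = amult R z (poly_comb (ascale R) P (rpow z))"
    by (rule vs.poly_comb_hom[symmetric]) (simp_all add: mult_add_right mult_scale_right)
  then show ?thesis by (simp add: reval_def vs.poly_comb_pCons)
qed

lemma reval_zero [simp]: "reval z 0 = 0"
  by (simp add: reval_def)

lemma reval_one [simp]: "reval z 1 = aone R"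
  unfolding one_pCons by (simp add: reval_pCons)

lemma reval_add: "reval z (P + Q) = reval z P + reval z Q"
  by (simp add: reval_def vs.poly_comb_add)

lemma reval_smult: "reval z (smult c P) = ascale R c (reval z P)"
  by (simp add: reval_def vs.poly_comb_smult)

lemma reval_diff: "reval z (P - Q) = reval z P - reval z Q"
  using reval_add[of z P "smult (-1) Q"] reval_smult[of z "-1" Q] by simp

lemma reval_sum: "reval z (sum f A) = (\<Sum>x\<in>A. reval z (f x))"
  by (induction A rule: infinite_finite_induct) (auto simp: reval_add)

lemma reval_mult: "reval z (P * Q) = amult R (reval z P) (reval z Q)"
proof (induction P)
  case (pCons a P)
  then show ?case
    by (simp add: reval_pCons reval_add reval_smult mult_add_left mult_scale_left one_mult mult_assoc)
qed simp

lemma reval_central: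
  assumes "\<And>b. amult R z b = amult R b z"
  shows "amult R (reval z P) b = amult R b (reval z P)"
proof (induction P arbitrary: b)
  case (pCons a P)
  have "amult R (amult R z (reval z P)) b = amult R b (amult R z (reval z P))"
    by (metis assms mult_assoc pCons(2))
  then show ?case
    by (simp add: reval_pCons mult_add_left mult_add_right mult_scale_left mult_scale_right one_mult mult_one)
qed simp

end

context unitary_rep
begin

text \<open>The roots of the minimal polynomial of \<open>z\<close> modulo \<open>J\<close> are simple because central
  elements whose square lies in \<open>J\<close> lie in \<open>J\<close>, and nonzero because \<open>z\<close> is invertible.\<close>

lemma central_unit_spectrum:
  assumes c: "\<And>b. amult R z b = amult R b z" and z': "amult R z' z = aone R"
  obtains A where "finite A" "0 \<notin> A" "\<And>P. (\<Prod>a\<in>A. [:- a, 1:]) dvd P \<Longrightarrow> reval z P \<in> J"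
proof -
  note Jd = star_idealD[OF J_ideal]
  define Q where "Q P \<longleftrightarrow> P \<noteq> 0 \<and> reval z P \<in> J" for P
  obtain P0 where "Q P0" using J_finite_codim[of "rpow z"] by (auto simp: Q_def reval_def)
  then obtain P where P: "Q P" "\<And>P'. Q P' \<Longrightarrow> degree P \<le> degree P'"
    using ex_has_least_nat[of Q P0 degree] by blast
  have P0: "P \<noteq> 0" and PJ: "reval z P \<in> J" using P(1) by (auto simp: Q_def)
  have deg: "degree T < degree P" if "P = [:- a, 1:] * T" for a T
  proof -
    have "T \<noteq> 0" using that P0 by auto
    then show ?thesis unfolding that by (subst degree_mult_eq) auto
  qed
  have "rsquarefree P"
    unfolding rsquarefree_def
  proof (intro conjI allI)
    fix a
    show "order a P = 0 \<or> order a P = 1"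
    proof (rule ccontr)
      assume "\<not> (order a P = 0 \<or> order a P = 1)"
      then have "[:- a, 1:] ^ 2 dvd P" using P0 by (subst order_divides) auto
      then obtain T where T: "P = [:- a, 1:] * ([:- a, 1:] * T)"
        by (metis dvdE mult.assoc power2_eq_square)
      \<comment> \<open>Since \<open>P = (X - a) W\<close> and \<open>W = (X - a) T\<close>, the
        square of \<open>W\<close> is \<open>P T\<close>. So \<open>W(z)\<close> lies in
        \<open>J\<close>, against the minimal degree of \<open>P\<close>.\<close>
      let ?W = "[:- a, 1:] * T"
      have "amult R (reval z ?W) (reval z ?W) = amult R (reval z P) (reval z T)"
      proof -
        have "(L * T) * (L * T) = (L * (L * T)) * T" for L :: "complex poly"
          by (simp only: mult_ac)
        then show ?thesis unfolding reval_mult[symmetric] T by metis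
      qed
      then have "amult R (reval z ?W) (reval z ?W) \<in> J" using Jd(4)[OF PJ] by simp
      then have "reval z ?W \<in> J" by (rule semiprime_central[OF reval_central[OF c]])
      then have "Q ?W" using P0 T by (auto simp: Q_def)
      then show False using P(2) deg[OF T] by fastforce
    qed
  qed (rule P0)
  then have dec: "smult (lead_coeff P) (\<Prod>a | poly P a = 0. [:- a, 1:]) = P"
    by (rule complex_poly_decompose_rsquarefree)
  show thesis
  proof (rule that[of "{a. poly P a = 0}"])
    show "finite {a. poly P a = 0}" using P0 by (rule poly_roots_finite)
    show "0 \<notin> {a. poly P a = 0}"
    proof
      assume "0 \<in> {a. poly P a = 0}"
      then obtain T where T: "P = [:- 0, 1:] * T" by (auto simp: poly_eq_0_iff_dvd)
      then have "amult R z' (amult R z (reval z T)) \<in> J"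
        using PJ Jd(5) by (simp add: reval_pCons)
      then have "Q T" using T P0 z' by (auto simp: Q_def mult_assoc[symmetric] one_mult)
      then show False using P(2) deg[OF T] by fastforce
    qed
    fix P' assume "(\<Prod>a | poly P a = 0. [:- a, 1:]) dvd P'"
    then obtain T where T: "P' = (\<Prod>a | poly P a = 0. [:- a, 1:]) * T" by (auto simp: dvd_def)
    have "smult (lead_coeff P) P' = P * T" unfolding T by (metis dec mult_smult_left)
    then have "ascale R (lead_coeff P) (reval z P') \<in> J"
      unfolding reval_smult[symmetric] using PJ Jd(4) by (simp add: reval_mult)
    then show "reval z P' \<in> J" by (rule star_ideal_unscale[OF J_ideal]) (use P0 in auto)
  qed
qed

end

section \<open>The quantum torus and its finite-dimensional quotients\<close>

text \<open>Four monomials \<open>t1^i t2^j\<close> with their inverses. Conjugation multiplies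
  \<open>t1^x t2^y\<close> by \<open>q^(j x - i y)\<close>, so the sum of the four conjugates is 4
  times the monomial if this is central, and 0 otherwise.\<close>

definition torus_units :: "complex \<Rightarrow> (torus \<times> torus) set" where
  "torus_units q = (\<lambda>(i, j). (Poly_Mapping.single (i, j) 1, Poly_Mapping.single (- i, - j) (q powi (i * j))))
     ` ({0, 1} \<times> {0, 1})"

definition torus_functional :: "(int \<times> int \<Rightarrow> complex) \<Rightarrow> torus \<Rightarrow> complex" where
  "torus_functional f x = (\<Sum>k\<in>Poly_Mapping.keys x. Poly_Mapping.lookup x k * f k)"

lemma torus_functional_single: "torus_functional f (Poly_Mapping.single k c) = c * f k"
  by (simp add: torus_functional_def)

lemma torus_functional_zero [simp]: "torus_functional f 0 = 0"
  by (simp add: torus_functional_def)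

lemma torus_functional_add: "torus_functional f (x + y) = torus_functional f x + torus_functional f y"
  unfolding torus_functional_def
  by (rule setsum_keys_plus_distrib[where f = "\<lambda>k c. c * f k"]) (auto simp: algebra_simps)

lemma torus_functional_scale: "torus_functional f (torus_scale c x) = c * torus_functional f x"
  by (induction x rule: torus_induct)
     (auto simp: torus_scale_single torus_scale_add torus_functional_single torus_functional_add algebra_simps)

lemma torus_functional_sum: "torus_functional f (sum g A) = (\<Sum>x\<in>A. torus_functional f (g x))"
  by (induction A rule: infinite_finite_induct) (auto simp: torus_functional_add)

lemma single_sum:
  "Poly_Mapping.single k (sum f A) = (\<Sum>x\<in>A. Poly_Mapping.single k (f x))"
  by (induction A rule: infinite_finite_induct) (auto simp: single_add)

lemma minus_one_powi: "(-1 :: complex) powi k = (if even k then 1 else -1)"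
  by (simp add: power_int_minus_left)

locale torus =
  fixes q \<theta>1 \<theta>2 :: complex
  assumes params: "(q, \<theta>1, \<theta>2) \<in> torus_params"
begin

abbreviation T where "T \<equiv> quantum_torus q \<theta>1 \<theta>2"
definition m :: nat where "m = mult_order q"

lemma q_cases: "q = 1 \<and> m = 1 \<or> q = -1 \<and> m = 2"
  using params by (auto simp: torus_params_def m_def mult_order_1 mult_order_minus_1)

lemma signs: "q \<in> {1, -1}" "\<theta>1 \<in> {1, -1}" "\<theta>2 \<in> {1, -1}"
  using params by (auto simp: torus_params_def)

lemma q_nz [simp]: "q \<noteq> 0" and m_pos [simp]: "0 < m"
  using q_cases by auto

lemma q_cong:
  assumes "int m dvd a - b"
  shows "q powi (a * k) = q powi (b * k)"
  using q_cases assms by (auto simp: minus_one_powi)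

lemma T_simps: "amult T = torus_mult q" "ascale T = torus_scale" "aone T = Poly_Mapping.single (0, 0) 1"
  "astar T = torus_star q \<theta>1 \<theta>2"
  by (simp_all add: quantum_torus_def)

lemma torus_conj:
  "torus_mult q (torus_mult q (Poly_Mapping.single (i, j) 1) (Poly_Mapping.single (x, y) c))
     (Poly_Mapping.single (- i, - j) (q powi (i * j))) =
   Poly_Mapping.single (x, y) (q powi (j * x - i * y) * c)"
proof -
  have gen: "q powi A * (q powi B * 1 * c) * q powi C = q powi (A + B + C) * c" for A B C
    by (simp add: power_int_add)
  have ex: "(j + y) * - i + j * x + i * j = j * x - i * y" by (simp add: algebra_simps)
  show ?thesis unfolding torus_mult_single fst_conv snd_conv add_Pair gen ex by simp
qed

lemma torus_units_sum:
  "(\<Sum>(u, v)\<in>torus_units q. torus_mult q (torus_mult q u x) v) =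
   (\<Sum>ij\<in>{0, 1} \<times> {0, 1}. torus_mult q (torus_mult q (Poly_Mapping.single ij 1) x)
     (Poly_Mapping.single (- fst ij, - snd ij) (q powi (fst ij * snd ij))))"
proof -
  have "inj_on (\<lambda>(i, j). (Poly_Mapping.single (i, j) (1::complex),
      Poly_Mapping.single (- i, - j) (q powi (i * j)))) ({0, 1} \<times> {0, 1 :: int})"
    by (rule inj_onI) (auto dest: arg_cong[where f = Poly_Mapping.keys] split: if_splits)
  then show ?thesis
    unfolding torus_units_def by (subst sum.reindex) (auto simp: case_prod_unfold)
qed

text \<open>For monomials \<open>a b\<close> and \<open>b a\<close> differ by a power of
  \<open>q\<close>. Where this power is not 1, the product is not central and its average
  vanishes.\<close>

lemma torus_units_comm:
  "(\<Sum>(u, v)\<in>torus_units q. torus_mult q (torus_mult q u (torus_mult q a b)) v) =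
   (\<Sum>(u, v)\<in>torus_units q. torus_mult q (torus_mult q u (torus_mult q b a)) v)"
proof -
  define av where "av x = (\<Sum>(u, v)\<in>torus_units q. torus_mult q (torus_mult q u x) v)" for x
  have av_add: "av (x + y) = av x + av y" for x y
    by (simp add: av_def torus_mult_add_left torus_mult_add_right case_prod_unfold sum.distrib)
  have av0: "av 0 = 0" using av_add[of 0 0] by simp
  have av_single: "av (Poly_Mapping.single (x, y) c) = Poly_Mapping.single (x, y)
      ((1 + q powi x + q powi (- y) + q powi (x - y)) * c)" for x y c
    unfolding av_def torus_units_sum
    using torus_conj[of 0 0 x y c] torus_conj[of 1 0 x y c] torus_conj[of 0 1 x y c] torus_conj[of 1 1 x y c]
    by (simp add: sum.cartesian_product'[symmetric] distrib_right single_add add_ac)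
  have "av (torus_mult q a b) = av (torus_mult q b a)"
  proof (induction a rule: torus_induct)
    case (single k c)
    show ?case
    proof (induction b rule: torus_induct)
      case (single l d)
      obtain x y x' y' where kl: "k = (x, y)" "l = (x', y')" by (cases k, cases l)
      let ?w = "1 + q powi (x + x') + q powi (- (y + y')) + q powi (x + x' - (y + y'))"
      have "?w * q powi (y * x') = ?w * q powi (y' * x)"
        using q_cases
        by (cases "even x"; cases "even x'"; cases "even y"; cases "even y'") (auto simp: minus_one_powi)
      then have "?w * (q powi (y * x') * c * d) = ?w * (q powi (y' * x) * d * c)"
        by (metis mult.assoc mult.commute)
      then show ?case
        unfolding kl torus_mult_single add_Pair av_single fst_conv snd_conv
          add.commute[of x' x] add.commute[of y' y]
        by (rule arg_cong)
    qed (auto simp: av0 av_add torus_mult_add_left torus_mult_add_right)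
  qed (auto simp: av0 av_add torus_mult_add_left torus_mult_add_right)
  then show ?thesis by (simp add: av_def)
qed

end

sublocale torus \<subseteq> inv_algebra "quantum_torus q \<theta>1 \<theta>2"
  by (rule quantum_torus_inv_algebra) (use signs in auto)

context torus
begin

lemma unitary_torus:
  assumes "3 \<le> n" "\<rho> = 1 \<or> \<rho> = -1"
  shows "unitary T n \<rho> (torus_units q)"
proof (intro unitary.intro unitary_axioms.intro inv_algebra_axioms)
  have *: "q powi (- (i * j)) * q powi (i * j) = 1" for i j
    by (simp add: power_int_minus)
  show "amult T u v = aone T" "amult T v u = aone T" if "(u, v) \<in> torus_units q" for u v
    using that * by (auto simp: torus_units_def T_simps torus_mult_single zero_prod_def power_int_minus)
  show "(\<Sum>(u, v)\<in>torus_units q. amult T (amult T u (amult T a b)) v) =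
      (\<Sum>(u, v)\<in>torus_units q. amult T (amult T u (amult T b a)) v)" for a b
    unfolding T_simps by (rule torus_units_comm)
qed (use assms in \<open>auto simp: torus_units_def\<close>)

text \<open>\<open>ev \<alpha> \<beta> u v\<close> is the \<open>(u, v)\<close> entry of the representation on $\mathbb{C}^m$ in which
  $t_1$ acts by $\alpha\,\mathrm{diag}(1, q, \dots, q^{m-1})$ and $t_2$ by $\beta$ times the cyclic shift.\<close>

definition ev :: "complex \<Rightarrow> complex \<Rightarrow> nat \<Rightarrow> nat \<Rightarrow> torus \<Rightarrow> complex" where
  "ev \<alpha> \<beta> u v = torus_functional (\<lambda>k. \<alpha> powi fst k * q powi (int u * fst k) * \<beta> powi snd k *
     (if int m dvd int u + snd k - int v then 1 else 0))"

lemma ev_simps [simp]: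
  "ev \<alpha> \<beta> u v 0 = 0" "ev \<alpha> \<beta> u v (x + y) = ev \<alpha> \<beta> u v x + ev \<alpha> \<beta> u v y"
  "ev \<alpha> \<beta> u v (torus_scale c x) = c * ev \<alpha> \<beta> u v x"
  "ev \<alpha> \<beta> u v (sum g A) = (\<Sum>x\<in>A. ev \<alpha> \<beta> u v (g x))"
  by (simp_all add: ev_def torus_functional_add torus_functional_scale torus_functional_sum)

lemma ev_single: "ev \<alpha> \<beta> u v (Poly_Mapping.single (x, y) c) =
    c * (\<alpha> powi x * q powi (int u * x) * \<beta> powi y * (if int m dvd int u + y - int v then 1 else 0))"
  by (simp add: ev_def torus_functional_single)

lemma ev_minus [simp]: "ev \<alpha> \<beta> u v (- x) = - ev \<alpha> \<beta> u v x"
  using ev_simps(2)[of \<alpha> \<beta> u v x "- x"] by (simp add: add_eq_0_iff)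

lemma ev_diff [simp]: "ev \<alpha> \<beta> u v (x - y) = ev \<alpha> \<beta> u v x - ev \<alpha> \<beta> u v y"
  using ev_simps(2)[of \<alpha> \<beta> u v x "- y"] by simp

lemma dvd_unique:
  obtains w where "w < m" "\<And>w'. w' < m \<Longrightarrow> int m dvd y - int w' \<longleftrightarrow> w' = w"
proof
  let ?w = "nat (y mod int m)"
  have w: "int ?w = y mod int m" by simp
  show "?w < m" using w by (metis m_pos of_nat_0_less_iff of_nat_less_iff pos_mod_bound)
  fix w' assume "w' < m"
  have "int m dvd y - int w' \<longleftrightarrow> y mod int m = int w' mod int m"
    by (simp add: mod_eq_dvd_iff)
  also have "int w' mod int m = int w'" using \<open>w' < m\<close> by simp
  finally show "int m dvd y - int w' \<longleftrightarrow> w' = ?w" using w by auto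
qed

lemma ev_mult:
  assumes nz: "\<alpha> \<noteq> 0" "\<beta> \<noteq> 0"
  shows "ev \<alpha> \<beta> u v (torus_mult q x y) = (\<Sum>w<m. ev \<alpha> \<beta> u w x * ev \<alpha> \<beta> w v y)"
proof (induction x rule: torus_induct)
  case (single k c)
  show ?case
  proof (induction y rule: torus_induct)
    case (single l d)
    obtain x y x' y' where kl: "k = (x, y)" "l = (x', y')" by (cases k, cases l)
    obtain w where w: "w < m" "\<And>w'. w' < m \<Longrightarrow> int m dvd int u + y - int w' \<longleftrightarrow> w' = w"
      using dvd_unique[of "int u + y"] by metis
    then have dvd: "int m dvd int u + y - int w" by blast
    then have qw: "q powi ((int u + y) * x') = q powi (int w * x')" by (intro q_cong)
    have "int m dvd (int w + y' - int v) - (int u + (y + y') - int v)"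
      using dvd by (subst dvd_minus_iff[symmetric]) (simp add: algebra_simps)
    then have dv: "int m dvd int u + (y + y') - int v \<longleftrightarrow> int m dvd int w + y' - int v"
      by (metis dvd_diff_commute dvd_diffD dvd_diffD1 zdvd_zdiffD)
    have "(\<Sum>w<m. ev \<alpha> \<beta> u w (Poly_Mapping.single k c) * ev \<alpha> \<beta> w v (Poly_Mapping.single l d)) =
      (\<Sum>w'<m. if w' = w then c * (\<alpha> powi x * q powi (int u * x) * \<beta> powi y) *
        (d * (\<alpha> powi x' * q powi (int w * x') * \<beta> powi y' *
          (if int m dvd int w + y' - int v then 1 else 0))) else 0)"
      by (rule sum.cong) (auto simp: kl ev_single w(2))
    also have "\<dots> = c * (\<alpha> powi x * q powi (int u * x) * \<beta> powi y) *
        (d * (\<alpha> powi x' * q powi (int w * x') * \<beta> powi y' *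
          (if int m dvd int w + y' - int v then 1 else 0)))"
      using w(1) by simp
    also have "q powi (int w * x') = q powi (int u * x') * q powi (y * x')"
      unfolding qw[symmetric] by (simp add: power_int_add distrib_right)
    also have "c * (\<alpha> powi x * q powi (int u * x) * \<beta> powi y) *
        (d * (\<alpha> powi x' * (q powi (int u * x') * q powi (y * x')) * \<beta> powi y' *
          (if int m dvd int w + y' - int v then 1 else 0))) =
        ev \<alpha> \<beta> u v (torus_mult q (Poly_Mapping.single k c) (Poly_Mapping.single l d))"
      unfolding kl torus_mult_single add_Pair ev_single dv fst_conv snd_conv
      by (simp add: power_int_add nz distrib_left)
    finally show ?case ..
  qed (auto simp: torus_mult_add_right distrib_left sum.distrib)
qed (auto simp: torus_mult_add_left distrib_right sum.distrib)

lemma ev_one: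
  assumes "u < m" "v < m"
  shows "ev \<alpha> \<beta> u v (Poly_Mapping.single (0, 0) 1) = (if u = v then 1 else 0)"
  using q_cases assms by (auto simp: ev_single less_2_cases_iff)

text \<open>A lift of the matrix unit at \<open>(u, v)\<close>. The mean over \<open>k\<close> of
  the powers of \<open>q^(-u) t1 / \<alpha>\<close> is the spectral projection of \<open>t1\<close>
  for the eigenvalue \<open>\<alpha> q^u\<close>; the power of \<open>t2 / \<beta>\<close> then
  leads from index \<open>u\<close> to \<open>v\<close>.\<close>

definition munit :: "complex \<Rightarrow> complex \<Rightarrow> nat \<Rightarrow> nat \<Rightarrow> torus" where
  "munit \<alpha> \<beta> u v = (\<Sum>k<m. Poly_Mapping.single (int k, (int v - int u) mod int m)
     (q powi (- (int u * int k)) * \<alpha> powi (- int k) * \<beta> powi (- ((int v - int u) mod int m)) / of_nat m))"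

lemma q_geometric: "(\<Sum>u<m. q powi (int u * x)) = (if int m dvd x then of_nat m else 0)"
  using q_cases by (auto simp: minus_one_powi numeral_2_eq_2)

lemma q_geometric': "(\<Sum>k<m. q powi (x * int k)) = (if int m dvd x then of_nat m else 0)"
  using q_geometric[of x] by (simp add: mult.commute)

lemma ev_munit:
  assumes nz: "\<alpha> \<noteq> 0" "\<beta> \<noteq> 0" and lt: "u < m" "v < m" "w < m" "x < m"
  shows "ev \<alpha> \<beta> w x (munit \<alpha> \<beta> u v) = (if w = u \<and> x = v then 1 else 0)"
proof -
  let ?j = "(int v - int u) mod int m" and ?d = "if int m dvd int w + (int v - int u) mod int m - int x then 1 else (0::complex)"
  have "ev \<alpha> \<beta> w x (munit \<alpha> \<beta> u v) = (\<Sum>k<m. q powi ((int w - int u) * int k) * ?d / of_nat m)"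
    unfolding munit_def ev_simps ev_single
    by (rule sum.cong) (use nz in \<open>auto simp: power_int_minus power_int_add power_int_diff algebra_simps field_simps\<close>)
  also have "\<dots> = ?d * (if int m dvd int w - int u then 1 else 0)"
    by (simp add: sum_divide_distrib[symmetric] sum_distrib_right[symmetric] q_geometric')
  also have "int m dvd int w - int u \<longleftrightarrow> w = u" using q_cases lt by (auto simp: less_2_cases_iff)
  finally show ?thesis using q_cases lt by (cases "w = u") (auto simp: less_2_cases_iff)
qed

text \<open>Fourier inversion: lifting the matrix of a monomial reduces both exponents modulo
  \<open>m\<close> and replaces \<open>t1^m\<close> and \<open>t2^m\<close> by the scalars
  \<open>\<alpha>^m\<close> and \<open>\<beta>^m\<close>.\<close>

lemma munit_expand:
  assumes nz: "\<alpha> \<noteq> 0" "\<beta> \<noteq> 0"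
  shows "(\<Sum>u<m. \<Sum>v<m. torus_scale (ev \<alpha> \<beta> u v (Poly_Mapping.single (x, y) c)) (munit \<alpha> \<beta> u v)) =
    Poly_Mapping.single (x mod int m, y mod int m) (c * \<alpha> powi (x - x mod int m) * \<beta> powi (y - y mod int m))"
proof -
  let ?y = "y mod int m"
  define C where "C k = c * \<alpha> powi (x - int k) * \<beta> powi (y - ?y) / of_nat m" for k
  have "(\<Sum>v<m. torus_scale (ev \<alpha> \<beta> u v (Poly_Mapping.single (x, y) c)) (munit \<alpha> \<beta> u v)) =
      (\<Sum>k<m. Poly_Mapping.single (int k, ?y) (q powi (int u * (x - int k)) * C k))" for u
  proof -
    obtain w where w: "w < m" "\<And>w'. w' < m \<Longrightarrow> int m dvd int u + y - int w' \<longleftrightarrow> w' = w"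
      using dvd_unique[of "int u + y"] by metis
    then have "int m dvd int u + y - int w" by blast
    then have j: "(int w - int u) mod int m = ?y"
      by (subst mod_eq_dvd_iff) (simp add: dvd_diff_commute algebra_simps)
    have "(\<Sum>v<m. torus_scale (ev \<alpha> \<beta> u v (Poly_Mapping.single (x, y) c)) (munit \<alpha> \<beta> u v)) =
        (\<Sum>v<m. if v = w then torus_scale (c * (\<alpha> powi x * q powi (int u * x) * \<beta> powi y)) (munit \<alpha> \<beta> u w) else 0)"
      by (rule sum.cong) (auto simp: ev_single w(2) vs.scale_zero_left[unfolded T_simps])
    also have "\<dots> = torus_scale (c * (\<alpha> powi x * q powi (int u * x) * \<beta> powi y)) (munit \<alpha> \<beta> u w)"
      using w by simp
    also have "\<dots> = (\<Sum>k<m. Poly_Mapping.single (int k, ?y) (q powi (int u * (x - int k)) * C k))"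
      unfolding munit_def j T_simps(2)[symmetric] vs.scale_sum_right
      unfolding T_simps(2) torus_scale_single C_def
      by (rule sum.cong)
         (use nz in \<open>auto simp: power_int_minus power_int_diff right_diff_distrib field_simps\<close>)
    finally show ?thesis .
  qed
  then have "(\<Sum>u<m. \<Sum>v<m. torus_scale (ev \<alpha> \<beta> u v (Poly_Mapping.single (x, y) c)) (munit \<alpha> \<beta> u v)) =
      (\<Sum>k<m. \<Sum>u<m. Poly_Mapping.single (int k, ?y) (q powi (int u * (x - int k)) * C k))"
    by (subst sum.swap) simp
  also have "\<dots> = (\<Sum>k<m. Poly_Mapping.single (int k, ?y) (\<Sum>u<m. q powi (int u * (x - int k)) * C k))"
    by (simp add: single_sum)
  also have "\<dots> = (\<Sum>k<m. Poly_Mapping.single (int k, ?y) ((if int m dvd x - int k then of_nat m else 0) * C k))"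
    by (simp add: sum_distrib_right[symmetric] q_geometric)
  also have "\<dots> = Poly_Mapping.single (x mod int m, ?y) (c * \<alpha> powi (x - x mod int m) * \<beta> powi (y - ?y))"
  proof -
    obtain w where w: "w < m" "\<And>w'. w' < m \<Longrightarrow> int m dvd x - int w' \<longleftrightarrow> w' = w"
      using dvd_unique[of x] by metis
    then have "int m dvd x - int w" by blast
    then have "x mod int m = int w mod int m" by (simp add: mod_eq_dvd_iff)
    then have xw: "x mod int m = int w" using w by simp
    have "(\<Sum>k<m. Poly_Mapping.single (int k, ?y) ((if int m dvd x - int k then of_nat m else 0) * C k)) =
        (\<Sum>k<m. if k = w then Poly_Mapping.single (int w, ?y) (of_nat m * C w) else 0)"
      by (rule sum.cong) (auto simp: w(2))
    then show ?thesis using w by (simp add: xw C_def)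
  qed
  finally show ?thesis .
qed

section \<open>Central elements and joint eigenvectors\<close>

definition z1 :: torus where "z1 = Poly_Mapping.single (int m, 0) 1"
definition z2 :: torus where "z2 = Poly_Mapping.single (0, int m) 1"

lemma z_central: "amult T z1 b = amult T b z1" "amult T z2 b = amult T b z2"
proof -
  have "q powi (int m * k) = 1" for k using q_cong[of "int m" 0 k] by simp
  then show "amult T z1 b = amult T b z1" "amult T z2 b = amult T b z2"
    unfolding T_simps z1_def z2_def
    by (induction b rule: torus_induct; force simp: torus_mult_add_left torus_mult_add_right torus_mult_single add.commute mult.commute)+
qed

lemma z_inverse:
  "amult T (Poly_Mapping.single (- int m, 0) 1) z1 = aone T"
  "amult T (Poly_Mapping.single (0, - int m) 1) z2 = aone T"
  by (simp_all add: T_simps z1_def z2_def torus_mult_single)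

text \<open>If \<open>L\<close> is a joint eigenvector of the centre modulo \<open>J\<close>, then the class of \<open>x L\<close> only
  depends on the matrix \<open>ev \<alpha> \<beta> _ _ x\<close>.\<close>

lemma ev_expand_mod:
  assumes J: "star_ideal J" and nz: "\<alpha> \<noteq> 0" "\<beta> \<noteq> 0"
    and L1: "amult T z1 L - ascale T (\<alpha> ^ m) L \<in> J" and L2: "amult T z2 L - ascale T (\<beta> ^ m) L \<in> J"
  shows "amult T x L - (\<Sum>u<m. \<Sum>v<m. ascale T (ev \<alpha> \<beta> u v x) (amult T (munit \<alpha> \<beta> u v) L)) \<in> J"
proof -
  note Jd = star_idealD[OF J]
  \<comment> \<open>Agreement of \<open>x\<close> and \<open>y\<close> on the class of
    \<open>L\<close>. It is a congruence for multiplication from the left, so scalars are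
    substituted for the rightmost factor.\<close>
  define E where "E x y \<longleftrightarrow> amult T (x - y) L \<in> J" for x y
  have E_refl: "E x x" for x using Jd(1) by (simp add: E_def)
  have E_trans: "E x z" if "E x y" "E y z" for x y z
    using Jd(2)[OF that[unfolded E_def]] by (simp add: E_def mult_add_left[symmetric])
  have E_sym: "E y x" if "E x y" for x y
    using Jd(7)[OF that[unfolded E_def]] by (simp add: E_def mult_minus_left[symmetric])
  have E_mult: "E (amult T a x) (amult T a y)" if "E x y" for a x y
    using Jd(5)[OF that[unfolded E_def], of a] by (simp add: E_def mult_assoc[symmetric] mult_diff_right)
  have E_scale: "E (ascale T c x) (ascale T c y)" if "E x y" for c x y
    using Jd(3)[OF that[unfolded E_def], of c]
    by (simp add: E_def mult_scale_left[symmetric] vs.scale_right_diff_distrib)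
  have E_add: "E (x + x') (y + y')" if "E x y" "E x' y'" for x x' y y'
    using Jd(2)[OF that[unfolded E_def]] by (simp add: E_def mult_add_left[symmetric] algebra_simps)
  \<comment> \<open>An eigenvalue of \<open>g 1\<close> passes to all integer powers; the downward
    step divides by \<open>c\<close>.\<close>
  have unit_pow: "E (g k) (ascale T (c powi k) (aone T))"
    if c: "c \<noteq> 0" and g: "\<And>j k. g (j + k) = amult T (g j) (g k)" "g 0 = aone T"
      and 1: "E (g 1) (ascale T c (aone T))" for g :: "int \<Rightarrow> torus" and c k
  proof (induction k rule: int_induct[where k = 0])
    case base
    show ?case by (simp add: g E_refl)
  next
    case (step1 i)
    have "E (g (i + 1)) (ascale T c (g i))"
      using E_mult[OF 1, of "g i"] by (simp add: g mult_scale_right mult_one)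
    moreover have "E (ascale T c (g i)) (ascale T (c powi (i + 1)) (aone T))"
      using E_scale[OF step1(2), of c] c by (simp add: power_int_add mult.commute)
    ultimately show ?case by (rule E_trans)
  next
    case (step2 i)
    have "g i = amult T (g (i - 1)) (g 1)" using g(1)[of "i - 1" 1] by simp
    then have "E (g i) (ascale T c (g (i - 1)))"
      using E_mult[OF 1, of "g (i - 1)"] by (simp add: mult_scale_right mult_one)
    from E_trans[OF E_sym[OF this] step2(2)]
    have "E (ascale T c (g (i - 1))) (ascale T (c powi i) (aone T))" .
    from E_scale[OF this, of "inverse c"] show ?case
      using c by (simp add: power_int_diff divide_inverse mult.commute)
  qed
  have g1: "E (Poly_Mapping.single (int m * k, 0) 1) (ascale T ((\<alpha> ^ m) powi k) (aone T))" for k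
  proof (rule unit_pow[where g = "\<lambda>k. Poly_Mapping.single (int m * k, 0) 1"])
    show "E (Poly_Mapping.single (int m * 1, 0) 1) (ascale T (\<alpha> ^ m) (aone T))"
      using L1 unfolding E_def mult_diff_left mult_scale_left one_mult z1_def by simp
  qed (use nz in \<open>simp_all add: T_simps torus_mult_single distrib_left\<close>)
  have g2: "E (Poly_Mapping.single (0, int m * k) 1) (ascale T ((\<beta> ^ m) powi k) (aone T))" for k
  proof (rule unit_pow[where g = "\<lambda>k. Poly_Mapping.single (0, int m * k) 1"])
    show "E (Poly_Mapping.single (0, int m * 1) 1) (ascale T (\<beta> ^ m) (aone T))"
      using L2 unfolding E_def mult_diff_left mult_scale_left one_mult z2_def by simp
  qed (use nz in \<open>simp_all add: T_simps torus_mult_single distrib_left\<close>)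
  define S where "S x = (\<Sum>u<m. \<Sum>v<m. ascale T (ev \<alpha> \<beta> u v x) (munit \<alpha> \<beta> u v))" for x
  have "E x (S x)"
  proof (induction x rule: torus_induct)
    case zero
    show ?case by (simp add: S_def E_refl)
  next
    case (add x y)
    have "S (x + y) = S x + S y" by (simp add: S_def vs.scale_left_distrib sum.distrib)
    then show ?case using E_add[OF add] by simp
  next
    case (single k c)
    obtain x y where k: "k = (x, y)" by (cases k)
    define i j where "i = x div int m" and "j = y div int m"
    have x: "x = x mod int m + int m * i" and y: "y = y mod int m + int m * j" by (simp_all add: i_def j_def)
    let ?M = "Poly_Mapping.single (x mod int m, y mod int m) c"
    have "q powi (y mod int m * (int m * i)) = 1" using q_cong[of "int m" 0 "y mod int m * i"] by (simp add: ac_simps)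
    then have "Poly_Mapping.single k c = amult T ?M (amult T (Poly_Mapping.single (int m * i, 0) 1)
        (Poly_Mapping.single (0, int m * j) 1))"
      using x y by (simp add: k T_simps torus_mult_single)
    moreover have "E (amult T (Poly_Mapping.single (int m * i, 0) 1) (Poly_Mapping.single (0, int m * j) 1))
        (ascale T ((\<alpha> ^ m) powi i * (\<beta> ^ m) powi j) (aone T))"
      using E_mult[OF g2[of j], of "Poly_Mapping.single (int m * i, 0) 1"]
        E_scale[OF g1[of i], of "(\<beta> ^ m) powi j"] E_trans
      by (fastforce simp: mult_scale_right mult_one mult.commute)
    ultimately have "E (Poly_Mapping.single k c) (ascale T ((\<alpha> ^ m) powi i * (\<beta> ^ m) powi j) ?M)"
      using E_mult by (fastforce simp: mult_scale_right mult_one)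
    moreover have "(\<alpha> ^ m) powi i = \<alpha> powi (x - x mod int m)" "(\<beta> ^ m) powi j = \<beta> powi (y - y mod int m)"
      by (simp_all add: i_def j_def power_int_mult minus_mod_eq_mult_div)
    moreover have "ascale T (\<alpha> powi (x - x mod int m) * \<beta> powi (y - y mod int m)) ?M = S (Poly_Mapping.single k c)"
      unfolding S_def k T_simps munit_expand[OF nz] by (simp add: torus_scale_single ac_simps)
    ultimately show ?case by (simp only:)
  qed
  then show ?thesis
    by (simp add: E_def S_def mult_diff_left mult_sum_left mult_scale_left)
qed

text \<open>\<open>z1\<close> and \<open>z2\<close> act by the scalars \<open>\<alpha>^m\<close> and
  \<open>\<beta>^m\<close>.\<close>

lemma ev_reval:
  assumes nz: "\<alpha> \<noteq> 0" "\<beta> \<noteq> 0" and uv: "u < m" "v < m"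
  shows "ev \<alpha> \<beta> u v (reval z1 P) = (if u = v then poly P (\<alpha> ^ m) else 0)"
    and "ev \<alpha> \<beta> u v (reval z2 P) = (if u = v then poly P (\<beta> ^ m) else 0)"
proof -
  have *: "ev \<alpha> \<beta> u v (reval z P) = (if u = v then poly P c else 0)"
    if z: "\<And>u v. u < m \<Longrightarrow> v < m \<Longrightarrow> ev \<alpha> \<beta> u v z = (if u = v then c else 0)" and "u < m" "v < m" for z c u v
    using that(2,3)
  proof (induction P arbitrary: u v)
    case (pCons a P)
    have "(\<Sum>w<m. ev \<alpha> \<beta> u w z * ev \<alpha> \<beta> w v (reval z P)) = (\<Sum>w<m. if w = u then c * ev \<alpha> \<beta> u v (reval z P) else 0)"
      using pCons by (intro sum.cong) (auto simp: z)
    then have "ev \<alpha> \<beta> u v (amult T z (reval z P)) = c * ev \<alpha> \<beta> u v (reval z P)"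
      using pCons by (simp add: T_simps ev_mult[OF nz])
    then show ?case using pCons by (simp add: reval_pCons T_simps ev_one)
  qed simp
  have "ev \<alpha> \<beta> u v z1 = (if u = v then \<alpha> ^ m else 0)" "ev \<alpha> \<beta> u v z2 = (if u = v then \<beta> ^ m else 0)"
    if "u < m" "v < m" for u v
    using q_cases that nz by (auto simp: z1_def z2_def ev_single less_2_cases_iff)
  then show "ev \<alpha> \<beta> u v (reval z1 P) = (if u = v then poly P (\<alpha> ^ m) else 0)"
    "ev \<alpha> \<beta> u v (reval z2 P) = (if u = v then poly P (\<beta> ^ m) else 0)"
    using * uv by blast+
qed

text \<open>Lagrange polynomials in \<open>z1\<close> and \<open>z2\<close> isolate the point, and a
  lifted matrix unit selects the entry. These central elements see a point only through its
  \<open>m\<close>-th powers, hence the injectivity hypothesis.\<close>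

lemma interpolation:
  assumes S: "finite S" "\<And>\<alpha> \<beta>. (\<alpha>, \<beta>) \<in> S \<Longrightarrow> \<alpha> \<noteq> 0 \<and> \<beta> \<noteq> 0"
    and inj: "inj_on (\<lambda>p. (fst p ^ m, snd p ^ m)) S"
    and p: "p \<in> S" and uv: "u < m" "v < m"
  obtains e where "\<And>\<alpha> \<beta> w x. (\<alpha>, \<beta>) \<in> S \<Longrightarrow> w < m \<Longrightarrow> x < m \<Longrightarrow>
    ev \<alpha> \<beta> w x e = (if (\<alpha>, \<beta>) = p \<and> w = u \<and> x = v then 1 else 0)"
proof -
  obtain a b where ab: "p = (a, b)" by (cases p)
  define A1 A2 where "A1 = (\<lambda>p. fst p ^ m) ` S" and "A2 = (\<lambda>p. snd p ^ m) ` S"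
  define e where "e = torus_mult q (torus_mult q (reval z1 (lagrange A1 (a ^ m))) (reval z2 (lagrange A2 (b ^ m)))) (munit a b u v)"
  have "ev \<alpha> \<beta> w x e = (if (\<alpha>, \<beta>) = p \<and> w = u \<and> x = v then 1 else 0)"
    if pt: "(\<alpha>, \<beta>) \<in> S" and wx: "w < m" "x < m" for \<alpha> \<beta> w x
  proof -
    have nz: "\<alpha> \<noteq> 0" "\<beta> \<noteq> 0" using S(2)[OF pt] by auto
    have fin: "finite A1" "finite A2" "\<alpha> ^ m \<in> A1" "\<beta> ^ m \<in> A2"
      using S(1) pt by (force simp: A1_def A2_def)+
    let ?c = "(if \<alpha> ^ m = a ^ m then 1 else 0) * (if \<beta> ^ m = b ^ m then 1 else (0::complex))"
    have L: "ev \<alpha> \<beta> w y (torus_mult q (reval z1 (lagrange A1 (a ^ m))) (reval z2 (lagrange A2 (b ^ m)))) =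
        (if w = y then ?c else 0)" if "y < m" for y
    proof -
      have "(\<Sum>k<m. ev \<alpha> \<beta> w k (reval z1 (lagrange A1 (a ^ m))) * ev \<alpha> \<beta> k y (reval z2 (lagrange A2 (b ^ m)))) =
          (\<Sum>k<m. if k = w then if w = y then ?c else 0 else 0)"
        using wx that by (intro sum.cong) (auto simp: ev_reval[OF nz] poly_lagrange fin)
      then show ?thesis using wx by (simp add: ev_mult[OF nz])
    qed
    have "ev \<alpha> \<beta> w x e = (\<Sum>y<m. if y = w then ?c * ev \<alpha> \<beta> w x (munit a b u v) else 0)"
      unfolding e_def ev_mult[OF nz, of w x "torus_mult q _ _"] by (intro sum.cong) (auto simp: L)
    then have e: "ev \<alpha> \<beta> w x e = ?c * ev \<alpha> \<beta> w x (munit a b u v)" using wx by simp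
    show ?thesis
    proof (cases "(\<alpha>, \<beta>) = p")
      case True
      then show ?thesis using e ab ev_munit[OF nz uv wx] by simp
    next
      case False
      then have "(\<alpha> ^ m, \<beta> ^ m) \<noteq> (a ^ m, b ^ m)" using inj_onD[OF inj, of "(\<alpha>, \<beta>)" p] pt p ab by auto
      then show ?thesis using e False by auto
    qed
  qed
  then show thesis using that by blast
qed

end

section \<open>Quotients and powers\<close>

text \<open>Cosets are exactly the fibres \<open>D b\<close> of \<open>f\<close>, so each union in
  \<open>lie_quotient\<close> collapses to one fibre, and \<open>f\<close> of any representative
  defines the isomorphism.\<close>

lemma quotient_isomorphic:
  fixes L :: "('k, 'a) lie_algebra" and M :: "('k, 'b) lie_algebra"
  assumes closed: "\<And>x y. x \<in> lcarrier L \<Longrightarrow> y \<in> lcarrier L \<Longrightarrow> ladd L x y \<in> lcarrier L"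
      "\<And>c x. x \<in> lcarrier L \<Longrightarrow> lscale L c x \<in> lcarrier L"
      "\<And>x y. x \<in> lcarrier L \<Longrightarrow> y \<in> lcarrier L \<Longrightarrow> lbracket L x y \<in> lcarrier L"
    and hom: "\<And>x y. x \<in> lcarrier L \<Longrightarrow> y \<in> lcarrier L \<Longrightarrow> f (ladd L x y) = ladd M (f x) (f y)"
      "\<And>c x. x \<in> lcarrier L \<Longrightarrow> f (lscale L c x) = lscale M c (f x)"
      "\<And>x y. x \<in> lcarrier L \<Longrightarrow> y \<in> lcarrier L \<Longrightarrow> f (lbracket L x y) = lbracket M (f x) (f y)"
    and onto: "f ` lcarrier L = lcarrier M"
    and coset: "\<And>x. x \<in> lcarrier L \<Longrightarrow> lie_coset L I x = {y \<in> lcarrier L. f y = f x}"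
  shows "lie_isomorphic (lie_quotient L I) M"
proof -
  define g where "g A = f (SOME a. a \<in> A)" for A
  define D where "D b = {y \<in> lcarrier L. f y = b}" for b
  have gD: "g (D (f x)) = f x" if "x \<in> lcarrier L" for x
  proof -
    have "(SOME a. a \<in> D (f x)) \<in> D (f x)" by (rule someI[of _ x]) (use that in \<open>simp add: D_def\<close>)
    then show ?thesis by (simp add: g_def D_def)
  qed
  have cos: "lie_coset L I x = D (f x)" if "x \<in> lcarrier L" for x
    using coset[OF that] by (simp add: D_def)
  have carr: "lcarrier (lie_quotient L I) = (\<lambda>x. D (f x)) ` lcarrier L"
    by (auto simp: lie_quotient_def cos)
  have add: "ladd (lie_quotient L I) (D (f x)) (D (f y)) = D (f (ladd L x y))"
    if "x \<in> lcarrier L" "y \<in> lcarrier L" for x y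
    using that by (auto simp: lie_quotient_def D_def cos closed hom)
  have scale: "lscale (lie_quotient L I) c (D (f x)) = D (f (lscale L c x))"
    if "x \<in> lcarrier L" for c x
    using that by (auto simp: lie_quotient_def D_def cos closed hom)
  have bracket: "lbracket (lie_quotient L I) (D (f x)) (D (f y)) = D (f (lbracket L x y))"
    if "x \<in> lcarrier L" "y \<in> lcarrier L" for x y
    using that by (auto simp: lie_quotient_def D_def cos closed hom)
  have "bij_betw g (lcarrier (lie_quotient L I)) (lcarrier M)"
    unfolding bij_betw_def carr onto[symmetric] by (auto simp: inj_on_def gD image_image)
  then show ?thesis
    unfolding lie_isomorphic_def carr
    by (intro exI[of _ g]) (auto simp: add scale bracket gD closed hom[symmetric])
qed

context unitary_rep
begin

text \<open>Surjectivity is asked for generators in a single slot. The elements that can be hit in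
  slot \<open>i\<close> with zeros elsewhere form a subalgebra, because brackets are taken slotwise,
  so by \<open>min\<close> they exhaust \<open>C\<close>; the slots are then filled one after
  another.\<close>

lemma annihilator_quotient_power:
  fixes \<Psi> :: "nat \<Rightarrow> (nat \<Rightarrow> nat \<Rightarrow> 'r) \<Rightarrow> nat \<Rightarrow> nat \<Rightarrow> complex"
    and N :: nat
  defines "gN \<equiv> gl N complex_algebra"
  assumes C: "lie_subalgebra C gN" and min: "\<And>H. lie_subalgebra H gN \<Longrightarrow> \<Gamma> \<subseteq> H \<Longrightarrow> C \<subseteq> H"
    and \<Gamma>: "\<Gamma> \<subseteq> C"
    and map: "\<And>i X. i < k \<Longrightarrow> X \<in> G \<Longrightarrow> \<Psi> i X \<in> C"
    and add: "\<And>i X Y. i < k \<Longrightarrow> X \<in> G \<Longrightarrow> Y \<in> G \<Longrightarrow> \<Psi> i (\<lambda>a b. X a b + Y a b) = (\<lambda>a b. \<Psi> i X a b + \<Psi> i Y a b)"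
    and scale: "\<And>i X c. i < k \<Longrightarrow> X \<in> G \<Longrightarrow> \<Psi> i (\<lambda>a b. ascale R c (X a b)) = (\<lambda>a b. c * \<Psi> i X a b)"
    and bracket: "\<And>i X Y. i < k \<Longrightarrow> X \<in> G \<Longrightarrow> Y \<in> G \<Longrightarrow> \<Psi> i (br X Y) = lbracket gN (\<Psi> i X) (\<Psi> i Y)"
    and ker: "\<And>X. X \<in> G \<Longrightarrow> X \<in> lie_annihilator (g_lie n \<rho> R) \<phi> \<longleftrightarrow> (\<forall>i<k. \<Psi> i X = (\<lambda>a b. 0))"
    and surj: "\<And>i Y. i < k \<Longrightarrow> Y \<in> \<Gamma> \<Longrightarrow> \<exists>X\<in>G. \<forall>j<k. \<Psi> j X = (if j = i then Y else (\<lambda>a b. 0))"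
  shows "lie_isomorphic (lie_quotient (g_lie n \<rho> R) (lie_annihilator (g_lie n \<rho> R) \<phi>))
    (lie_power (gN\<lparr>lcarrier := C\<rparr>) k)"
proof -
  have ops: "ladd gN X Y = (\<lambda>a b. X a b + Y a b)" "lscale gN c X = (\<lambda>a b. c * X a b)"
    "lzero gN = (\<lambda>a b. 0)" for X Y c
    by (simp_all add: gN_def gl_def complex_algebra_def)
  have br0: "lbracket gN (\<lambda>a b. 0) (\<lambda>a b. 0) = (\<lambda>a b. 0)"
    by (simp add: gN_def gl_def complex_algebra_def mat_mult_def)
  have Cc: "X \<in> C \<Longrightarrow> Y \<in> C \<Longrightarrow> (\<lambda>a b. X a b + Y a b) \<in> C" "X \<in> C \<Longrightarrow> (\<lambda>a b. c * X a b) \<in> C"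
    "X \<in> C \<Longrightarrow> Y \<in> C \<Longrightarrow> lbracket gN X Y \<in> C" "(\<lambda>a b. 0) \<in> C" "C \<subseteq> lcarrier gN" for X Y c
    using C unfolding lie_subalgebra_def ops by blast+
  have zero: "\<Psi> i (\<lambda>a b. 0) = (\<lambda>a b. 0)" if "i < k" for i
    using scale[OF that G_closed(1), of 0] by simp
  have slot: "\<exists>X\<in>G. \<forall>j<k. \<Psi> j X = (if j = i then Y else (\<lambda>a b. 0))" if i: "i < k" and Y: "Y \<in> C" for i Y
  proof -
    define Q where "Q X Y \<longleftrightarrow> (\<forall>j<k. \<Psi> j X = (if j = i then Y else (\<lambda>a b. 0)))" for X Y
    define H where "H = {Y \<in> C. \<exists>X\<in>G. Q X Y}"
    have Qadd: "Q (\<lambda>a b. X a b + X' a b) (\<lambda>a b. Y a b + Y' a b)"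
      if "Q X Y" "Q X' Y'" "X \<in> G" "X' \<in> G" for X Y X' Y'
      using that by (auto simp: Q_def add)
    have Qscale: "Q (\<lambda>a b. ascale R c (X a b)) (\<lambda>a b. c * Y a b)" if "Q X Y" "X \<in> G" for X Y c
      using that by (auto simp: Q_def scale)
    have Qbr: "Q (br X X') (lbracket gN Y Y')" if "Q X Y" "Q X' Y'" "X \<in> G" "X' \<in> G" for X Y X' Y'
      using that by (auto simp: Q_def bracket br0)
    have "Q (\<lambda>a b. 0) (\<lambda>a b. 0)" by (auto simp: Q_def zero)
    then have "(\<lambda>a b. 0) \<in> H" using Cc(4) G_closed(1) by (auto simp: H_def)
    moreover have "(\<lambda>a b. Y a b + Y' a b) \<in> H" if "Y \<in> H" "Y' \<in> H" for Y Y'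
      using that Cc(1) Qadd G_closed(2) unfolding H_def by blast
    moreover have "(\<lambda>a b. c * Y a b) \<in> H" if "Y \<in> H" for Y c
      using that Cc(2) Qscale G_closed(3) unfolding H_def by blast
    moreover have "lbracket gN Y Y' \<in> H" if "Y \<in> H" "Y' \<in> H" for Y Y'
      using that Cc(3) Qbr G_closed(4) unfolding H_def by blast
    ultimately have "lie_subalgebra H gN"
      using Cc(5) unfolding lie_subalgebra_def ops H_def by blast
    moreover have "\<Gamma> \<subseteq> H" using surj[OF i] \<Gamma> unfolding H_def Q_def by blast
    ultimately have "C \<subseteq> H" by (rule min)
    then show ?thesis using Y unfolding H_def Q_def by blast
  qed
  have onto: "\<exists>X\<in>G. \<forall>j<k. \<Psi> j X = y j" if y: "\<forall>j<k. y j \<in> C" for y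
  proof -
    have "\<exists>X\<in>G. \<forall>j<k. \<Psi> j X = (if j < l then y j else (\<lambda>a b. 0))" if "l \<le> k" for l
      using that
    proof (induction l)
      case 0
      then show ?case using zero G_closed(1) by auto
    next
      case (Suc l)
      then obtain X where X: "X \<in> G" "\<forall>j<k. \<Psi> j X = (if j < l then y j else (\<lambda>a b. 0))" by auto
      obtain X' where X': "X' \<in> G" "\<forall>j<k. \<Psi> j X' = (if j = l then y l else (\<lambda>a b. 0))"
        using slot[of l "y l"] Suc y by auto
      show ?case
      proof (intro bexI allI impI)
        show "(\<lambda>a b. X a b + X' a b) \<in> G" using X X' G_closed(2) by blast
        fix j assume "j < k"
        then show "\<Psi> j (\<lambda>a b. X a b + X' a b) = (if j < Suc l then y j else (\<lambda>a b. 0))"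
          using X X' by (auto simp: add less_Suc_eq)
      qed
    qed
    from this[of k] show ?thesis by auto
  qed
  define f where "f X = (\<lambda>i\<in>{..<k}. \<Psi> i X)" for X
  have pw: "lcarrier (lie_power (gN\<lparr>lcarrier := C\<rparr>) k) = {..<k} \<rightarrow>\<^sub>E C"
    "ladd (lie_power (gN\<lparr>lcarrier := C\<rparr>) k) x y = (\<lambda>i\<in>{..<k}. \<lambda>a b. x i a b + y i a b)"
    "lscale (lie_power (gN\<lparr>lcarrier := C\<rparr>) k) c x = (\<lambda>i\<in>{..<k}. \<lambda>a b. c * x i a b)"
    "lbracket (lie_power (gN\<lparr>lcarrier := C\<rparr>) k) x y = (\<lambda>i\<in>{..<k}. lbracket gN (x i) (y i))" for x y c
    by (simp_all add: lie_power_def ops)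
  have f_eq: "f X = f Y \<longleftrightarrow> (\<forall>i<k. \<Psi> i X = \<Psi> i Y)" for X Y
  proof
    show "\<forall>i<k. \<Psi> i X = \<Psi> i Y" if "f X = f Y"
    proof (intro allI impI)
      fix i assume "i < k"
      then show "\<Psi> i X = \<Psi> i Y" using fun_cong[OF that, of i] by (simp add: f_def)
    qed
    show "f X = f Y" if "\<forall>i<k. \<Psi> i X = \<Psi> i Y"
      unfolding f_def using that by (intro restrict_ext) simp
  qed
  show ?thesis
  proof (rule quotient_isomorphic[where f = f])
    show "f ` G = lcarrier (lie_power (gN\<lparr>lcarrier := C\<rparr>) k)"
    proof
      show "f ` G \<subseteq> lcarrier (lie_power (gN\<lparr>lcarrier := C\<rparr>) k)"
        using map by (auto simp: pw f_def)
      show "lcarrier (lie_power (gN\<lparr>lcarrier := C\<rparr>) k) \<subseteq> f ` G"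
      proof
        fix y assume "y \<in> lcarrier (lie_power (gN\<lparr>lcarrier := C\<rparr>) k)"
        then have y: "y \<in> {..<k} \<rightarrow>\<^sub>E C" by (simp add: pw)
        then obtain X where X: "X \<in> G" "\<forall>j<k. \<Psi> j X = y j" using onto[of y] by auto
        then have "f X = y" using y by (auto simp: f_def PiE_def extensional_def)
        then show "y \<in> f ` G" using X by blast
      qed
    qed
    fix X assume X: "X \<in> G"
    let ?A = "lie_annihilator (g_lie n \<rho> R) \<phi>"
    show "lie_coset (g_lie n \<rho> R) ?A X = {Y \<in> G. f Y = f X}"
    proof
      show "lie_coset (g_lie n \<rho> R) ?A X \<subseteq> {Y \<in> G. f Y = f X}"
        using X ker I_G by (auto simp: lie_coset_def g_lie_simps(2) f_eq add G_closed subset_iff)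
      show "{Y \<in> G. f Y = f X} \<subseteq> lie_coset (g_lie n \<rho> R) ?A X"
      proof
        fix Y assume "Y \<in> {Y \<in> G. f Y = f X}"
        then have Y: "Y \<in> G" "\<forall>i<k. \<Psi> i Y = \<Psi> i X" by (auto simp: f_eq)
        let ?Z = "\<lambda>a b. Y a b + ascale R (-1) (X a b)"
        have Z: "?Z \<in> G" using X Y by (intro G_closed)
        have "\<Psi> i ?Z = (\<lambda>a b. 0)" if "i < k" for i
          using that X Y by (simp add: add scale G_closed(3) del: vs.scale_minus_left)
        then have "?Z \<in> ?A" using ker[OF Z] by blast
        moreover have "Y = ladd (g_lie n \<rho> R) X ?Z" by (simp add: g_lie_simps(2))
        ultimately show "Y \<in> lie_coset (g_lie n \<rho> R) ?A X" unfolding lie_coset_def by blast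
      qed
    qed
  qed (auto simp: g_lie_simps(2-4) G_closed pw f_def add scale bracket intro!: restrict_ext)
qed

end

locale torus_rep = torus q \<theta>1 \<theta>2 +
    unitary_rep "quantum_torus q \<theta>1 \<theta>2" n \<rho> "torus_units q" s B \<phi>
  for q \<theta>1 \<theta>2 :: complex and n \<rho> and s :: "complex \<Rightarrow> 'v::ab_group_add \<Rightarrow> 'v" and B \<phi>
begin

text \<open>Modulo \<open>J\<close> the products \<open>e1 a e2 b\<close> are joint eigenvectors of
  \<open>z1\<close> and \<open>z2\<close> with sum 1, and \<open>S\<close> records those outside
  \<open>J\<close>. An element whose matrices vanish on \<open>S\<close> kills all of them.
  Conversely, an element of \<open>J\<close> with a nonzero matrix entry would put the eigenvector
  itself into \<open>J\<close>, because matrix algebras are simple.\<close>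

theorem J_points:
  obtains S where "finite S" "\<And>\<alpha> \<beta>. (\<alpha>, \<beta>) \<in> S \<Longrightarrow> \<alpha> \<noteq> 0 \<and> \<beta> \<noteq> 0"
    "inj_on (\<lambda>p. (fst p ^ m, snd p ^ m)) S"
    "\<And>a. a \<in> J \<longleftrightarrow> (\<forall>(\<alpha>, \<beta>)\<in>S. \<forall>u<m. \<forall>v<m. ev \<alpha> \<beta> u v a = 0)"
proof -
  note Jd = star_idealD[OF J_ideal]
  obtain A1 where A1: "finite A1" "0 \<notin> A1" "\<And>P. (\<Prod>a\<in>A1. [:- a, 1:]) dvd P \<Longrightarrow> reval z1 P \<in> J"
    using central_unit_spectrum[OF z_central(1) z_inverse(1)] by blast
  obtain A2 where A2: "finite A2" "0 \<notin> A2" "\<And>P. (\<Prod>a\<in>A2. [:- a, 1:]) dvd P \<Longrightarrow> reval z2 P \<in> J"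
    using central_unit_spectrum[OF z_central(2) z_inverse(2)] by blast
  define e1 e2 where "e1 a = reval z1 (lagrange A1 a)" and "e2 b = reval z2 (lagrange A2 b)" for a b
  have c: "amult T (e1 a) x = amult T x (e1 a)" "amult T (e2 a) x = amult T x (e2 a)" for a x
    unfolding e1_def e2_def by (intro reval_central z_central)+
  have lin: "reval z ([:- a, 1:] * P) = amult T z (reval z P) - ascale T a (reval z P)" for z a P
    by (simp only: reval_mult) (simp add: reval_pCons mult_diff_left mult_scale_left one_mult mult_one)
  have eig1: "amult T z1 (e1 a) - ascale T a (e1 a) \<in> J" if "a \<in> A1" for a
    using A1(3)[OF lagrange_dvd[OF A1(1) that]] unfolding lin e1_def .
  have eig2: "amult T z2 (e2 a) - ascale T a (e2 a) \<in> J" if "a \<in> A2" for a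
    using A2(3)[OF lagrange_dvd[OF A2(1) that]] unfolding lin e2_def .
  have sum1: "aone T - (\<Sum>a\<in>A1. e1 a) \<in> J"
    using A1(3)[OF lagrange_sum_dvd[OF A1(1)]] by (simp add: reval_diff reval_sum e1_def)
  have sum2: "aone T - (\<Sum>a\<in>A2. e2 a) \<in> J"
    using A2(3)[OF lagrange_sum_dvd[OF A2(1)]] by (simp add: reval_diff reval_sum e2_def)
  have "\<exists>b :: complex. b ^ m = a" for a
    using q_cases power2_csqrt[of a] by (auto intro: exI[of _ "csqrt a"])
  then obtain rt where rt: "rt a ^ m = a" for a :: complex by metis
  \<comment> \<open>\<open>rt\<close> picks one \<open>m\<close>-th root per eigenvalue, so a point
    is determined by its \<open>m\<close>-th powers.\<close>
  define S where "S = {(rt a, rt b) | a b. a \<in> A1 \<and> b \<in> A2 \<and> amult T (e1 a) (e2 b) \<notin> J}"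
  have nz: "\<alpha> \<noteq> 0 \<and> \<beta> \<noteq> 0" if "(\<alpha>, \<beta>) \<in> S" for \<alpha> \<beta>
  proof -
    from that obtain a b where "\<alpha> = rt a" "\<beta> = rt b" "a \<in> A1" "b \<in> A2" by (auto simp: S_def)
    then show ?thesis using rt[of a] rt[of b] A1(2) A2(2) by (metis m_pos power_0_left not_gr_zero)
  qed
  have expand: "amult T x (amult T (e1 a) (e2 b)) - (\<Sum>u<m. \<Sum>v<m.
      ascale T (ev (rt a) (rt b) u v x) (amult T (munit (rt a) (rt b) u v) (amult T (e1 a) (e2 b)))) \<in> J"
    if "a \<in> A1" "b \<in> A2" "(rt a, rt b) \<in> S" for a b x
  proof (rule ev_expand_mod[OF J_ideal])
    show "rt a \<noteq> 0" "rt b \<noteq> 0" using nz that by blast+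
    show "amult T z1 (amult T (e1 a) (e2 b)) - ascale T (rt a ^ m) (amult T (e1 a) (e2 b)) \<in> J"
      using Jd(4)[OF eig1[OF that(1)], of "e2 b"]
      by (simp add: rt mult_diff_left mult_scale_left mult_assoc)
    have "amult T z2 (amult T (e1 a) (e2 b)) = amult T (e1 a) (amult T z2 (e2 b))"
      by (simp add: mult_assoc[symmetric] z_central(2)[of "e1 a"])
    then show "amult T z2 (amult T (e1 a) (e2 b)) - ascale T (rt b ^ m) (amult T (e1 a) (e2 b)) \<in> J"
      using Jd(5)[OF eig2[OF that(2)], of "e1 a"]
      by (simp add: rt mult_diff_right mult_scale_right)
  qed
  have main: "a \<in> J \<longleftrightarrow> (\<forall>(\<alpha>, \<beta>)\<in>S. \<forall>u<m. \<forall>v<m. ev \<alpha> \<beta> u v a = 0)" for a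
  proof
    assume ev0: "\<forall>(\<alpha>, \<beta>)\<in>S. \<forall>u<m. \<forall>v<m. ev \<alpha> \<beta> u v a = 0"
    have 1: "amult T a (amult T (e1 x) (e2 y)) \<in> J" if xy: "x \<in> A1" "y \<in> A2" for x y
    proof (cases "amult T (e1 x) (e2 y) \<in> J")
      case True
      then show ?thesis by (rule Jd(5))
    next
      case False
      then have "(rt x, rt y) \<in> S" using xy by (auto simp: S_def)
      then show ?thesis using expand[OF xy, of a] ev0 by auto
    qed
    have "amult T (\<Sum>x\<in>A1. e1 x) (\<Sum>y\<in>A2. e2 y) = (\<Sum>x\<in>A1. \<Sum>y\<in>A2. amult T (e1 x) (e2 y))"
      by (subst mult_sum_left) (simp only: mult_sum_right)
    then have "amult T a (amult T (\<Sum>x\<in>A1. e1 x) (\<Sum>y\<in>A2. e2 y)) \<in> J"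
      using 1 by (auto simp: mult_sum_right intro!: Jd(9))
    moreover have "amult T a (amult T (\<Sum>x\<in>A1. e1 x) (aone T - (\<Sum>y\<in>A2. e2 y))) \<in> J"
      by (intro Jd(5) sum2)
    moreover have "amult T a (aone T - (\<Sum>x\<in>A1. e1 x)) \<in> J" by (intro Jd(5) sum1)
    \<comment> \<open>Telescoping \<open>a\<close> along the two partitions of unity.\<close>
    ultimately have "amult T a (aone T - (\<Sum>x\<in>A1. e1 x)) +
        (amult T a (amult T (\<Sum>x\<in>A1. e1 x) (aone T - (\<Sum>y\<in>A2. e2 y))) +
         amult T a (amult T (\<Sum>x\<in>A1. e1 x) (\<Sum>y\<in>A2. e2 y))) \<in> J"
      by (intro Jd(2))
    then show "a \<in> J" by (simp add: mult_diff_right mult_one)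
  next
    assume a: "a \<in> J"
    show "\<forall>(\<alpha>, \<beta>)\<in>S. \<forall>u<m. \<forall>v<m. ev \<alpha> \<beta> u v a = 0"
    proof (rule ccontr)
      assume "\<not> (\<forall>(\<alpha>, \<beta>)\<in>S. \<forall>u<m. \<forall>v<m. ev \<alpha> \<beta> u v a = 0)"
      then obtain \<alpha> \<beta> u v where S: "(\<alpha>, \<beta>) \<in> S" and uv: "u < m" "v < m" and ne: "ev \<alpha> \<beta> u v a \<noteq> 0" by blast
      from S obtain x y where xy: "\<alpha> = rt x" "\<beta> = rt y" "x \<in> A1" "y \<in> A2" "amult T (e1 x) (e2 y) \<notin> J"
        by (auto simp: S_def)
      note nz' = nz[OF S, THEN conjunct1] nz[OF S, THEN conjunct2]
      define L where "L = amult T (e1 x) (e2 y)"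
      have ex: "amult T b L - (\<Sum>u<m. \<Sum>v<m. ascale T (ev \<alpha> \<beta> u v b) (amult T (munit \<alpha> \<beta> u v) L)) \<in> J" for b
        using expand[OF xy(3,4), of b] S xy by (simp add: L_def)
      have unit: "amult T (munit \<alpha> \<beta> w w) L \<in> J" if w: "w < m" for w
      proof -
        \<comment> \<open>Multiplying by lifted units on both sides cuts out entry
          \<open>(u, v)\<close> of \<open>a\<close> and moves it to \<open>(w, w)\<close>.\<close>
        define b where "b = amult T (amult T (munit \<alpha> \<beta> w u) a) (munit \<alpha> \<beta> v w)"
        have "b \<in> J" unfolding b_def by (intro Jd(4) Jd(5) a)
        have sel: "(\<Sum>z<m. (if x = w \<and> z = u then 1 else 0) * f z) = (if x = w then f u else 0)"
          "(\<Sum>z<m. f z * (if z = v \<and> x = w then 1 else 0)) = (if x = w then f v else 0)" for x and f :: "nat \<Rightarrow> complex"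
          using uv by (auto simp: if_distrib[of "\<lambda>x. x * _"] if_distrib[of "\<lambda>x. _ * x"] cong: if_cong)
        have evb: "ev \<alpha> \<beta> i j b = (if i = w \<and> j = w then ev \<alpha> \<beta> u v a else 0)" if ij: "i < m" "j < m" for i j
        proof -
          have 1: "ev \<alpha> \<beta> i k (torus_mult q (munit \<alpha> \<beta> w u) a) = (if i = w then ev \<alpha> \<beta> u k a else 0)" for k
          proof -
            have "ev \<alpha> \<beta> i k (torus_mult q (munit \<alpha> \<beta> w u) a) =
                (\<Sum>z<m. (if i = w \<and> z = u then 1 else 0) * ev \<alpha> \<beta> z k a)"
              unfolding ev_mult[OF nz'] by (intro sum.cong) (use ij w uv nz' in \<open>auto simp: ev_munit\<close>)
            then show ?thesis by (simp only: sel)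
          qed
          have "ev \<alpha> \<beta> i j b = (\<Sum>z<m. (if i = w then ev \<alpha> \<beta> u z a else 0) * (if z = v \<and> j = w then 1 else 0))"
            unfolding b_def T_simps ev_mult[OF nz', of i j "torus_mult q _ _"] 1
            by (intro sum.cong) (use ij w uv nz' in \<open>auto simp: ev_munit\<close>)
          then show ?thesis by (simp only: sel) simp
        qed
        have "(\<Sum>i<m. \<Sum>j<m. ascale T (ev \<alpha> \<beta> i j b) (amult T (munit \<alpha> \<beta> i j) L)) =
            (\<Sum>i<m. \<Sum>j<m. if i = w then if j = w then
              ascale T (ev \<alpha> \<beta> u v a) (amult T (munit \<alpha> \<beta> w w) L) else 0 else 0)"
          by (intro sum.cong refl) (auto simp: evb)
        also have "\<dots> = (\<Sum>i<m. if i = w then ascale T (ev \<alpha> \<beta> u v a) (amult T (munit \<alpha> \<beta> w w) L) else 0)"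
          by (intro sum.cong refl) (use w in auto)
        also have "\<dots> = ascale T (ev \<alpha> \<beta> u v a) (amult T (munit \<alpha> \<beta> w w) L)"
          using w by simp
        finally have "amult T b L - ascale T (ev \<alpha> \<beta> u v a) (amult T (munit \<alpha> \<beta> w w) L) \<in> J"
          using ex[of b] by simp
        then have "ascale T (ev \<alpha> \<beta> u v a) (amult T (munit \<alpha> \<beta> w w) L) \<in> J"
          using Jd(8)[OF Jd(4)[OF \<open>b \<in> J\<close>, of L]] by fastforce
        then show ?thesis using ne by (rule star_ideal_unscale[OF J_ideal])
      qed
      have "(\<Sum>i<m. \<Sum>j<m. ascale T (ev \<alpha> \<beta> i j (aone T)) (amult T (munit \<alpha> \<beta> i j) L)) =
          (\<Sum>i<m. \<Sum>j<m. if j = i then amult T (munit \<alpha> \<beta> i i) L else 0)"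
        by (intro sum.cong) (auto simp: T_simps(3) ev_one)
      also have "\<dots> \<in> J" by (intro Jd(9)) (auto simp: unit Jd(1))
      finally have "L \<in> J" using Jd(2)[OF ex[of "aone T"]] by (fastforce simp: one_mult)
      then show False using xy by (simp add: L_def)
    qed
  qed
  show thesis
  proof (rule that[of S])
    have "S \<subseteq> (\<lambda>(a, b). (rt a, rt b)) ` (A1 \<times> A2)" by (auto simp: S_def)
    then show "finite S" using A1 A2 by (meson finite_SigmaI finite_imageI finite_subset)
    show "inj_on (\<lambda>p. (fst p ^ m, snd p ^ m)) S"
      by (auto simp: inj_on_def S_def rt)
  qed (use nz main in auto)
qed

end

section \<open>The evaluation homomorphisms\<close>

lemma unitary_complex:
  assumes "3 \<le> N" "\<rho> = 1 \<or> \<rho> = -1"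
  shows "unitary complex_algebra N \<rho> {(1, 1)}"
  by (intro unitary.intro unitary_axioms.intro inv_algebra_complex)
     (use assms in \<open>auto simp: complex_algebra_def\<close>)

text \<open>Root elements as matrix unit minus adjoint: in this form they can be followed through a
  map that respects adjoints.\<close>

lemma (in unitary) F_adjoint:
  assumes "p \<in> idx" "q \<in> idx" "i \<in> idx" "j \<in> idx"
  shows "F p q a i j = e_mat p q a i j - ascale R (eps i * eps j) (astar R (e_mat p q a (pr j) (pr i)))"
proof -
  have "ascale R (eps i * eps j) (astar R (e_mat p q a (pr j) (pr i))) =
      ascale R (eps i * eps j) (e_mat (pr q) (pr p) (astar R a) i j)"
    by (simp add: e_mat_pr(2)[OF assms] star_e_mat)
  also have "\<dots> = ascale R (eps (pr q) * eps (pr p)) (e_mat (pr q) (pr p) (astar R a) i j)"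
    by (rule e_mat_sign)
  also have "eps (pr q) * eps (pr p) = eps p * eps q"
    using assms by (simp add: eps_pr ac_simps)
  finally show ?thesis by (simp add: F_def e_mat_scale)
qed

section \<open>Generators of the special linear algebra\<close>

lemma subalgebra_sl: "lie_subalgebra (lcarrier (sl N)) (gl N complex_algebra)"
proof -
  have "(\<Sum>i = 1..N. \<Sum>l = 1..N. X i l * Y l i) = (\<Sum>i = 1..N. \<Sum>l = 1..N. Y i l * X l i)"
    for X Y :: "nat \<Rightarrow> nat \<Rightarrow> complex"
    by (subst sum.swap) (simp add: mult.commute)
  then show ?thesis
    by (auto simp: lie_subalgebra_def sl_def gl_def mat_mult_def complex_algebra_def sum.distrib
      sum_subtractf sum_distrib_left[symmetric])
qed

lemma e_mat_mult:
  assumes "b \<in> {1..N}"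
  shows "mat_mult complex_algebra N (e_mat a b x) (e_mat c d y) = (if b = c then e_mat a d (x * y) else (\<lambda>i j. 0))"
proof (intro ext)
  fix i j
  have "mat_mult complex_algebra N (e_mat a b x) (e_mat c d y) i j =
      (\<Sum>l = 1..N. if l = b then (if i = a \<and> b = c \<and> j = d then x * y else 0) else 0)"
    unfolding mat_mult_def by (rule sum.cong) (auto simp: e_mat_def complex_algebra_def)
  then show "mat_mult complex_algebra N (e_mat a b x) (e_mat c d y) i j =
      (if b = c then e_mat a d (x * y) else (\<lambda>i j. 0)) i j"
    using assms by (simp add: e_mat_def)
qed

lemma subalgebra_sum:
  assumes H: "lie_subalgebra H (gl N complex_algebra)" and f: "\<And>x. x \<in> A \<Longrightarrow> f x \<in> H"
  shows "(\<lambda>i j. \<Sum>x\<in>A. f x i j) \<in> H"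
proof -
  have "(\<lambda>i j. 0) \<in> H" "\<And>X Y. X \<in> H \<Longrightarrow> Y \<in> H \<Longrightarrow> (\<lambda>i j. X i j + Y i j) \<in> H"
    using H by (auto simp: lie_subalgebra_def gl_def)
  then show ?thesis using f by (induction A rule: infinite_finite_induct) auto
qed

text \<open>Brackets of off-diagonal units give \<open>E_aa - E_11\<close>. A diagonal of trace zero
  is a combination of these, since the coefficients at \<open>E_11\<close> cancel.\<close>

lemma sl_minimal:
  assumes H: "lie_subalgebra H (gl N complex_algebra)"
    and gen: "{e_mat a b c | a b c. a \<in> {1..N} \<and> b \<in> {1..N} \<and> a \<noteq> b} \<subseteq> H"
  shows "lcarrier (sl N) \<subseteq> H"
proof
  fix Y assume Y: "Y \<in> lcarrier (sl N)"
  have e: "e_mat a b c \<in> H" if "a \<in> {1..N}" "b \<in> {1..N}" "a \<noteq> b" for a b c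
    using gen that by blast
  have Hbr: "lbracket (gl N complex_algebra) X Z \<in> H" if "X \<in> H" "Z \<in> H" for X Z
    using H that by (auto simp: lie_subalgebra_def)
  have Hadd: "(\<lambda>i j. X i j + Z i j) \<in> H" if "X \<in> H" "Z \<in> H" for X Z
    using H that by (auto simp: lie_subalgebra_def gl_def)
  have H0: "(\<lambda>i j. 0) \<in> H" using H by (auto simp: lie_subalgebra_def gl_def)
  have diag: "(\<lambda>i j. e_mat a a c i j - e_mat 1 1 c i j) \<in> H" if a: "a \<in> {1..N}" for a c
  proof (cases "a = 1")
    case False
    have 1: "1 \<in> {1..N}" using a by auto
    have "lbracket (gl N complex_algebra) (e_mat a 1 c) (e_mat 1 a 1) \<in> H"
      using a 1 False by (intro Hbr e) auto
    then show ?thesis by (simp add: gl_def e_mat_mult[OF 1] e_mat_mult[OF a] del: One_nat_def)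
  qed (simp add: H0)
  have off: "(\<lambda>i j. \<Sum>a\<in>{1..N}. \<Sum>b\<in>{1..N} - {a}. e_mat a b (Y a b) i j) \<in> H"
    by (intro subalgebra_sum[OF H] e) auto
  have dg: "(\<lambda>i j. \<Sum>a\<in>{1..N}. e_mat a a (Y a a) i j - e_mat 1 1 (Y a a) i j) \<in> H"
    by (intro subalgebra_sum[OF H] diag) auto
  have "Y i j = (\<Sum>a\<in>{1..N}. \<Sum>b\<in>{1..N} - {a}. e_mat a b (Y a b) i j) +
      (\<Sum>a\<in>{1..N}. e_mat a a (Y a a) i j - e_mat 1 1 (Y a a) i j)" for i j
  proof -
    have tr: "(\<Sum>a\<in>{1..N}. e_mat 1 1 (Y a a) i j) = 0"
      using Y by (cases "i = 1 \<and> j = 1") (auto simp: e_mat_def sl_def)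
    have "(\<Sum>a\<in>{1..N}. \<Sum>b\<in>{1..N}. e_mat a b (Y a b) i j) =
        (\<Sum>a\<in>{1..N}. if i = a then (\<Sum>b\<in>{1..N}. if j = b then Y a b else 0) else 0)"
      by (intro sum.cong) (auto simp: e_mat_def)
    also have "\<dots> = Y i j"
      using Y by (auto simp: sl_def gl_def)
    finally have "Y i j = (\<Sum>a\<in>{1..N}. \<Sum>b\<in>{1..N}. e_mat a b (Y a b) i j)" ..
    also have "(\<Sum>a\<in>{1..N}. \<Sum>b\<in>{1..N}. e_mat a b (Y a b) i j) =
        (\<Sum>a\<in>{1..N}. (\<Sum>b\<in>{1..N} - {a}. e_mat a b (Y a b) i j) + e_mat a a (Y a a) i j)"
      by (intro sum.cong refl, subst add.commute, rule sum.remove) auto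
    finally show ?thesis unfolding sum_subtractf tr by (simp add: sum.distrib)
  qed
  then have "Y = (\<lambda>i j. (\<Sum>a\<in>{1..N}. \<Sum>b\<in>{1..N} - {a}. e_mat a b (Y a b) i j) +
      (\<Sum>a\<in>{1..N}. e_mat a a (Y a a) i j - e_mat 1 1 (Y a a) i j))" by blast
  then show "Y \<in> H" using Hadd[OF off dg] by simp
qed

section \<open>Commutative torus with nontrivial involution\<close>

context torus_rep
begin

text \<open>Points are characters, and the involution acts on them by \<sigma>, which has no fixed
  point because it negates a nonzero coordinate. The value of a skew matrix at
  \<open>\<sigma> p\<close> is determined by its value at \<open>p\<close>, whereas the value at
  \<open>p\<close> is restricted by its trace only.\<close>

lemma quotient_sl:
  assumes q1: "q = 1" and \<theta>2: "\<theta>2 = -1"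
  shows "\<exists>k. lie_isomorphic (lie_quotient (g_lie n \<rho> T) (lie_annihilator (g_lie n \<rho> T) \<phi>))
    (lie_power (sl (2 * n)) k)"
proof -
  have m1: "m = 1" using q_cases q1 by auto
  obtain S where S: "finite S" "\<And>\<alpha> \<beta>. (\<alpha>, \<beta>) \<in> S \<Longrightarrow> \<alpha> \<noteq> 0 \<and> \<beta> \<noteq> 0"
    "inj_on (\<lambda>p. (fst p ^ m, snd p ^ m)) S"
    "\<And>a. a \<in> J \<longleftrightarrow> (\<forall>(\<alpha>, \<beta>)\<in>S. \<forall>u<m. \<forall>v<m. ev \<alpha> \<beta> u v a = 0)"
    by (rule J_points) blast
  define E where "E p = ev (fst p) (snd p) 0 0" for p
  have J: "a \<in> J \<longleftrightarrow> (\<forall>p\<in>S. E p a = 0)" for a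
    unfolding S(4) E_def using m1 by auto
  define \<sigma> where "\<sigma> p = (\<theta>1 * fst p, - snd p)" for p :: "complex \<times> complex"
  have \<theta>1sq: "\<theta>1 * \<theta>1 = 1" "\<theta>1 * (\<theta>1 * c) = c" for c using signs by auto
  have \<sigma>\<sigma>: "\<sigma> (\<sigma> p) = p" for p by (simp add: \<sigma>_def \<theta>1sq)
  have \<sigma>_star: "E p (astar T x) = E (\<sigma> p) x" for p x
  proof (induction x rule: torus_induct)
    case (single k c)
    obtain i j where k: "k = (i, j)" by (cases k)
    have "(- snd p) powi j = (- 1) powi j * snd p powi j"
      using power_int_mult_distrib[of "-1" "snd p" j] by simp
    moreover have "q powi l = 1" for l using q1 by simp
    ultimately show ?case
      unfolding k E_def \<sigma>_def T_simps torus_star_single fst_conv snd_conv ev_single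
      by (simp add: \<theta>2 m1 power_int_mult_distrib)
  qed (simp_all add: E_def T_simps torus_star_add)
  \<comment> \<open>A largest subset of \<open>S\<close> disjoint from its image under \<sigma>; a
    point of \<open>S\<close> outside both could be added.\<close>
  obtain S' where S': "S' \<subseteq> S" "S' \<inter> \<sigma> ` S' = {}" "S \<subseteq> S' \<union> \<sigma> ` S'"
  proof -
    define Q where "Q A \<longleftrightarrow> A \<subseteq> S \<and> A \<inter> \<sigma> ` A = {}" for A
    have "Q {}" by (simp add: Q_def)
    then obtain A where A: "Q A" "\<And>A'. Q A' \<Longrightarrow> card A' \<le> card A"
      using ex_has_greatest_nat[of Q "{}" card "Suc (card S)"] card_mono[OF S(1)]
      by (auto simp: Q_def less_Suc_eq_le)
    have "p \<in> A \<union> \<sigma> ` A" if "p \<in> S" for p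
    proof (rule ccontr)
      assume n: "p \<notin> A \<union> \<sigma> ` A"
      have "\<sigma> p \<noteq> p" using S(2)[of "fst p" "snd p"] that by (auto simp: \<sigma>_def prod_eq_iff)
      moreover have "\<sigma> p \<notin> A" using n \<sigma>\<sigma> by (metis UnI2 image_eqI)
      ultimately have "Q (insert p A)" using A(1) that n by (auto simp: Q_def)
      moreover have "finite A" using A(1) S(1) by (auto simp: Q_def intro: finite_subset)
      ultimately show False using A(2)[of "insert p A"] n by simp
    qed
    then show thesis using that[of A] A(1) unfolding Q_def by blast
  qed
  have finS': "finite S'" using S' S(1) finite_subset by blast
  define k where "k = card S'"
  obtain h where h: "bij_betw h {..<k} S'"
    using ex_bij_betw_nat_finite[OF finS'] by (auto simp: k_def lessThan_atLeast0)
  have hS: "h i \<in> S'" if "i < k" for i using h that by (auto simp: bij_betw_def)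
  have nzE: "fst (h i) \<noteq> 0" "snd (h i) \<noteq> 0" if "i < k" for i
    using hS[OF that] S' S(2)[of "fst (h i)" "snd (h i)"] by auto
  have E_mult: "E (h i) (torus_mult q x y) = E (h i) x * E (h i) y" if "i < k" for i x y
    unfolding E_def using ev_mult[OF nzE[OF that]] m1 by simp
  have E_lin: "E p 0 = 0" "E p (x + y) = E p x + E p y" "E p (ascale T c x) = c * E p x"
    "E p (- x) = - E p x" "E p (x - y) = E p x - E p y" "E p (sum f A) = (\<Sum>x\<in>A. E p (f x))" for p x y c f and A :: "nat set"
    by (simp_all add: E_def T_simps)
  define \<Psi> where "\<Psi> i X = (\<lambda>a b. E (h i) (X a b))" for i :: nat and X :: "nat \<Rightarrow> nat \<Rightarrow> torus"
  \<comment> \<open>All four conjugations are trivial for \<open>q = 1\<close>, so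
    \<open>avg\<close> is multiplication by 4 and the trace itself vanishes.\<close>
  have tr0: "tr X = 0" if "X \<in> G" for X
  proof -
    have "avg x = ascale T 4 x" for x
      unfolding avg_def T_simps
    proof (induction x rule: torus_induct)
      case (single k c)
      obtain x y where k: "k = (x, y)" by (cases k)
      show ?case
        unfolding torus_units_sum
        using torus_conj[of 0 0 x y c] torus_conj[of 1 0 x y c] torus_conj[of 0 1 x y c] torus_conj[of 1 1 x y c]
        by (simp add: k q1 sum.cartesian_product'[symmetric] torus_scale_single single_add[symmetric])
    qed (simp_all add: torus_mult_add_left torus_mult_add_right torus_scale_add case_prod_unfold sum.distrib)
    then show ?thesis using G_skew(2)[OF that] by simp
  qed
  have "lie_isomorphic (lie_quotient (g_lie n \<rho> T) (lie_annihilator (g_lie n \<rho> T) \<phi>))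
    (lie_power ((gl (2 * n) complex_algebra)\<lparr>lcarrier := lcarrier (sl (2 * n))\<rparr>) k)"
  proof (rule annihilator_quotient_power[where \<Psi> = \<Psi>])
    show "lie_subalgebra (lcarrier (sl (2 * n))) (gl (2 * n) complex_algebra)" by (rule subalgebra_sl)
    let ?\<Gamma> = "{e_mat a b c | a b (c :: complex). a \<in> {1..2 * n} \<and> b \<in> {1..2 * n} \<and> a \<noteq> b}"
    show "lcarrier (sl (2 * n)) \<subseteq> H" if "lie_subalgebra H (gl (2 * n) complex_algebra)" "?\<Gamma> \<subseteq> H" for H
      using that by (rule sl_minimal)
    show "?\<Gamma> \<subseteq> lcarrier (sl (2 * n))"
      by (auto simp: sl_def gl_def e_mat_def intro!: sum.neutral)
    fix i X assume i: "i < k" and X: "X \<in> G"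
    have X0: "X a b = 0" if "a \<notin> idx \<or> b \<notin> idx" for a b
      using G_closed(5)[OF X] that by (auto simp: gl_simps)
    have "(\<Sum>a\<in>idx. E (h i) (X a a)) = E (h i) (tr X)" by (simp add: tr_def E_lin)
    then have "(\<Sum>a = 1..2 * n. E (h i) (X a a)) = 0" using tr0[OF X] by (simp add: idx_def E_lin)
    then show "\<Psi> i X \<in> lcarrier (sl (2 * n))"
      using X0 by (auto simp: \<Psi>_def sl_def gl_def idx_def E_lin)
    show "\<Psi> i (\<lambda>a b. ascale T c (X a b)) = (\<lambda>a b. c * \<Psi> i X a b)" for c
      by (simp add: \<Psi>_def E_lin)
    fix Y assume Y: "Y \<in> G"
    show "\<Psi> i (\<lambda>a b. X a b + Y a b) = (\<lambda>a b. \<Psi> i X a b + \<Psi> i Y a b)"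
      by (simp add: \<Psi>_def E_lin)
    show "\<Psi> i (br X Y) = lbracket (gl (2 * n) complex_algebra) (\<Psi> i X) (\<Psi> i Y)"
      unfolding gl_simps(5) \<Psi>_def
      by (simp add: E_lin E_mult[OF i] T_simps(1) gl_def mat_mult_def complex_algebra_def idx_def)
  next
    fix X assume X: "X \<in> G"
    have "X \<in> lie_annihilator (g_lie n \<rho> T) \<phi> \<longleftrightarrow> (\<forall>a b. \<forall>p\<in>S. E p (X a b) = 0)"
      using I_iff[of X] X J by simp
    also have "\<dots> \<longleftrightarrow> (\<forall>i<k. \<Psi> i X = (\<lambda>a b. 0))"
    proof
      assume *: "\<forall>a b. \<forall>p\<in>S. E p (X a b) = 0"
      show "\<forall>i<k. \<Psi> i X = (\<lambda>a b. 0)" 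
        unfolding \<Psi>_def using * hS S'(1) by (intro allI impI ext) blast
    next
      assume *: "\<forall>i<k. \<Psi> i X = (\<lambda>a b. 0)"
      have 1: "E p (X a b) = 0" if "p \<in> S'" for p a b
      proof -
        obtain i where "i < k" "p = h i" using h \<open>p \<in> S'\<close> by (auto simp: bij_betw_def)
        then show ?thesis using * by (auto simp: \<Psi>_def fun_eq_iff)
      qed
      have 2: "E (\<sigma> p) (X a b) = 0" if "p \<in> S'" for p a b
      proof (cases "a \<in> idx \<and> b \<in> idx")
        case True
        then have "X (pr b) (pr a) = ascale T (- (eps a * eps b)) (astar T (X a b))"
          using G_skew(1)[OF X] unfolding skew_def by blast
        then have "(eps a * eps b) * E p (astar T (X a b)) = 0" using 1[OF that, of "pr b" "pr a"] by (simp add: E_lin)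
        moreover have "eps a \<noteq> 0" "eps b \<noteq> 0" using rho by (auto simp: eps_def)
        ultimately show ?thesis by (simp add: \<sigma>_star)
      next
        case False
        then have "X a b = 0" using G_closed(5)[OF X] by (auto simp: gl_simps)
        then show ?thesis by (simp add: E_lin)
      qed
      show "\<forall>a b. \<forall>p\<in>S. E p (X a b) = 0" using 1 2 S'(3) by blast
    qed
    finally show "X \<in> lie_annihilator (g_lie n \<rho> T) \<phi> \<longleftrightarrow> (\<forall>i<k. \<Psi> i X = (\<lambda>a b. 0))" .
  next
    fix i Y assume i: "i < k"
      and "Y \<in> {e_mat a b c | a b (c :: complex). a \<in> {1..2 * n} \<and> b \<in> {1..2 * n} \<and> a \<noteq> b}"
    then obtain a b c where Y: "Y = e_mat a b c" "a \<in> idx" "b \<in> idx" "a \<noteq> b" by (auto simp: idx_def)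
    \<comment> \<open>Interpolating on the images under \<sigma> as well makes
      \<open>astar e\<close> vanish at every \<open>h j\<close>. The mirror part of
      \<open>F a b\<close> then disappears and a bare matrix unit remains.\<close>
    let ?T = "S' \<union> \<sigma> ` S'"
    obtain e where e: "\<And>\<alpha> \<beta> w x. (\<alpha>, \<beta>) \<in> ?T \<Longrightarrow> w < m \<Longrightarrow> x < m \<Longrightarrow>
        ev \<alpha> \<beta> w x e = (if (\<alpha>, \<beta>) = h i \<and> w = 0 \<and> x = 0 then 1 else 0)"
    proof (rule interpolation[of ?T "h i" 0 0])
      show "finite ?T" using finS' by simp
      show "inj_on (\<lambda>p. (fst p ^ m, snd p ^ m)) ?T" by (simp add: m1 inj_on_def)
      show "\<alpha> \<noteq> 0 \<and> \<beta> \<noteq> 0" if "(\<alpha>, \<beta>) \<in> ?T" for \<alpha> \<beta>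
        using that S'(1) S(2) \<theta>1sq by (force simp: \<sigma>_def)
    qed (use hS[OF i] in auto)
    have Ee: "E p e = (if p = h i then 1 else 0)" if "p \<in> ?T" for p
      using e[of "fst p" "snd p" 0 0] that m1 by (simp add: E_def)
    have "\<Psi> j (F a b (ascale T c e)) = (if j = i then Y else (\<lambda>a b. 0))" if j: "j < k" for j
    proof (intro ext)
      fix x y
      have "\<sigma> (h j) \<in> \<sigma> ` S'" using hS[OF j] by (rule imageI)
      then have "\<sigma> (h j) \<noteq> h i" using S'(2) hS[OF i] by (metis disjoint_iff)
      then have st: "E (h j) (astar T e) = 0" using Ee[of "\<sigma> (h j)"] hS[OF j] by (simp add: \<sigma>_star)
      have ej: "E (h j) e = (if j = i then 1 else 0)"
        using Ee[of "h j"] hS[OF j] h i j by (auto simp: bij_betw_def inj_on_def)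
      have ee: "E p (e_mat r t z x y) = e_mat r t (E p z) x y" for p r t z
        by (simp add: e_mat_def E_lin)
      show "\<Psi> j (F a b (ascale T c e)) x y = (if j = i then Y else (\<lambda>a b. 0)) x y"
        unfolding \<Psi>_def F_def E_lin ee star_scale st ej Y by (simp add: e_mat_def)
    qed
    then show "\<exists>X\<in>G. \<forall>j<k. \<Psi> j X = (if j = i then Y else (\<lambda>a b. 0))"
      by (intro bexI[of _ "F a b (ascale T c e)"] F_G Y) blast
  qed
  moreover have "(gl (2 * n) complex_algebra)\<lparr>lcarrier := lcarrier (sl (2 * n))\<rparr> = sl (2 * n)"
    by (simp add: sl_def)
  ultimately show ?thesis by (metis (no_types))
qed

end

text \<open>The case of a monomial in \<open>E_star\<close> below, a finite check on parities for
  each triple. For \<open>\<theta>1 = -1\<close> the involution negates \<open>t1\<close> and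
  exchanges its two eigenvectors, which is why \<open>kp\<close> swaps 0 and 1.\<close>

lemma star_coefficient:
  fixes q \<theta>1 \<theta>2 :: complex and m u v :: nat and kp :: "nat \<Rightarrow> nat"
  assumes "q = 1 \<and> m = 1 \<and> \<theta>1 = 1 \<and> \<theta>2 = 1 \<or>
      q = -1 \<and> m = 2 \<and> (\<theta>1, \<theta>2) \<in> {(1, 1), (1, -1), (-1, -1)}"
    and "u < m" "v < m" and kp: "\<And>u. kp u = (if \<theta>1 = 1 then u else 1 - u)"
  shows "\<theta>1 powi a * \<theta>2 powi b * q powi (a * b) * (q powi (int (kp v) * a) *
        (if int m dvd int (kp v) + b - int (kp u) then 1 else 0)) =
      \<theta>2 ^ u * \<theta>2 ^ v * (q powi (int u * a) * (if int m dvd int u + b - int v then 1 else 0))"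
proof -
  consider "q = 1" "m = 1" "\<theta>1 = 1" "\<theta>2 = 1" | "q = -1" "m = 2" "\<theta>1 = 1" "\<theta>2 = 1"
    | "q = -1" "m = 2" "\<theta>1 = 1" "\<theta>2 = -1" | "q = -1" "m = 2" "\<theta>1 = -1" "\<theta>2 = -1"
    using assms(1) by blast
  then show ?thesis
    using assms(2,3)
    by cases (cases "even a"; cases "even b"; auto simp: kp less_2_cases_iff minus_one_powi)+
qed

section \<open>The remaining triples\<close>

context torus_rep
begin

lemma quotient_g_lie:
  assumes type: "q = -1 \<or> (q, \<theta>1, \<theta>2) = (1, 1, 1)"
  shows "\<exists>k. lie_isomorphic (lie_quotient (g_lie n \<rho> T) (lie_annihilator (g_lie n \<rho> T) \<phi>))
    (lie_power (g_lie (m * n) (\<theta>1 * \<rho>) complex_algebra) k)"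
proof -
  have \<theta>\<rho>: "\<theta>1 * \<rho> = 1 \<or> \<theta>1 * \<rho> = -1" using signs rho by auto
  have "n \<le> m * n" using q_cases by auto
  then have mn: "3 \<le> m * n" using n3 by linarith
  interpret C: unitary complex_algebra "m * n" "\<theta>1 * \<rho>" "{(1, 1)}"
    by (rule unitary_complex) (use mn \<theta>\<rho> in auto)
  obtain S where S: "finite S" "\<And>\<alpha> \<beta>. (\<alpha>, \<beta>) \<in> S \<Longrightarrow> \<alpha> \<noteq> 0 \<and> \<beta> \<noteq> 0"
    "inj_on (\<lambda>p. (fst p ^ m, snd p ^ m)) S"
    "\<And>a. a \<in> J \<longleftrightarrow> (\<forall>(\<alpha>, \<beta>)\<in>S. \<forall>u<m. \<forall>v<m. ev \<alpha> \<beta> u v a = 0)"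
    by (rule J_points) blast
  define k where "k = card S"
  obtain h where h: "bij_betw h {..<k} S"
    using ex_bij_betw_nat_finite[OF S(1)] by (auto simp: k_def lessThan_atLeast0)
  have hS: "h i \<in> S" if "i < k" for i using h that by (auto simp: bij_betw_def)
  define E where "E i = ev (fst (h i)) (snd (h i))" for i
  have nzE: "fst (h i) \<noteq> 0" "snd (h i) \<noteq> 0" if "i < k" for i
    using hS[OF that] S(2)[of "fst (h i)" "snd (h i)"] by auto
  have E_mult: "E i u v (torus_mult q x y) = (\<Sum>w<m. E i u w x * E i w v y)" if "i < k" for i u v x y
    unfolding E_def by (rule ev_mult[OF nzE[OF that]])
  have E_lin: "E i u v 0 = 0" "E i u v (x + y) = E i u v x + E i u v y"
    "E i u v (ascale T c x) = c * E i u v x" "E i u v (- x) = - E i u v x"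
    "E i u v (x - y) = E i u v x - E i u v y" "E i u v (sum f A) = (\<Sum>x\<in>A. E i u v (f x))"
    for i u v x y c f and A :: "nat set"
    by (simp_all add: E_def T_simps)
  have J: "a \<in> J \<longleftrightarrow> (\<forall>i<k. \<forall>u<m. \<forall>v<m. E i u v a = 0)" for a
  proof -
    have "S = h ` {..<k}" using h by (simp add: bij_betw_def)
    then show ?thesis unfolding S(4) E_def by (simp add: case_prod_unfold lessThan_def)
  qed

  text \<open>The involution of the torus is, in the representation \<open>ev\<close>, the transpose conjugated by the
    monomial matrix that sends the \<open>u\<close>-th basis vector to $\theta_2^u$ times the \<open>kp u\<close>-th one.\<close>

  define kp where "kp u = (if \<theta>1 = 1 then u else 1 - u)" for u :: nat
  \<comment> \<open>The third identity says that the monomial matrix is symmetric or antisymmetric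
    according to \<theta>1.\<close>
  have kp: "kp u < m" "kp (kp u) = u" "\<theta>2 ^ kp u = \<theta>1 * \<theta>2 ^ u" if "u < m" for u
    using that type params q_cases by (auto simp: kp_def torus_params_def less_2_cases_iff)
  have E_star: "E i (kp v) (kp u) (astar T x) = \<theta>2 ^ u * \<theta>2 ^ v * E i u v x" if uv: "u < m" "v < m" for i u v x
  proof (induction x rule: torus_induct)
    case (single k c)
    obtain a b where k: "k = (a, b)" by (cases k)
    have "\<theta>1 powi a * \<theta>2 powi b * q powi (a * b) * (q powi (int (kp v) * a) *
          (if int m dvd int (kp v) + b - int (kp u) then 1 else 0)) =
        \<theta>2 ^ u * \<theta>2 ^ v * (q powi (int u * a) * (if int m dvd int u + b - int v then 1 else 0))"
      by (rule star_coefficient) (use uv type params q_cases in \<open>auto simp: kp_def torus_params_def\<close>)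
    from arg_cong[OF this, of "\<lambda>z. fst (h i) powi a * snd (h i) powi b * c * z"] show ?case
      unfolding k E_def T_simps torus_star_single fst_conv snd_conv ev_single
      by (simp only: mult_ac)
  qed (simp_all add: E_lin T_simps torus_star_add distrib_left)
  have \<theta>2sq: "\<theta>2 ^ u * \<theta>2 ^ u = 1" for u
    using signs by (auto simp: power_mult_distrib[symmetric])

  \<comment> \<open>Matrix indices start at 1, offsets within a block at 0. Truncated subtraction
    gives \<open>blk 0 = 1\<close>, hence the explicit bound \<open>1 \<le> a\<close> in
    \<open>Cidx\<close>.\<close>
  define blk off where "blk a = (a - 1) div m + 1" and "off a = (a - 1) mod m" for a
  define pos where "pos p u = m * (p - 1) + u + 1" for p u
  have off: "off a < m" for a by (simp add: off_def)
  have pos_blk: "pos (blk a) (off a) = a" if "1 \<le> a" for a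
    using that by (simp add: pos_def blk_def off_def)
  have blk_pos: "blk (pos p u) = p" "off (pos p u) = u" if "1 \<le> p" "u < m" for p u
    using that by (simp_all add: pos_def blk_def off_def)
  have blk1: "1 \<le> blk a" for a by (simp add: blk_def)
  have blk_le: "blk a \<le> l \<longleftrightarrow> a \<le> m * l" if "1 \<le> a" for a l
  proof -
    have "blk a \<le> l \<longleftrightarrow> (a - 1) div m < l" by (auto simp: blk_def)
    also have "\<dots> \<longleftrightarrow> a - 1 < l * m" by (rule div_less_iff_less_mult) simp
    finally show ?thesis using that by (auto simp: mult.commute)
  qed
  have Cidx: "a \<in> C.idx \<longleftrightarrow> 1 \<le> a \<and> blk a \<in> idx" for a
    unfolding C.idx_def idx_def using blk1[of a] blk_le[of a "2 * n"] by (auto simp: ac_simps)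
  have pos_idx: "pos p u \<in> C.idx" if "p \<in> idx" "u < m" for p u
    using that blk_pos[of p u] unfolding Cidx by (auto simp: idx_def pos_def)
  have Cpr: "blk (C.pr a) = pr (blk a)" "off (C.pr a) = off a" if a: "a \<in> C.idx" for a
  proof -
    have 1: "1 \<le> a" "1 \<le> blk a" using a Cidx blk1 by auto
    have le: "a \<le> m * n \<longleftrightarrow> blk a \<le> n" using blk_le[OF 1(1), of n] by simp
    have eq: "a = pos (blk a) (off a)" using pos_blk[OF 1(1)] by simp
    have "C.pr a = pos (pr (blk a)) (off a)"
    proof (cases "blk a \<le> n")
      case True
      then have "C.pr a = a + m * n" using le by (simp add: C.pr_def)
      also have "\<dots> = pos (blk a + n) (off a)"
      proof -
        obtain d where "blk a = Suc d" using 1 by (cases "blk a") auto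
        then show ?thesis by (subst eq) (simp add: pos_def distrib_left)
      qed
      finally show ?thesis using True by (simp add: pr_def)
    next
      case False
      then have "C.pr a = a - m * n" using le by (simp add: C.pr_def)
      also have "\<dots> = pos (blk a - n) (off a)"
      proof -
        obtain d where "blk a = Suc (n + d)" using False less_imp_Suc_add[of n "blk a"] by auto
        then show ?thesis by (subst eq) (simp add: pos_def distrib_left)
      qed
      finally show ?thesis using False by (simp add: pr_def)
    qed
    moreover have "1 \<le> pr (blk a)" using a Cidx pr_dom[of "blk a"] by (simp add: idx_def)
    ultimately show "blk (C.pr a) = pr (blk a)" "off (C.pr a) = off a" using blk_pos off by auto
  qed
  have sum_blocks: "(\<Sum>c\<in>C.idx. f (blk c) (off c)) = (\<Sum>r\<in>idx. \<Sum>w<m. f r w)" for f :: "nat \<Rightarrow> nat \<Rightarrow> complex"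
  proof -
    have "(\<Sum>c\<in>C.idx. f (blk c) (off c)) = (\<Sum>(r, w)\<in>idx \<times> {..<m}. f r w)"
    proof (rule sum.reindex_bij_witness[where i = "\<lambda>(r, w). pos r w" and j = "\<lambda>c. (blk c, off c)"])
      fix rw assume "rw \<in> idx \<times> {..<m}"
      then show "(case rw of (r, w) \<Rightarrow> pos r w) \<in> C.idx"
        "(blk (case rw of (r, w) \<Rightarrow> pos r w), off (case rw of (r, w) \<Rightarrow> pos r w)) = rw"
        using pos_idx blk_pos by (auto simp: idx_def)
    qed (auto simp: Cidx pos_blk off)
    then show ?thesis by (simp add: sum.cartesian_product)
  qed
  \<comment> \<open>The change of basis: permutation \<kappa> and sign \<chi>, trivial on the first
    \<open>n\<close> blocks.\<close>
  define \<kappa> where "\<kappa> p u = (if p \<le> n then u else kp u)" for p u :: nat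
  define \<chi> where "\<chi> p u = (if p \<le> n then 1 else \<theta>2 ^ u)" for p u :: nat
  have \<kappa>: "\<kappa> p u < m" "\<kappa> p (\<kappa> p u) = u" if "u < m" for p u using that kp by (auto simp: \<kappa>_def)
  have \<kappa>_pr: "\<kappa> (pr p) u = kp (\<kappa> p u)" if "p \<in> idx" "u < m" for p u
    using that kp by (auto simp: \<kappa>_def pr_def idx_def)
  have \<chi>sq: "\<chi> p u * \<chi> p u = 1" for p u by (simp add: \<chi>_def \<theta>2sq)
  \<comment> \<open>The signs of both adjoints meet here: for \<open>p > n\<close> the identity
    \<open>\<theta>2 ^ kp u = \<theta>1 * \<theta>2 ^ u\<close> turns \<rho> into
    \<open>\<theta>1 * \<rho>\<close>.\<close>
  have sign: "eps p * \<chi> (pr p) u * \<theta>2 ^ \<kappa> p u = (if p \<le> n then 1 else \<theta>1 * \<rho>) * \<chi> p u"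
    if "p \<in> idx" "u < m" for p u
    using that kp \<theta>2sq by (auto simp: eps_def \<chi>_def \<kappa>_def pr_def idx_def)
  have Ceps: "C.eps a = (if blk a \<le> n then 1 else \<theta>1 * \<rho>)" if "a \<in> C.idx" for a
    using that Cidx blk_le[of a n] by (simp add: C.eps_def)
  define \<Psi> where "\<Psi> i X = (\<lambda>a b. if a \<in> C.idx \<and> b \<in> C.idx then
      \<chi> (blk a) (off a) * \<chi> (blk b) (off b) *
        E i (\<kappa> (blk a) (off a)) (\<kappa> (blk b) (off b)) (X (blk a) (blk b)) else 0)"
    for i :: nat and X :: "nat \<Rightarrow> nat \<Rightarrow> torus"
  have adj: "eps (blk a) * eps (blk b) * (\<chi> (blk (C.pr b)) (off (C.pr b)) * \<chi> (blk (C.pr a)) (off (C.pr a)) *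
        E i (\<kappa> (blk (C.pr b)) (off (C.pr b))) (\<kappa> (blk (C.pr a)) (off (C.pr a))) (astar T x)) =
      C.eps a * C.eps b * (\<chi> (blk a) (off a) * \<chi> (blk b) (off b) *
        E i (\<kappa> (blk a) (off a)) (\<kappa> (blk b) (off b)) x)"
    if ab: "a \<in> C.idx" "b \<in> C.idx" for a b i x
  proof -
    have idx: "blk a \<in> idx" "blk b \<in> idx" using ab Cidx by auto
    show ?thesis
      unfolding Cpr[OF ab(1)] Cpr[OF ab(2)] \<kappa>_pr[OF idx(1) off] \<kappa>_pr[OF idx(2) off]
        E_star[OF \<kappa>(1)[OF off] \<kappa>(1)[OF off]] Ceps[OF ab(1)] Ceps[OF ab(2)]
      using arg_cong2[OF sign[OF idx(1) off[of a]] sign[OF idx(2) off[of b]],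
        of "\<lambda>y z. y * z * E i (\<kappa> (blk a) (off a)) (\<kappa> (blk b) (off b)) x"]
      by (simp only: mult_ac)
  qed
  have Csimps: "amult complex_algebra = (*)" "ascale complex_algebra = (*)" "astar complex_algebra = (\<lambda>z. z)"
    by (simp_all add: complex_algebra_def)
  have skewC: "C.skew (\<Psi> i X)" if X: "skew X" for i X
    unfolding C.skew_def
  proof (intro ballI)
    fix a b assume ab: "a \<in> C.idx" "b \<in> C.idx"
    have idx: "blk a \<in> idx" "blk b \<in> idx" using ab Cidx by auto
    have x: "X (pr (blk b)) (pr (blk a)) = ascale T (- (eps (blk a) * eps (blk b))) (astar T (X (blk a) (blk b)))"
      using X idx unfolding skew_def by blast
    have "\<Psi> i X (C.pr b) (C.pr a) = \<chi> (blk (C.pr b)) (off (C.pr b)) * \<chi> (blk (C.pr a)) (off (C.pr a)) *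
        E i (\<kappa> (blk (C.pr b)) (off (C.pr b))) (\<kappa> (blk (C.pr a)) (off (C.pr a))) (X (pr (blk b)) (pr (blk a)))"
      using ab C.pr_dom Cpr by (simp add: \<Psi>_def)
    also have "\<dots> = - (C.eps a * C.eps b * \<Psi> i X a b)"
      unfolding x E_lin using adj[OF ab, of i "X (blk a) (blk b)"] ab by (simp add: \<Psi>_def ac_simps)
    finally show "\<Psi> i X (C.pr b) (C.pr a) =
        ascale complex_algebra (- (C.eps a * C.eps b)) (astar complex_algebra (\<Psi> i X a b))"
      by (simp add: Csimps)
  qed
  \<comment> \<open>With the identity involution, pairing \<open>a\<close> with
    \<open>C.pr a\<close> gives \<open>tr = - tr\<close>, so the trace condition in
    \<open>C.G_iff\<close> follows from skewness.\<close>
  have trC: "C.avg (C.tr Y) = 0" if "C.skew Y" for Y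
  proof -
    have "C.tr Y = (\<Sum>a\<in>C.idx. Y (C.pr a) (C.pr a))"
      unfolding C.tr_def by (rule sum.reindex_bij_betw[OF C.bij_pr, symmetric])
    also have "\<dots> = (\<Sum>a\<in>C.idx. - Y a a)"
      using that unfolding C.skew_def by (intro sum.cong refl) (simp add: Csimps)
    also have "\<dots> = - C.tr Y" by (simp add: C.tr_def sum_negf)
    finally have "C.tr Y = 0" by simp
    then show ?thesis by simp
  qed
  \<comment> \<open>Positions in two different blocks come directly from some \<open>F p q\<close>
    with \<open>p \<noteq> q\<close>. Those within one block are brackets through a third block, so
    \<open>\<Gamma>\<close> still generates.\<close>
  define \<Gamma> where "\<Gamma> = {C.F a b c | a b c. a \<in> C.idx \<and> b \<in> C.idx \<and> blk a \<noteq> blk b}"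
  have "lie_isomorphic (lie_quotient (g_lie n \<rho> T) (lie_annihilator (g_lie n \<rho> T) \<phi>))
    (lie_power ((gl (2 * (m * n)) complex_algebra)\<lparr>lcarrier := C.G\<rparr>) k)"
  proof (rule annihilator_quotient_power[where \<Psi> = \<Psi> and \<Gamma> = \<Gamma>])
    show "lie_subalgebra C.G (gl (2 * (m * n)) complex_algebra)" by (rule C.subalgebra_G)
    show "\<Gamma> \<subseteq> C.G" using C.F_G by (auto simp: \<Gamma>_def)
    show "C.G \<subseteq> H" if H: "lie_subalgebra H (gl (2 * (m * n)) complex_algebra)" and gen: "\<Gamma> \<subseteq> H" for H
    proof (rule C.G_minimal[OF H], rule subsetI)
      fix Y assume "Y \<in> C.gens"
      then obtain a b c where Y: "a \<in> C.idx" "b \<in> C.idx" "a \<noteq> b" "Y = C.F a b c" by (rule C.gens_F)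
      have mem: "C.F x y z \<in> H" if "x \<in> C.idx" "y \<in> C.idx" "blk x \<noteq> blk y" for x y z
        using gen that unfolding \<Gamma>_def by blast
      show "Y \<in> H"
      proof (cases "blk a = blk b")
        case False
        then show ?thesis using Y mem by simp
      next
        case True
        obtain r where r: "r \<in> idx" "r \<noteq> blk a" "r \<noteq> pr (blk a)" using third_index Y(1) Cidx by metis
        define d where "d = pos r 0"
        have d: "d \<in> C.idx" "blk d = r" using r pos_idx blk_pos[of r 0] by (auto simp: d_def idx_def)
        have ne: "d \<noteq> C.pr x" "d \<noteq> x" if "x \<in> C.idx" "blk x = blk a" for x
          using that d r Cpr by auto
        have g: "C.good a d" "C.good d b"
          using ne[of a] ne[of b] Y d True C.good_sym(1)[of b d] by (auto simp: C.good_def)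
        have "C.F a d c \<in> H" "C.F d b 1 \<in> H" using mem Y d r True by simp_all
        then have "C.br (C.F a d c) (C.F d b 1) \<in> H" using H unfolding lie_subalgebra_def by blast
        moreover have "C.br (C.F a d c) (C.F d b 1) = C.F a b c"
          using C.br_FF_good[OF g, of c 1] Y by (simp add: Csimps)
        ultimately show ?thesis using Y by simp
      qed
    qed
    fix i X assume i: "i < k" and X: "X \<in> G"
    have "\<Psi> i X \<in> lcarrier (gl (2 * (m * n)) complex_algebra)" by (auto simp: C.gl_simps \<Psi>_def)
    then show "\<Psi> i X \<in> C.G" using skewC[OF G_skew(1)[OF X]] trC by (auto simp: C.G_iff)
    show "\<Psi> i (\<lambda>a b. ascale T c (X a b)) = (\<lambda>a b. c * \<Psi> i X a b)" for c
      unfolding \<Psi>_def E_lin by (intro ext) simp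
    fix Y assume Y: "Y \<in> G"
    show "\<Psi> i (\<lambda>a b. X a b + Y a b) = (\<lambda>a b. \<Psi> i X a b + \<Psi> i Y a b)"
      unfolding \<Psi>_def E_lin by (intro ext) (simp add: distrib_left)
    show "\<Psi> i (br X Y) = C.br (\<Psi> i X) (\<Psi> i Y)"
    proof (intro ext)
      fix a b
      \<comment> \<open>At the inner index the signs square to 1 and \<kappa> only permutes the
        summation.\<close>
      have prod: "(\<Sum>c\<in>C.idx. \<Psi> i X a c * \<Psi> i Y c b) = \<chi> (blk a) (off a) * \<chi> (blk b) (off b) *
          E i (\<kappa> (blk a) (off a)) (\<kappa> (blk b) (off b)) (\<Sum>l\<in>idx. amult T (X (blk a) l) (Y l (blk b)))"
        if ab: "a \<in> C.idx" "b \<in> C.idx" for X Y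
      proof -
        let ?e = "\<lambda>u x. E i (\<kappa> (blk a) (off a)) u x" and ?e' = "\<lambda>u y. E i u (\<kappa> (blk b) (off b)) y"
        let ?c = "\<chi> (blk a) (off a) * \<chi> (blk b) (off b)"
        have "(\<Sum>c\<in>C.idx. \<Psi> i X a c * \<Psi> i Y c b) =
            (\<Sum>c\<in>C.idx. ?c * (?e (\<kappa> (blk c) (off c)) (X (blk a) (blk c)) *
              ?e' (\<kappa> (blk c) (off c)) (Y (blk c) (blk b))))"
        proof (intro sum.cong refl)
          fix c assume "c \<in> C.idx"
          then have "\<Psi> i X a c * \<Psi> i Y c b = (\<chi> (blk c) (off c) * \<chi> (blk c) (off c)) *
              (?c * (?e (\<kappa> (blk c) (off c)) (X (blk a) (blk c)) *
                ?e' (\<kappa> (blk c) (off c)) (Y (blk c) (blk b))))"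
            using ab by (simp add: \<Psi>_def)
          then show "\<Psi> i X a c * \<Psi> i Y c b = ?c * (?e (\<kappa> (blk c) (off c)) (X (blk a) (blk c)) *
              ?e' (\<kappa> (blk c) (off c)) (Y (blk c) (blk b)))"
            by (simp add: \<chi>sq)
        qed
        also have "\<dots> = (\<Sum>r\<in>idx. \<Sum>w<m. ?c * (?e (\<kappa> r w) (X (blk a) r) * ?e' (\<kappa> r w) (Y r (blk b))))"
          by (rule sum_blocks)
        also have "\<dots> = (\<Sum>r\<in>idx. \<Sum>w<m. ?c * (?e w (X (blk a) r) * ?e' w (Y r (blk b))))"
        proof (rule sum.cong[OF refl])
          fix r
          have "bij_betw (\<kappa> r) {..<m} {..<m}"
            by (rule bij_betw_byWitness[where f' = "\<kappa> r"]) (use \<kappa> in auto)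
          then show "(\<Sum>w<m. ?c * (?e (\<kappa> r w) (X (blk a) r) * ?e' (\<kappa> r w) (Y r (blk b)))) =
              (\<Sum>w<m. ?c * (?e w (X (blk a) r) * ?e' w (Y r (blk b))))"
            by (rule sum.reindex_bij_betw)
        qed
        finally show ?thesis by (simp add: E_lin T_simps(1) E_mult[OF i] sum_distrib_left)
      qed
      show "\<Psi> i (br X Y) a b = C.br (\<Psi> i X) (\<Psi> i Y) a b"
      proof (cases "a \<in> C.idx \<and> b \<in> C.idx")
        case True
        then have "\<Psi> i (br X Y) a b = \<chi> (blk a) (off a) * \<chi> (blk b) (off b) *
            (E i (\<kappa> (blk a) (off a)) (\<kappa> (blk b) (off b)) (\<Sum>l\<in>idx. amult T (X (blk a) l) (Y l (blk b))) -
             E i (\<kappa> (blk a) (off a)) (\<kappa> (blk b) (off b)) (\<Sum>l\<in>idx. amult T (Y (blk a) l) (X l (blk b))))"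
          by (simp add: \<Psi>_def gl_simps(5) E_lin(5))
        then show ?thesis
          unfolding C.gl_simps(5) Csimps using True prod[of X Y] prod[of Y X]
          by (simp only: right_diff_distrib)
      next
        case False
        then show ?thesis by (auto simp: C.gl_simps(5) Csimps \<Psi>_def)
      qed
    qed
  next
    fix X assume X: "X \<in> G"
    have "X \<in> lie_annihilator (g_lie n \<rho> T) \<phi> \<longleftrightarrow> (\<forall>p q. \<forall>i<k. \<forall>u<m. \<forall>v<m. E i u v (X p q) = 0)"
      using I_iff[of X] X J by simp
    also have "\<dots> \<longleftrightarrow> (\<forall>i<k. \<Psi> i X = (\<lambda>a b. 0))"
    proof
      assume "\<forall>p q. \<forall>i<k. \<forall>u<m. \<forall>v<m. E i u v (X p q) = 0"
      then show "\<forall>i<k. \<Psi> i X = (\<lambda>a b. 0)"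
        unfolding \<Psi>_def using \<kappa>(1)[OF off] by (intro allI impI ext) simp
    next
      assume *: "\<forall>i<k. \<Psi> i X = (\<lambda>a b. 0)"
      have "E i u v (X p q) = 0" if i: "i < k" and uv: "u < m" "v < m" for p q i u v
      proof (cases "p \<in> idx \<and> q \<in> idx")
        case True
        define a b where "a = pos p (\<kappa> p u)" and "b = pos q (\<kappa> q v)"
        have ab: "a \<in> C.idx" "b \<in> C.idx" using True uv \<kappa> pos_idx by (auto simp: a_def b_def)
        have bo: "blk a = p" "off a = \<kappa> p u" "blk b = q" "off b = \<kappa> q v"
          using True uv \<kappa> blk_pos by (auto simp: a_def b_def idx_def)
        have "\<Psi> i X a b = 0" using * i by simp
        then have "\<chi> p (\<kappa> p u) * \<chi> q (\<kappa> q v) * E i u v (X p q) = 0"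
          using ab uv by (simp add: \<Psi>_def bo \<kappa>)
        moreover have "\<chi> p u \<noteq> 0" for p u using \<chi>sq[of p u] by auto
        ultimately show ?thesis by simp
      next
        case False
        then have "X p q = 0" using G_closed(5)[OF X] by (auto simp: gl_simps)
        then show ?thesis by (simp add: E_lin)
      qed
      then show "\<forall>p q. \<forall>i<k. \<forall>u<m. \<forall>v<m. E i u v (X p q) = 0" by blast
    qed
    finally show "X \<in> lie_annihilator (g_lie n \<rho> T) \<phi> \<longleftrightarrow> (\<forall>i<k. \<Psi> i X = (\<lambda>a b. 0))" .
  next
    fix i Y assume i: "i < k" and "Y \<in> \<Gamma>"
    then obtain a b c where Y: "Y = C.F a b c" "a \<in> C.idx" "b \<in> C.idx" "blk a \<noteq> blk b"
      by (auto simp: \<Gamma>_def)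
    define p q' u v where "p = blk a" and "q' = blk b" and "u = \<kappa> (blk a) (off a)" and "v = \<kappa> (blk b) (off b)"
    have uv: "u < m" "v < m" using \<kappa>(1)[OF off] by (auto simp: u_def v_def)
    have pq: "p \<in> idx" "q' \<in> idx" "p \<noteq> q'" using Y Cidx by (auto simp: p_def q'_def)
    obtain e where e: "\<And>\<alpha> \<beta> w x. (\<alpha>, \<beta>) \<in> S \<Longrightarrow> w < m \<Longrightarrow> x < m \<Longrightarrow>
        ev \<alpha> \<beta> w x e = (if (\<alpha>, \<beta>) = h i \<and> w = u \<and> x = v then 1 else 0)"
      by (rule interpolation[OF S(1,2,3) hS[OF i] uv], assumption, rule that)
    have Ee: "E j w x e = (if j = i \<and> w = u \<and> x = v then 1 else 0)" if "j < k" "w < m" "x < m" for j w x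
      using e[of "fst (h j)" "snd (h j)" w x] that hS[of j] h i
      by (auto simp: E_def bij_betw_def inj_on_def)
    \<comment> \<open>The factors \<chi> cancel those in \<open>\<Psi>\<close>, as \<chi> squares to
      1.\<close>
    define x0 where "x0 = ascale T (c * \<chi> (blk a) (off a) * \<chi> (blk b) (off b)) e"
    have "\<Psi> j (F p q' x0) = (if j = i then Y else (\<lambda>a b. 0))" if j: "j < k" for j
    proof (intro ext)
      fix A B
      \<comment> \<open>The image of the bare matrix unit. The mirror part of \<open>F\<close> is
        its adjoint, and \<open>adj\<close> translates adjoints over the torus into adjoints over
        the complex numbers.\<close>
      define Z where "Z A B = \<chi> (blk A) (off A) * \<chi> (blk B) (off B) *
          E j (\<kappa> (blk A) (off A)) (\<kappa> (blk B) (off B)) (e_mat p q' x0 (blk A) (blk B))" for A B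
      have Z: "Z A B = e_mat a b (if j = i then c else 0) A B" if AB: "A \<in> C.idx" "B \<in> C.idx" for A B
      proof (cases "blk A = p \<and> blk B = q'")
        case True
        have inj: "\<kappa> (blk x) (off x) = \<kappa> (blk y) (off y) \<longleftrightarrow> x = y"
          if "x \<in> C.idx" "y \<in> C.idx" "blk x = blk y" for x y
          using that \<kappa>(2)[OF off] pos_blk Cidx by metis
        have eqs: "\<kappa> (blk A) (off A) = u \<longleftrightarrow> A = a" "\<kappa> (blk B) (off B) = v \<longleftrightarrow> B = b"
          unfolding u_def v_def using AB Y True by (intro inj; simp add: p_def q'_def)+
        have x0: "e_mat p q' x0 (blk A) (blk B) = x0" using True by (simp add: e_mat_def)
        have "Z A B = \<chi> (blk A) (off A) * \<chi> (blk B) (off B) * (c * \<chi> (blk a) (off a) * \<chi> (blk b) (off b) *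
            (if j = i \<and> A = a \<and> B = b then 1 else 0))"
          unfolding Z_def x0 unfolding x0_def E_lin Ee[OF j \<kappa>(1)[OF off] \<kappa>(1)[OF off]] eqs ..
        moreover have "\<chi> (blk a) (off a) * \<chi> (blk b) (off b) * (c * \<chi> (blk a) (off a) * \<chi> (blk b) (off b)) =
            (\<chi> (blk a) (off a) * \<chi> (blk a) (off a)) * (\<chi> (blk b) (off b) * \<chi> (blk b) (off b)) * c"
          by (simp only: mult_ac)
        ultimately show ?thesis by (auto simp: e_mat_def \<chi>sq)
      next
        case False
        then show ?thesis by (auto simp: Z_def e_mat_def E_lin p_def q'_def)
      qed
      show "\<Psi> j (F p q' x0) A B = (if j = i then Y else (\<lambda>a b. 0)) A B"
      proof (cases "A \<in> C.idx \<and> B \<in> C.idx")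
        case True
        then have AB: "A \<in> C.idx" "B \<in> C.idx" "C.pr A \<in> C.idx" "C.pr B \<in> C.idx"
          and idx: "blk A \<in> idx" "blk B \<in> idx" using Cidx C.pr_dom by auto
        let ?x = "e_mat p q' x0 (pr (blk B)) (pr (blk A))"
        have "eps (pr (blk B)) * eps (pr (blk A)) = eps (blk A) * eps (blk B)"
          using idx by (simp add: eps_pr ac_simps)
        moreover have "C.eps (C.pr B) * C.eps (C.pr A) = C.eps A * C.eps B"
        proof -
          have "(r * x) * (r * y) = (r * r) * (y * x)" for r x y :: complex by (simp only: mult_ac)
          then show ?thesis unfolding C.eps_pr[OF AB(1)] C.eps_pr[OF AB(2)] by (simp only: C.rho_sq mult_1)
        qed
        ultimately have "eps (blk A) * eps (blk B) * (\<chi> (blk A) (off A) * \<chi> (blk B) (off B) *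
            E j (\<kappa> (blk A) (off A)) (\<kappa> (blk B) (off B)) (astar T ?x)) =
            C.eps A * C.eps B * Z (C.pr B) (C.pr A)"
          using adj[OF AB(4,3), of j ?x] AB by (simp add: Z_def Cpr)
        then have "\<Psi> j (F p q' x0) A B = Z A B - C.eps A * C.eps B * Z (C.pr B) (C.pr A)"
          using AB by (simp add: \<Psi>_def F_adjoint[OF pq(1,2) idx] E_lin right_diff_distrib Z_def
            mult.left_commute)
        also have "\<dots> = C.F a b (if j = i then c else 0) A B"
          unfolding C.F_adjoint[OF Y(2,3) AB(1,2)] Csimps Z[OF AB(1,2)] Z[OF AB(4,3)] ..
        finally show ?thesis using Y C.F_zero by simp
      next
        case False
        then have "C.F a b c A B = 0" using C.F_gl[OF Y(2,3)] by (auto simp: C.gl_simps)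
        then show ?thesis using False Y by (auto simp: \<Psi>_def)
      qed
    qed
    then show "\<exists>X\<in>G. \<forall>j<k. \<Psi> j X = (if j = i then Y else (\<lambda>a b. 0))"
      by (intro bexI[of _ "F p q' x0"] F_G pq) blast
  qed
  moreover have "(gl (2 * (m * n)) complex_algebra)\<lparr>lcarrier := C.G\<rparr> = g_lie (m * n) (\<theta>1 * \<rho>) complex_algebra"
    by (simp add: g_lie_def lie_generate_def)
  ultimately show ?thesis by (metis (no_types))
qed

end

theorem theorem5p3:
  fixes n :: nat and \<rho> q \<theta>1 \<theta>2 :: complex
    and s :: "complex \<Rightarrow> 'v::ab_group_add \<Rightarrow> 'v" and Basis :: "'v set"
    and \<phi> :: "(nat \<Rightarrow> nat \<Rightarrow> torus) \<Rightarrow> 'v \<Rightarrow> 'v"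
  assumes "3 \<le> n" and "\<rho> \<in> {1, -1}" and "(q, \<theta>1, \<theta>2) \<in> torus_params"
    and "finite_dimensional_vector_space s Basis"
    and "lie_irreducible (g_lie n \<rho> (quantum_torus q \<theta>1 \<theta>2)) s \<phi>"
    and "2 \<le> vector_space.dim s (UNIV :: 'v set)"
  shows
    "(q = -1 \<or> (q, \<theta>1, \<theta>2) = (1, 1, 1) \<longrightarrow>
       (\<exists>k::nat. lie_isomorphic
          (lie_quotient (g_lie n \<rho> (quantum_torus q \<theta>1 \<theta>2))
             (lie_annihilator (g_lie n \<rho> (quantum_torus q \<theta>1 \<theta>2)) \<phi>))
          (lie_power (g_lie (mult_order q * n) (\<theta>1 * \<rho>) complex_algebra) k))) \<and>
     ((q, \<theta>1, \<theta>2) = (1, 1, -1) \<or> (q, \<theta>1, \<theta>2) = (1, -1, -1) \<longrightarrow>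
       (\<exists>k::nat. lie_isomorphic
          (lie_quotient (g_lie n \<rho> (quantum_torus q \<theta>1 \<theta>2))
             (lie_annihilator (g_lie n \<rho> (quantum_torus q \<theta>1 \<theta>2)) \<phi>))
          (lie_power (sl (2 * n)) k)))"
proof -
  interpret t: torus q \<theta>1 \<theta>2 by standard (rule assms)
  interpret torus_rep q \<theta>1 \<theta>2 n \<rho> s Basis \<phi>
    by (intro torus_rep.intro unitary_rep.intro unitary_rep_axioms.intro t.torus_axioms t.unitary_torus)
       (use assms in auto)
  show ?thesis using quotient_g_lie quotient_sl by (auto simp: t.m_def)
qed

end
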